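(* Let $G$ be a finite non-abelian group. The commuting graph $\Gamma(G)$ has maximum vertex degree $<5$ if and only if $G$ is isomorphic to one of the following groups: $S_3$, $D_{10}$, $A_4$, $\mathrm{GA}(1,5)$, $A_5$; $D_8$, $Q_8$; $D_{12}$, $C_3\rtimes C_4$, $\mathrm{SL}(2,3)$; $(C_4\times C_2)\rtimes C_2$, $C_4\rtimes C_4$, $C_8\rtimes C_2$, $D_8\times C_2$, $Q_8\times C_2$, $D_8\circ_{C_2}C_4$.
   Context: For a finite non-abelian group $G$ with center $Z(G)$, the commuting graph $\Gamma(G)$ is the simple graph whose vertex set is $G\setminus Z(G)$ and in which two distinct vertices $x,y$ are adjacent if and only if $xy=yx$. Notation for groups: $C_n$ is the cyclic group of order $n$; $D_{2n}$ is the dihedral group of order $2n$ (so $D_8,D_{10},D_{12}$ have orders $8,10,12$); $Q_8$ is the quaternion group of order 8; $S_3$, $A_4$, $A_5$ are symmetric and alternating groups; $\mathrm{GA}(1,5)$ is the group of all affine maps $t\mapsto at+b$ ($a\in\mathbb{F}_5^\times$, $b\in\mathbb{F}_5$) of $\mathbb{F}_5$, of order 20; $\mathrm{SL}(2,3)$ is the group of $2\times 2$ matrices of determinant 1 over $\mathbb{F}_3$. $C_3\rtimes C_4$ is the semidirect product in which a generator of $C_4$ acts on $C_3$ by inversion. The groups $(C_4\times C_2)\rtimes C_2$, $C_4\rtimes C_4$, $C_8\rtimes C_2$ denote the following non-abelian groups of order 16 with center of order 4: $(C_4\times C_2)\rtimes C_2=\langle a,b,c\mid a^4=b^2=c^2=1,\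 ab=ba,\ bc=cb,\ cac^{-1}=ab\rangle$; $C_4\rtimes C_4=\langle a,b\mid a^4=b^4=1,\ bab^{-1}=a^{-1}\rangle$; $C_8\rtimes C_2=\langle a,b\mid a^8=b^2=1,\ bab^{-1}=a^5\rangle$. $D_8\circ_{C_2}C_4$ is the central product of $D_8$ and $C_4$ over $C_2$, i.e. the quotient of $D_8\times C_4$ identifying the center of $D_8$ with the subgroup of order 2 of $C_4$. *)

theory Defs
  imports
    "HOL-Algebra.Algebra"
    "HOL-Number_Theory.Residues"
    "Graph_Theory.Pair_Digraph"
begin

section \<open>The commuting graph\<close>

definition center :: "('a, 'b) monoid_scheme \<Rightarrow> 'a set" where
  "center G = {z \<in> carrier G. \<forall>g \<in> carrier G. z \<otimes>\<^bsub>G\<^esub> g = g \<otimes>\<^bsub>G\<^esub> z}"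

definition commuting_graph :: "('a, 'b) monoid_scheme \<Rightarrow> 'a pair_pre_digraph" where
  "commuting_graph G =
    \<lparr>pverts = carrier G - center G,
     parcs = {(x, y). x \<in> carrier G - center G \<and> y \<in> carrier G - center G \<and>
                      x \<noteq> y \<and> x \<otimes>\<^bsub>G\<^esub> y = y \<otimes>\<^bsub>G\<^esub> x}\<rparr>"

text \<open>The locale \<^locale>\<open>pair_graph\<close> describes finite simple undirected graphs; each edge is
  represented by its two opposite arcs, so the degree of a vertex is its \<^const>\<open>out_degree\<close>.\<close>

lemma pair_graph_commuting_graph:
  assumes "finite (carrier G)"
  shows "pair_graph (commuting_graph G)"
proof
  show "finite (parcs (commuting_graph G))"
    by (rule finite_subset[of _ "carrier G \<times> carrier G"])
      (use assms in \<open>auto simp: commuting_graph_def\<close>)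
qed (use assms in \<open>auto simp: commuting_graph_def symmetric_def intro!: symI\<close>)

text \<open>Meaningful for finite graphs with at least one vertex.\<close>

definition max_degree :: "('a, 'b) pre_digraph \<Rightarrow> nat" where
  "max_degree \<Gamma> = Max (out_degree \<Gamma> ` verts \<Gamma>)"


section \<open>Semidirect and central products\<close>

definition semidirect_product ::
  "('a, 'c) monoid_scheme \<Rightarrow> ('b, 'd) monoid_scheme \<Rightarrow> ('b \<Rightarrow> 'a \<Rightarrow> 'a) \<Rightarrow> ('a \<times> 'b) monoid" where
  "semidirect_product N H \<phi> =
    \<lparr>carrier = carrier N \<times> carrier H,
     monoid.mult = (\<lambda>(n, h) (n', h'). (n \<otimes>\<^bsub>N\<^esub> \<phi> h n', h \<otimes>\<^bsub>H\<^esub> h')),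
     one = (\<one>\<^bsub>N\<^esub>, \<one>\<^bsub>H\<^esub>)\<rparr>"

text \<open>The action on an abelian group \<open>N\<close> of a cyclic group \<^term>\<open>integer_mod_group m\<close> of
  even order, in which the generator \<open>1\<close> acts by inversion.\<close>

definition inversion_action :: "('a, 'b) monoid_scheme \<Rightarrow> int \<Rightarrow> 'a \<Rightarrow> 'a" where
  "inversion_action N k = (m_inv N) ^^ nat k"

text \<open>The quotient of \<open>G \<times> H\<close> that identifies each \<open>z\<close> in the central subgroup \<open>Z\<close> of \<open>G\<close>
  with its image \<open>\<theta> z\<close> in the center of \<open>H\<close>.\<close>

definition central_product ::
  "('a, 'c) monoid_scheme \<Rightarrow> ('b, 'd) monoid_scheme \<Rightarrow> 'a set \<Rightarrow> ('a \<Rightarrow> 'b) \<Rightarrow> ('a \<times> 'b) set monoid" where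
  "central_product G H Z \<theta> = (G \<times>\<times> H) Mod ((\<lambda>z. (z, inv\<^bsub>H\<^esub> (\<theta> z))) ` Z)"


section \<open>Groups given by generators and relations\<close>

text \<open>A word is a list of letters \<open>(g, True)\<close>, standing for the generator \<open>g\<close>, and
  \<open>(g, False)\<close>, standing for its formal inverse. The generators are all the elements of the
  type \<open>'g\<close>, and a pair \<open>(u, v)\<close> of words in \<open>R\<close> stands for the relation \<open>u = v\<close>.\<close>

type_synonym 'g word = "('g \<times> bool) list"

inductive pres_eq :: "('g word \<times> 'g word) set \<Rightarrow> 'g word \<Rightarrow> 'g word \<Rightarrow> bool"
  for R :: "('g word \<times> 'g word) set" where
  pres_refl: "pres_eq R u u"
| pres_sym: "pres_eq R u v \<Longrightarrow> pres_eq R v u"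
| pres_trans: "pres_eq R u v \<Longrightarrow> pres_eq R v w \<Longrightarrow> pres_eq R u w"
| pres_append: "pres_eq R u u' \<Longrightarrow> pres_eq R v v' \<Longrightarrow> pres_eq R (u @ v) (u' @ v')"
| pres_cancel: "pres_eq R [(g, s), (g, \<not> s)] []"
| pres_rel: "(u, v) \<in> R \<Longrightarrow> pres_eq R u v"

definition presented_group :: "('g word \<times> 'g word) set \<Rightarrow> 'g word set monoid" where
  "presented_group R =
    \<lparr>carrier = UNIV // {(u, v). pres_eq R u v},
     monoid.mult = (\<lambda>A B. {w. \<exists>u \<in> A. \<exists>v \<in> B. pres_eq R (u @ v) w}),
     one = {w. pres_eq R [] w}\<rparr>"

definition gen :: "'g \<Rightarrow> 'g word" where
  "gen g = [(g, True)]"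

definition gen_inv :: "'g \<Rightarrow> 'g word" where
  "gen_inv g = [(g, False)]"

definition gen_pow :: "'g \<Rightarrow> nat \<Rightarrow> 'g word" where
  "gen_pow g n = replicate n (g, True)"

datatype two_gens = a\<^sub>2 | b\<^sub>2

datatype three_gens = a\<^sub>3 | b\<^sub>3 | c\<^sub>3


section \<open>The groups of the classification\<close>

abbreviation cyclic :: "nat \<Rightarrow> int monoid" where
  "cyclic n \<equiv> integer_mod_group n"

text \<open>The dihedral group of order \<open>2 * n\<close>.\<close>

definition dihedral_group :: "nat \<Rightarrow> (int \<times> int) monoid" where
  "dihedral_group n = semidirect_product (cyclic n) (cyclic 2) (inversion_action (cyclic n))"

text \<open>The units \<open>\<plusminus>1, \<plusminus>i, \<plusminus>j, \<plusminus>k\<close> under Hamilton's product, with \<open>(p, q, r, s)\<close> standing for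
  \<open>p + q i + r j + s k\<close>.\<close>

definition quaternion_group :: "(int \<times> int \<times> int \<times> int) monoid" where
  "quaternion_group =
    \<lparr>carrier = {(1, 0, 0, 0), (-1, 0, 0, 0), (0, 1, 0, 0), (0, -1, 0, 0),
                (0, 0, 1, 0), (0, 0, -1, 0), (0, 0, 0, 1), (0, 0, 0, -1)},
     monoid.mult = (\<lambda>(p, q, r, s) (p', q', r', s').
       (p * p' - q * q' - r * r' - s * s',
        p * q' + q * p' + r * s' - s * r',
        p * r' - q * s' + r * p' + s * q',
        p * s' + q * r' - r * q' + s * p')),
     one = (1, 0, 0, 0)\<rparr>"

text \<open>The affine maps \<open>t \<mapsto> a t + b\<close> with \<open>a\<close> invertible, as functions on the carrier of the field
  under composition.\<close>

definition affine_group :: "('a, 'b) ring_scheme \<Rightarrow> ('a \<Rightarrow> 'a) monoid" where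
  "affine_group F = (BijGroup (carrier F))
    \<lparr>carrier := {(\<lambda>t \<in> carrier F. a \<otimes>\<^bsub>F\<^esub> t \<oplus>\<^bsub>F\<^esub> b) | a b. a \<in> Units F \<and> b \<in> carrier F}\<rparr>"

text \<open>The matrix with rows \<open>(a, b)\<close> and \<open>(c, d)\<close> is represented by \<open>((a, b), (c, d))\<close>.\<close>

definition special_linear_group_2 ::
  "('a, 'b) ring_scheme \<Rightarrow> (('a \<times> 'a) \<times> ('a \<times> 'a)) monoid" where
  "special_linear_group_2 F =
    \<lparr>carrier = {((a, b), (c, d)) | a b c d.
       a \<in> carrier F \<and> b \<in> carrier F \<and> c \<in> carrier F \<and> d \<in> carrier F \<and>
       a \<otimes>\<^bsub>F\<^esub> d \<ominus>\<^bsub>F\<^esub> b \<otimes>\<^bsub>F\<^esub> c = \<one>\<^bsub>F\<^esub>},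
     monoid.mult = (\<lambda>((a, b), (c, d)) ((a', b'), (c', d')).
       ((a \<otimes>\<^bsub>F\<^esub> a' \<oplus>\<^bsub>F\<^esub> b \<otimes>\<^bsub>F\<^esub> c', a \<otimes>\<^bsub>F\<^esub> b' \<oplus>\<^bsub>F\<^esub> b \<otimes>\<^bsub>F\<^esub> d'),
        (c \<otimes>\<^bsub>F\<^esub> a' \<oplus>\<^bsub>F\<^esub> d \<otimes>\<^bsub>F\<^esub> c', c \<otimes>\<^bsub>F\<^esub> b' \<oplus>\<^bsub>F\<^esub> d \<otimes>\<^bsub>F\<^esub> d'))),
     one = ((\<one>\<^bsub>F\<^esub>, \<zero>\<^bsub>F\<^esub>), (\<zero>\<^bsub>F\<^esub>, \<one>\<^bsub>F\<^esub>))\<rparr>"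

definition GA_1_5 :: "(int \<Rightarrow> int) monoid" where
  "GA_1_5 = affine_group (residue_ring 5)"

definition SL_2_3 :: "((int \<times> int) \<times> (int \<times> int)) monoid" where
  "SL_2_3 = special_linear_group_2 (residue_ring 3)"

definition C3_sdp_C4 :: "(int \<times> int) monoid" where
  "C3_sdp_C4 = semidirect_product (cyclic 3) (cyclic 4) (inversion_action (cyclic 3))"

definition C4xC2_sdp_C2 :: "three_gens word set monoid" where
  "C4xC2_sdp_C2 = presented_group
    {(gen_pow a\<^sub>3 4, []), (gen_pow b\<^sub>3 2, []), (gen_pow c\<^sub>3 2, []),
     (gen a\<^sub>3 @ gen b\<^sub>3, gen b\<^sub>3 @ gen a\<^sub>3),
     (gen b\<^sub>3 @ gen c\<^sub>3, gen c\<^sub>3 @ gen b\<^sub>3),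
     (gen c\<^sub>3 @ gen a\<^sub>3 @ gen_inv c\<^sub>3, gen a\<^sub>3 @ gen b\<^sub>3)}"

definition C4_sdp_C4 :: "two_gens word set monoid" where
  "C4_sdp_C4 = presented_group
    {(gen_pow a\<^sub>2 4, []), (gen_pow b\<^sub>2 4, []),
     (gen b\<^sub>2 @ gen a\<^sub>2 @ gen_inv b\<^sub>2, gen_inv a\<^sub>2)}"

definition C8_sdp_C2 :: "two_gens word set monoid" where
  "C8_sdp_C2 = presented_group
    {(gen_pow a\<^sub>2 8, []), (gen_pow b\<^sub>2 2, []),
     (gen b\<^sub>2 @ gen a\<^sub>2 @ gen_inv b\<^sub>2, gen_pow a\<^sub>2 5)}"

text \<open>The center of \<open>D\<^sub>8\<close> and the subgroup \<open>{0, 2}\<close> of \<open>C\<^sub>4\<close> have order 2, so there is only one way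
  to identify them.\<close>

definition D8_central_C4 :: "((int \<times> int) \<times> int) set monoid" where
  "D8_central_C4 = central_product (dihedral_group 4) (cyclic 4) (center (dihedral_group 4))
     (\<lambda>z. if z = \<one>\<^bsub>dihedral_group 4\<^esub> then 0 else 2)"

end

theory Submission
  imports Defs
begin

text \<open>
  For a non-central \<open>x\<close> with centralizer \<open>C(x)\<close>, the neighbours of \<open>x\<close> in the commuting graph are
  the elements of \<open>C(x)\<close> that are neither central nor equal to \<open>x\<close>. So \<open>x\<close> has degree
  \<open>|C(x)| - |Z| - 1\<close>, where \<open>Z\<close> is the center, and the maximum degree is less than 5 iff
  \<open>|C(x)| \<le> |Z| + 5\<close> for all non-central \<open>x\<close> (\<open>max_degree_commuting_graph\<close>). As \<open>Z\<close> is a proper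
  subgroup of \<open>C(x)\<close>, this leaves only a few possibilities for \<open>|Z|\<close> and \<open>|C(x)|\<close>.

  If \<open>|Z| = 1\<close>, all centralizers of non-trivial elements have order at most 6. A \<open>p\<close>-subgroup lies
  in the centralizer of one of its own non-trivial elements, so the prime powers dividing \<open>|G|\<close>
  are at most 5 and \<open>|G|\<close> divides 60. In each of the remaining orders the class equation, sorted
  by the orders of the centralizers, has so few solutions that it determines which elements are
  conjugate. That excludes the orders 15 and 30, produces the relations of \<open>GA(1,5)\<close> for order 20,
  and yields a subgroup of index 5 for order 60; a faithful action on the cosets of a subgroup
  identifies \<open>A\<^sub>4\<close> and \<open>A\<^sub>5\<close> (\<open>coset_action_iso_alt_group\<close>).

  If \<open>|Z| = 2\<close>, the centralizers have order 4 or 6, and the same method shows that \<open>|G|\<close> is 8, 12 or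
  24. For order 24 the class equation forces a normal quaternion subgroup whose three pairs
  \<open>\<plusminus>i, \<plusminus>j, \<plusminus>k\<close> are permuted by an element of order 3, and this is \<open>SL(2,3)\<close>.

  If \<open>|Z| \<ge> 3\<close>, then \<open>3 |Z| > |Z| + 5\<close>, so \<open>Z\<close> has index 2 in every \<open>C(x)\<close>. Consequently squares and
  commutators are central and commutators have order at most 2, so \<open>|Z|\<close> is even; and
  \<open>2 |Z| \<le> |Z| + 5\<close> leaves only \<open>|Z| = 4\<close>. Two non-commuting elements generate \<open>G\<close> modulo the
  center (\<open>generated_by_pair_and_center\<close>), whence \<open>|G| = 16\<close>. The squares of the two generators
  and of their product then determine the group.

  Most isomorphisms come from presentations: by von Dyck's theorem (\<open>iso_presented_group\<close>) two
  groups of order \<open>n\<close> are isomorphic if both are generated by elements that satisfy the same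
  relations and these relations present a group of order at most \<open>n\<close>. For the converse direction,
  orders up to 12 are immediate from \<open>|C(x)| \<le> |G| / 2\<close>, for order 16 it suffices that
  \<open>|G| \<le> 4 |Z|\<close>, and \<open>GA(1,5)\<close>, \<open>SL(2,3)\<close> and \<open>A\<^sub>5\<close> are treated separately.
\<close>

section \<open>Groups that satisfy a presentation\<close>

definition word_val :: "('a, 'b) monoid_scheme \<Rightarrow> ('g \<Rightarrow> 'a) \<Rightarrow> 'g word \<Rightarrow> 'a" where
  "word_val G f w = foldr (\<lambda>(g, s) x. (if s then f g else inv\<^bsub>G\<^esub> f g) \<otimes>\<^bsub>G\<^esub> x) w \<one>\<^bsub>G\<^esub>"

definition satisfies ::
  "('a, 'b) monoid_scheme \<Rightarrow> ('g \<Rightarrow> 'a) \<Rightarrow> ('g word \<times> 'g word) set \<Rightarrow> bool" where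
  "satisfies G f R \<longleftrightarrow> range f \<subseteq> carrier G \<and> (\<forall>(u, v) \<in> R. word_val G f u = word_val G f v)"

lemma word_val_Nil [simp]: "word_val G f [] = \<one>\<^bsub>G\<^esub>"
  by (simp add: word_val_def)

lemma word_val_Cons:
  "word_val G f ((g, s) # w) = (if s then f g else inv\<^bsub>G\<^esub> f g) \<otimes>\<^bsub>G\<^esub> word_val G f w"
  by (simp add: word_val_def)

context group
begin

lemma word_val_closed [simp]:
  assumes "range f \<subseteq> carrier G" shows "word_val G f w \<in> carrier G"
proof (induction w)
  case (Cons p w)
  obtain g s where "p = (g, s)" by (cases p)
  moreover have "f g \<in> carrier G" using assms by blast
  ultimately show ?case using Cons by (simp add: word_val_Cons)
qed simp

lemma word_val_append:
  assumes "range f \<subseteq> carrier G"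
  shows "word_val G f (u @ v) = word_val G f u \<otimes> word_val G f v"
proof (induction u)
  case Nil
  then show ?case using assms by simp
next
  case (Cons p u)
  obtain g s where "p = (g, s)" by (cases p)
  moreover have "f g \<in> carrier G" using assms by blast
  ultimately show ?case using Cons assms by (simp add: word_val_Cons m_assoc)
qed

lemma word_val_gen [simp]:
  assumes "range f \<subseteq> carrier G"
  shows "word_val G f (gen g) = f g" "word_val G f (gen_inv g) = inv f g"
    "word_val G f (gen_pow g n) = f g [^] n"
proof -
  have fg: "f g \<in> carrier G" using assms by blast
  then show "word_val G f (gen g) = f g" "word_val G f (gen_inv g) = inv f g"
    by (simp_all add: gen_def gen_inv_def word_val_Cons)
  show "word_val G f (gen_pow g n) = f g [^] n"
  proof (induction n)
    case (Suc n)
    then show ?case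
      using fg nat_pow_Suc2 by (simp add: gen_pow_def word_val_Cons)
  qed (simp add: gen_pow_def)
qed

text \<open>Equality of values is closed under all the rules that define \<open>pres_eq\<close>: a cancelling pair
  evaluates to \<open>\<one>\<close> in any group, and the relations hold by assumption.\<close>

lemma pres_eq_word_val:
  assumes "pres_eq R u v" and "satisfies G f R"
  shows "word_val G f u = word_val G f v"
  using assms(1)
proof (induction rule: pres_eq.induct)
  case (pres_cancel g s)
  have "f g \<in> carrier G" using assms(2) by (auto simp: satisfies_def)
  then show ?case by (simp add: word_val_Cons)
qed (use assms(2) in \<open>auto simp: satisfies_def word_val_append\<close>)

end

definition pres_class :: "('g word \<times> 'g word) set \<Rightarrow> 'g word \<Rightarrow> 'g word set" where
  "pres_class R u = {w. pres_eq R u w}"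

lemma pres_class_eq_iff: "pres_class R u = pres_class R v \<longleftrightarrow> pres_eq R u v"
  unfolding pres_class_def by (auto intro: pres_refl pres_sym pres_trans)

lemma carrier_presented_group: "carrier (presented_group R) = range (pres_class R)"
  by (auto simp: presented_group_def pres_class_def quotient_def Image_def)

lemma one_presented_group: "\<one>\<^bsub>presented_group R\<^esub> = pres_class R []"
  by (simp add: presented_group_def pres_class_def)

lemma mult_presented_group:
  "pres_class R u \<otimes>\<^bsub>presented_group R\<^esub> pres_class R v = pres_class R (u @ v)"
  unfolding presented_group_def pres_class_def
  by (auto intro: pres_refl pres_append pres_trans pres_sym)

fun word_inv :: "'g word \<Rightarrow> 'g word" where
  "word_inv [] = []"
| "word_inv ((g, s) # w) = word_inv w @ [(g, \<not> s)]"

lemma word_inv_cancel: "pres_eq R (word_inv w @ w) []"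
proof (induction w rule: word_inv.induct)
  case (2 g s w)
  have "pres_eq R (word_inv w @ [(g, \<not> s), (g, \<not> \<not> s)] @ w) (word_inv w @ [] @ w)"
    by (intro pres_append pres_refl pres_cancel)
  with 2 show ?case by (auto intro: pres_trans)
qed (simp add: pres_refl)

lemma group_presented_group: "group (presented_group R)"
proof (rule groupI)
  fix x assume "x \<in> carrier (presented_group R)"
  then obtain u where "x = pres_class R u" by (auto simp: carrier_presented_group)
  then show "\<exists>y \<in> carrier (presented_group R). y \<otimes>\<^bsub>presented_group R\<^esub> x = \<one>\<^bsub>presented_group R\<^esub>"
    by (intro bexI[of _ "pres_class R (word_inv u)"])
      (auto simp: carrier_presented_group one_presented_group mult_presented_group
        pres_class_eq_iff word_inv_cancel)
qed (auto simp: carrier_presented_group one_presented_group mult_presented_group)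

abbreviation pres_gen :: "('g word \<times> 'g word) set \<Rightarrow> 'g \<Rightarrow> 'g word set" where
  "pres_gen R g \<equiv> pres_class R (gen g)"

lemma inv_pres_gen: "inv\<^bsub>presented_group R\<^esub> pres_gen R g = pres_class R (gen_inv g)"
proof (rule group.inv_equality[OF group_presented_group])
  have "pres_eq R (gen_inv g @ gen g) []"
    using pres_cancel[of R g False] by (simp add: gen_def gen_inv_def)
  then show "pres_class R (gen_inv g) \<otimes>\<^bsub>presented_group R\<^esub> pres_gen R g = \<one>\<^bsub>presented_group R\<^esub>"
    by (simp add: one_presented_group mult_presented_group pres_class_eq_iff)
qed (auto simp: carrier_presented_group)

text \<open>Evaluating a word in the presented group returns the class of that word. Hence the
  generators satisfy the relations there, and they generate the group.\<close>

lemma word_val_presented_group: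
  "word_val (presented_group R) (pres_gen R) w = pres_class R w"
proof (induction w)
  case Nil
  then show ?case by (simp add: one_presented_group)
next
  case (Cons p w)
  obtain g s where p: "p = (g, s)" by (cases p)
  show ?case
    by (cases s) (simp_all add: p word_val_Cons Cons inv_pres_gen mult_presented_group,
        simp_all add: gen_def gen_inv_def)
qed

lemma satisfies_presented_group: "satisfies (presented_group R) (pres_gen R) R"
  by (auto simp: satisfies_def carrier_presented_group word_val_presented_group
      pres_class_eq_iff pres_rel)

lemma (in group) word_val_in_generate: 
  "range f \<subseteq> carrier G \<Longrightarrow> word_val G f w \<in> generate G (range f)"
proof (induction w)
  case Nil
  then show ?case by (simp add: generate.one)
next
  case (Cons p w)
  obtain g s where p: "p = (g, s)" by (cases p)
  show ?case
    using Cons by (auto simp: p word_val_Cons intro!: generate.eng intro: generate.incl generate.inv)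
qed

lemma generate_presented_group:
  "generate (presented_group R) (range (pres_gen R)) = carrier (presented_group R)"
proof
  show "generate (presented_group R) (range (pres_gen R)) \<subseteq> carrier (presented_group R)"
    by (rule group.generate_incl[OF group_presented_group]) (auto simp: carrier_presented_group)
  show "carrier (presented_group R) \<subseteq> generate (presented_group R) (range (pres_gen R))"
    using group.word_val_in_generate[OF group_presented_group, of "pres_gen R" R]
    by (auto simp: carrier_presented_group word_val_presented_group)
qed

text \<open>Von Dyck's theorem, with a count in place of the description of the kernel: evaluation of
  words is a homomorphism onto \<open>G\<close>, and as the presented group is not larger than \<open>G\<close>, it is
  injective.\<close>

theorem (in group) iso_presented_group:
  assumes sat: "satisfies G f R" and gen: "generate G (range f) = carrier G"
    and fin: "finite (carrier (presented_group R))"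
    and le: "card (carrier (presented_group R)) \<le> card (carrier G)"
  shows "G \<cong> presented_group R"
proof -
  let ?P = "presented_group R"
  have f: "range f \<subseteq> carrier G" using sat by (simp add: satisfies_def)
  \<comment> \<open>The value of a class, computed from an arbitrary representative.\<close>
  define h where "h A = word_val G f (SOME u. u \<in> A)" for A
  have h: "h (pres_class R u) = word_val G f u" for u
  proof -
    have "(SOME v. v \<in> pres_class R u) \<in> pres_class R u"
      by (rule someI[of _ u]) (simp add: pres_class_def pres_refl)
    then show ?thesis unfolding h_def pres_class_def using pres_eq_word_val[OF _ sat] by fastforce
  qed
  have hom: "h \<in> hom ?P G"
    by (auto simp: hom_def carrier_presented_group mult_presented_group h word_val_append f)
  interpret h: group_hom ?P G h
    using hom group_presented_group is_group by (simp add: group_hom_def group_hom_axioms_def)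
  have "range f \<subseteq> h ` carrier ?P"
    using h f by (auto simp: carrier_presented_group image_image intro!: image_eqI[of _ _ "gen _"])
  then have "carrier G \<subseteq> h ` carrier ?P"
    using generate_subgroup_incl[OF _ h.img_is_subgroup, of "range f"] gen by simp
  then have im: "h ` carrier ?P = carrier G" using hom by (auto simp: hom_def)
  then have "card (carrier ?P) = card (h ` carrier ?P)"
    using le card_image_le[OF fin, of h] by simp
  then have "inj_on h (carrier ?P)" using fin by (simp add: eq_card_imp_inj_on)
  then have "?P \<cong> G" using hom im by (auto simp: is_iso_def iso_def bij_betw_def)
  then show ?thesis using group.iso_sym[OF group_presented_group] by blast
qed

text \<open>Only an upper bound is required: a group of order \<open>n\<close> that is generated by elements
  satisfying the relations supplies the lower one.\<close>

definition presents_at_most :: "('g word \<times> 'g word) set \<Rightarrow> nat \<Rightarrow> bool" where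
  "presents_at_most R n \<longleftrightarrow>
    finite (carrier (presented_group R)) \<and> card (carrier (presented_group R)) \<le> n"

text \<open>The generators may satisfy further relations that do not follow from \<open>R\<close>. Comparing the
  orders, as in the next lemma, rules that out.\<close>

definition presented_by :: "('a, 'b) monoid_scheme \<Rightarrow> ('g word \<times> 'g word) set \<Rightarrow> bool" where
  "presented_by G R \<longleftrightarrow> group G \<and> (\<exists>f. satisfies G f R \<and> generate G (range f) = carrier G)"

lemma iso_of_same_presentation:
  assumes "presented_by G R" "presented_by H R" "presents_at_most R n"
    "card (carrier G) = n" "card (carrier H) = n"
  shows "G \<cong> H"
proof -
  have "G \<cong> presented_group R"
    using assms group.iso_presented_group[of G] by (auto simp: presented_by_def presents_at_most_def)
  moreover have "H \<cong> presented_group R" "group H"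
    using assms group.iso_presented_group[of H] by (auto simp: presented_by_def presents_at_most_def)
  ultimately show ?thesis using group.iso_sym iso_trans by blast
qed

lemma presented_by_presented_group: "presented_by (presented_group R) R"
  unfolding presented_by_def
  using group_presented_group satisfies_presented_group generate_presented_group by blast

section \<open>Upper bounds for the order of a presented group\<close>

lemma (in group) cancel_inv [simp]:
  assumes "x \<in> carrier G" "y \<in> carrier G"
  shows "inv x \<otimes> (x \<otimes> y) = y" "x \<otimes> (inv x \<otimes> y) = y"
  using assms by (simp_all add: m_assoc[symmetric])

lemma (in group) subgroup_nat_pow_closed:
  "subgroup H G \<Longrightarrow> h \<in> H \<Longrightarrow> h [^] (n::nat) \<in> H"
  by (metis int_pow_int subgroup_int_pow_closed)

text \<open>Since \<open>y\<close> normalizes the subgroup \<open>A\<close> generated by \<open>B\<close> and some power \<open>y ^ m\<close> lies in \<open>A\<close>,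
  the products \<open>a \<otimes> y ^ i\<close> with \<open>a \<in> A\<close> and \<open>i < m\<close> already form a subgroup.\<close>

lemma (in group) generate_insert_card_le:
  assumes B: "B \<subseteq> carrier G" and y: "y \<in> carrier G" and m: "m > 0"
    and fin: "finite (generate G B)"
    and conj: "\<And>x. x \<in> B \<Longrightarrow> y \<otimes> x \<otimes> inv y \<in> generate G B"
    and pow: "y [^] m \<in> generate G B"
  shows "finite (generate G (insert y B)) \<and> card (generate G (insert y B)) \<le> m * card (generate G B)"
proof -
  let ?A = "generate G B"
  interpret A: subgroup ?A G by (rule generate_is_subgroup[OF B])
  have conjA: "y \<otimes> a \<otimes> inv y \<in> ?A" if "a \<in> ?A" for a
    using that
  proof (induction rule: generate.induct)
    case one
    then show ?case using y by (simp add: generate.one)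
  next
    case (incl h)
    then show ?case by (rule conj)
  next
    case (inv h)
    have "y \<otimes> inv h \<otimes> inv y = inv (y \<otimes> h \<otimes> inv y)"
      using inv B y by (auto simp: inv_mult_group m_assoc subset_iff)
    then show ?case using conj[OF inv] A.m_inv_closed by simp
  next
    case (eng h k)
    have "y \<otimes> (h \<otimes> k) \<otimes> inv y = (y \<otimes> h \<otimes> inv y) \<otimes> (y \<otimes> k \<otimes> inv y)"
      using eng(1,2) y by (simp add: m_assoc A.mem_carrier)
    then show ?case using eng by simp
  qed
  have conjAi: "y [^] i \<otimes> a \<otimes> inv (y [^] i) \<in> ?A" if "a \<in> ?A" for a and i :: nat
  proof (induction i)
    case 0
    then show ?case using that by simp
  next
    case (Suc i)
    have "y [^] Suc i \<otimes> a \<otimes> inv (y [^] Suc i) = y \<otimes> (y [^] i \<otimes> a \<otimes> inv (y [^] i)) \<otimes> inv y"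
      using that y unfolding nat_pow_Suc2[OF y] by (simp add: inv_mult_group m_assoc A.mem_carrier)
    then show ?case using conjA[OF Suc] by simp
  qed
  define S where "S = (\<lambda>(a, i). a \<otimes> y [^] (i::nat)) ` (?A \<times> {..<m})"
  have inS: "a \<otimes> y [^] i \<in> S" if "a \<in> ?A" for a and i :: nat
  proof -
    have "y [^] (m * (i div m)) \<in> ?A"
      using A.subgroup_axioms pow y nat_pow_pow[OF y, of m "i div m"]
      by (metis subgroup_nat_pow_closed)
    moreover have "a \<otimes> y [^] i = (a \<otimes> y [^] (m * (i div m))) \<otimes> y [^] (i mod m)"
      using that y by (simp add: m_assoc nat_pow_mult A.mem_carrier)
    ultimately show ?thesis
      using that m unfolding S_def by (auto intro!: image_eqI[of _ _ "(_, i mod m)"])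
  qed
  \<comment> \<open>The induction has to place \<open>inv y\<close> in \<open>S\<close> as well; it is \<open>inv (y ^ m) \<otimes> y ^ (m - 1)\<close>.\<close>
  have "generate G (insert y B) \<subseteq> S"
  proof
    fix g assume "g \<in> generate G (insert y B)"
    then show "g \<in> S"
    proof (induction rule: generate.induct)
      case one
      then show ?case using inS[of \<one> 0] by (simp add: generate.one)
    next
      case (incl h)
      then show ?case using inS[of \<one> 1] inS[of h 0] y B by (auto simp: generate.one generate.incl)
    next
      case (inv h)
      then consider "h = y" | "h \<in> B" by blast
      then show ?case
      proof cases
        case 1
        have "inv y = inv (y [^] m) \<otimes> y [^] (m - 1)"
        proof -
          have "y [^] m = y [^] (m - 1) \<otimes> y" using m by (metis Suc_diff_1 nat_pow_Suc)
          then have "inv (y [^] m) = inv y \<otimes> inv (y [^] (m - 1))" using y by (simp add: inv_mult_group)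
          then show ?thesis using y by (simp add: m_assoc)
        qed
        then show ?thesis using inS[of "inv (y [^] m)" "m - 1"] pow 1 by simp
      next
        case 2
        then show ?thesis using inS[of "inv h" 0] B by (auto simp: generate.inv)
      qed
    next
      case (eng h k)
      then obtain a i b j where hk: "h = a \<otimes> y [^] (i::nat)" "a \<in> ?A" "k = b \<otimes> y [^] (j::nat)" "b \<in> ?A"
        unfolding S_def by auto
      then have "h \<otimes> k = (a \<otimes> (y [^] i \<otimes> b \<otimes> inv (y [^] i))) \<otimes> y [^] (i + j)"
        using y by (simp add: m_assoc nat_pow_mult[symmetric] A.mem_carrier)
      then show ?case using inS conjAi hk by auto
    qed
  qed
  moreover have "finite S" "card S \<le> m * card ?A"
    unfolding S_def using fin card_image_le[of "?A \<times> {..<m}"] by (auto simp: card_cartesian_product mult.commute)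
  ultimately show ?thesis
    using finite_subset card_mono le_trans by metis
qed

lemma UNIV_two_gens: "UNIV = {a\<^sub>2, b\<^sub>2}"
  using two_gens.exhaust by blast

lemma UNIV_three_gens: "UNIV = {a\<^sub>3, b\<^sub>3, c\<^sub>3}"
  using three_gens.exhaust by blast

lemma presents_at_mostI:
  assumes "finite (generate (presented_group R) (range (pres_gen R))) \<and>
    card (generate (presented_group R) (range (pres_gen R))) \<le> n"
  shows "presents_at_most R n"
  using assms by (simp add: presents_at_most_def generate_presented_group)

section \<open>The presentations that occur in the classification\<close>

text \<open>The parameters \<open>(n, 2, n - 1, 0)\<close> give the dihedral group of order \<open>2 n\<close>, \<open>(4, 2, 3, 2)\<close> the
  quaternion group, \<open>(3, 4, 2, 0)\<close> the group \<open>C\<^sub>3 \<rtimes> C\<^sub>4\<close>, \<open>(5, 4, 2, 0)\<close> the group \<open>GA(1,5)\<close>, and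
  \<open>(8, 2, 5, 0)\<close> the group \<open>C\<^sub>8 \<rtimes> C\<^sub>2\<close>.\<close>

definition metacyclic_relations ::
  "nat \<Rightarrow> nat \<Rightarrow> nat \<Rightarrow> nat \<Rightarrow> (two_gens word \<times> two_gens word) set" where
  "metacyclic_relations n m r s =
    {(gen_pow a\<^sub>2 n, []), (gen_pow b\<^sub>2 m, gen_pow a\<^sub>2 s),
     (gen b\<^sub>2 @ gen a\<^sub>2 @ gen_inv b\<^sub>2, gen_pow a\<^sub>2 r)}"

text \<open>The relations of \<open>C\<^sub>4 \<rtimes> C\<^sub>4\<close>, with conjugation written as inversion and not as the third
  power, as they are in the definition of that group.\<close>

definition inverting_relations :: "(two_gens word \<times> two_gens word) set" where
  "inverting_relations =
    {(gen_pow a\<^sub>2 4, []), (gen_pow b\<^sub>2 4, []),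
     (gen b\<^sub>2 @ gen a\<^sub>2 @ gen_inv b\<^sub>2, gen_inv a\<^sub>2)}"

text \<open>The subgroup generated by \<open>a\<close> and \<open>b\<close> is \<open>D\<^sub>8\<close> for \<open>s = 0\<close> and \<open>Q\<^sub>8\<close> for \<open>s = 2\<close>; the
  central element \<open>c\<close> either splits off (\<open>k = 0\<close>) or is a square root of \<open>a\<^sup>2\<close> (\<open>k = 2\<close>). So
  \<open>(0, 0)\<close> is \<open>D\<^sub>8 \<times> C\<^sub>2\<close>, \<open>(2, 0)\<close> is \<open>Q\<^sub>8 \<times> C\<^sub>2\<close>, and \<open>(0, 2)\<close> is the central product of \<open>D\<^sub>8\<close>
  and \<open>C\<^sub>4\<close>.\<close>

definition dihedral_type_relations :: "nat \<Rightarrow> nat \<Rightarrow> (three_gens word \<times> three_gens word) set" where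
  "dihedral_type_relations s k =
    {(gen_pow a\<^sub>3 4, []), (gen_pow b\<^sub>3 2, gen_pow a\<^sub>3 s), (gen_pow c\<^sub>3 2, gen_pow a\<^sub>3 k),
     (gen b\<^sub>3 @ gen a\<^sub>3 @ gen_inv b\<^sub>3, gen_pow a\<^sub>3 3),
     (gen c\<^sub>3 @ gen a\<^sub>3, gen a\<^sub>3 @ gen c\<^sub>3), (gen c\<^sub>3 @ gen b\<^sub>3, gen b\<^sub>3 @ gen c\<^sub>3)}"

definition C4xC2_sdp_C2_relations :: "(three_gens word \<times> three_gens word) set" where
  "C4xC2_sdp_C2_relations =
    {(gen_pow a\<^sub>3 4, []), (gen_pow b\<^sub>3 2, []), (gen_pow c\<^sub>3 2, []),
     (gen a\<^sub>3 @ gen b\<^sub>3, gen b\<^sub>3 @ gen a\<^sub>3),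
     (gen b\<^sub>3 @ gen c\<^sub>3, gen c\<^sub>3 @ gen b\<^sub>3),
     (gen c\<^sub>3 @ gen a\<^sub>3 @ gen_inv c\<^sub>3, gen a\<^sub>3 @ gen b\<^sub>3)}"

text \<open>Here \<open>a\<close> and \<open>b\<close> are the elements \<open>i\<close> and \<open>j\<close> of a quaternion group, and \<open>c\<close> has order 3 and
  maps \<open>i\<close> to \<open>j\<close> and \<open>j\<close> to \<open>k = i j\<close>.\<close>

definition SL_2_3_relations :: "(three_gens word \<times> three_gens word) set" where
  "SL_2_3_relations =
    {(gen_pow a\<^sub>3 4, []), (gen_pow b\<^sub>3 2, gen_pow a\<^sub>3 2), (gen_pow c\<^sub>3 3, []),
     (gen b\<^sub>3 @ gen a\<^sub>3 @ gen_inv b\<^sub>3, gen_pow a\<^sub>3 3),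
     (gen c\<^sub>3 @ gen a\<^sub>3 @ gen_inv c\<^sub>3, gen b\<^sub>3),
     (gen c\<^sub>3 @ gen b\<^sub>3 @ gen_inv c\<^sub>3, gen a\<^sub>3 @ gen b\<^sub>3)}"

context group
begin

lemma satisfies_metacyclic:
  "satisfies G f (metacyclic_relations n m r s) \<longleftrightarrow>
    f a\<^sub>2 \<in> carrier G \<and> f b\<^sub>2 \<in> carrier G \<and> f a\<^sub>2 [^] n = \<one> \<and> f b\<^sub>2 [^] m = f a\<^sub>2 [^] s \<and>
    f b\<^sub>2 \<otimes> f a\<^sub>2 \<otimes> inv f b\<^sub>2 = f a\<^sub>2 [^] r"
proof (cases "range f \<subseteq> carrier G")
  case True
  moreover from this have "f g \<in> carrier G" for g by blast
  ultimately show ?thesis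
    by (simp add: satisfies_def metacyclic_relations_def word_val_append m_assoc)
qed (auto simp: satisfies_def UNIV_two_gens)

lemma satisfies_inverting:
  "satisfies G f inverting_relations \<longleftrightarrow>
    f a\<^sub>2 \<in> carrier G \<and> f b\<^sub>2 \<in> carrier G \<and> f a\<^sub>2 [^] (4::nat) = \<one> \<and> f b\<^sub>2 [^] (4::nat) = \<one> \<and>
    f b\<^sub>2 \<otimes> f a\<^sub>2 \<otimes> inv f b\<^sub>2 = inv f a\<^sub>2"
proof (cases "range f \<subseteq> carrier G")
  case True
  moreover from this have "f g \<in> carrier G" for g by blast
  ultimately show ?thesis
    by (simp add: satisfies_def inverting_relations_def word_val_append m_assoc)
qed (auto simp: satisfies_def UNIV_two_gens)

lemma satisfies_dihedral_type:
  "satisfies G f (dihedral_type_relations s k) \<longleftrightarrow>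
    f a\<^sub>3 \<in> carrier G \<and> f b\<^sub>3 \<in> carrier G \<and> f c\<^sub>3 \<in> carrier G \<and>
    f a\<^sub>3 [^] (4::nat) = \<one> \<and> f b\<^sub>3 [^] (2::nat) = f a\<^sub>3 [^] s \<and> f c\<^sub>3 [^] (2::nat) = f a\<^sub>3 [^] k \<and>
    f b\<^sub>3 \<otimes> f a\<^sub>3 \<otimes> inv f b\<^sub>3 = f a\<^sub>3 [^] (3::nat) \<and>
    f c\<^sub>3 \<otimes> f a\<^sub>3 = f a\<^sub>3 \<otimes> f c\<^sub>3 \<and> f c\<^sub>3 \<otimes> f b\<^sub>3 = f b\<^sub>3 \<otimes> f c\<^sub>3"
proof (cases "range f \<subseteq> carrier G")
  case True
  moreover from this have "f g \<in> carrier G" for g by blast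
  ultimately show ?thesis
    by (simp add: satisfies_def dihedral_type_relations_def word_val_append m_assoc)
qed (auto simp: satisfies_def UNIV_three_gens)

lemma satisfies_C4xC2_sdp_C2:
  "satisfies G f C4xC2_sdp_C2_relations \<longleftrightarrow>
    f a\<^sub>3 \<in> carrier G \<and> f b\<^sub>3 \<in> carrier G \<and> f c\<^sub>3 \<in> carrier G \<and>
    f a\<^sub>3 [^] (4::nat) = \<one> \<and> f b\<^sub>3 [^] (2::nat) = \<one> \<and> f c\<^sub>3 [^] (2::nat) = \<one> \<and>
    f a\<^sub>3 \<otimes> f b\<^sub>3 = f b\<^sub>3 \<otimes> f a\<^sub>3 \<and> f b\<^sub>3 \<otimes> f c\<^sub>3 = f c\<^sub>3 \<otimes> f b\<^sub>3 \<and>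
    f c\<^sub>3 \<otimes> f a\<^sub>3 \<otimes> inv f c\<^sub>3 = f a\<^sub>3 \<otimes> f b\<^sub>3"
proof (cases "range f \<subseteq> carrier G")
  case True
  moreover from this have "f g \<in> carrier G" for g by blast
  ultimately show ?thesis
    by (simp add: satisfies_def C4xC2_sdp_C2_relations_def word_val_append m_assoc)
qed (auto simp: satisfies_def UNIV_three_gens)

lemma satisfies_SL_2_3:
  "satisfies G f SL_2_3_relations \<longleftrightarrow>
    f a\<^sub>3 \<in> carrier G \<and> f b\<^sub>3 \<in> carrier G \<and> f c\<^sub>3 \<in> carrier G \<and>
    f a\<^sub>3 [^] (4::nat) = \<one> \<and> f b\<^sub>3 [^] (2::nat) = f a\<^sub>3 [^] (2::nat) \<and> f c\<^sub>3 [^] (3::nat) = \<one> \<and>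
    f b\<^sub>3 \<otimes> f a\<^sub>3 \<otimes> inv f b\<^sub>3 = f a\<^sub>3 [^] (3::nat) \<and>
    f c\<^sub>3 \<otimes> f a\<^sub>3 \<otimes> inv f c\<^sub>3 = f b\<^sub>3 \<and> f c\<^sub>3 \<otimes> f b\<^sub>3 \<otimes> inv f c\<^sub>3 = f a\<^sub>3 \<otimes> f b\<^sub>3"
proof (cases "range f \<subseteq> carrier G")
  case True
  moreover from this have "f g \<in> carrier G" for g by blast
  ultimately show ?thesis
    by (simp add: satisfies_def SL_2_3_relations_def word_val_append m_assoc)
qed (auto simp: satisfies_def UNIV_three_gens)

lemma presented_by_two_gensI:
  assumes "satisfies G (case_two_gens x y) R" "generate G {x, y} = carrier G"
  shows "presented_by G R"
proof -
  have "range (case_two_gens x y) = {x, y}" by (simp add: UNIV_two_gens)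
  then show ?thesis using assms is_group by (auto simp: presented_by_def)
qed

lemma presented_by_three_gensI:
  assumes "satisfies G (case_three_gens x y z) R" "generate G {x, y, z} = carrier G"
  shows "presented_by G R"
proof -
  have "range (case_three_gens x y z) = {x, y, z}" by (simp add: UNIV_three_gens)
  then show ?thesis using assms is_group by (auto simp: presented_by_def)
qed

lemma presented_by_two_gensE:
  assumes "presented_by G R"
  obtains x y where "satisfies G (case_two_gens x y) R" "generate G {x, y} = carrier G"
proof -
  obtain f where f: "satisfies G f R" "generate G (range f) = carrier G"
    using assms by (auto simp: presented_by_def)
  moreover have "f = case_two_gens (f a\<^sub>2) (f b\<^sub>2)" by (auto simp: fun_eq_iff split: two_gens.split)
  moreover have "range f = {f a\<^sub>2, f b\<^sub>2}" by (simp add: UNIV_two_gens)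
  ultimately show thesis using that by metis
qed

lemma presented_by_three_gensE:
  assumes "presented_by G R"
  obtains x y z where "satisfies G (case_three_gens x y z) R" "generate G {x, y, z} = carrier G"
proof -
  obtain f where f: "satisfies G f R" "generate G (range f) = carrier G"
    using assms by (auto simp: presented_by_def)
  moreover have "f = case_three_gens (f a\<^sub>3) (f b\<^sub>3) (f c\<^sub>3)"
    by (auto simp: fun_eq_iff split: three_gens.split)
  moreover have "range f = {f a\<^sub>3, f b\<^sub>3, f c\<^sub>3}" by (simp add: UNIV_three_gens)
  ultimately show thesis using that by metis
qed

lemma generate_cyclic_card_le:
  assumes "x \<in> carrier G" "n > 0" "x [^] n = \<one>"
  shows "finite (generate G {x}) \<and> card (generate G {x}) \<le> n"
  using generate_insert_card_le[of "{}" x n] assms by (simp add: generate_empty)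

lemma pow_in_generate: "x \<in> B \<Longrightarrow> B \<subseteq> carrier G \<Longrightarrow> x [^] (n::nat) \<in> generate G B"
  by (intro subgroup_nat_pow_closed generate_is_subgroup generate.incl)

lemma generate_metacyclic_card_le:
  assumes "x \<in> carrier G" "y \<in> carrier G" "n > 0" "m > 0"
    and "x [^] n = \<one>" "y [^] m \<in> generate G {x}" "y \<otimes> x \<otimes> inv y \<in> generate G {x}"
  shows "finite (generate G {x, y}) \<and> card (generate G {x, y}) \<le> n * m"
proof -
  have "finite (generate G {x})" "card (generate G {x}) \<le> n"
    using generate_cyclic_card_le assms by auto
  moreover from this have "finite (generate G {y, x}) \<and> card (generate G {y, x}) \<le> m * card (generate G {x})"
    using assms by (intro generate_insert_card_le) auto
  ultimately show ?thesis
    using le_trans[OF _ mult_le_mono2[of "card (generate G {x})" n m]]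
    by (simp add: insert_commute mult.commute[of n])
qed

end

text \<open>This bound and the next ones climb a tower of subgroups, adding one generator at a time:
  each new generator normalizes the subgroup generated by the previous ones and has a power in
  it.\<close>

lemma presents_metacyclic:
  assumes "n > 0" "m > 0" shows "presents_at_most (metacyclic_relations n m r s) (n * m)"
proof (rule presents_at_mostI)
  let ?R = "metacyclic_relations n m r s"
  let ?P = "presented_group ?R"
  interpret P: group ?P by (rule group_presented_group)
  have "range (pres_gen ?R) = {pres_gen ?R a\<^sub>2, pres_gen ?R b\<^sub>2}" by (simp add: UNIV_two_gens)
  then show "finite (generate ?P (range (pres_gen ?R))) \<and> card (generate ?P (range (pres_gen ?R))) \<le> n * m"
    using satisfies_presented_group[of ?R] assms
    by (simp add: P.satisfies_metacyclic P.generate_metacyclic_card_le P.pow_in_generate)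
qed

lemma presents_inverting: "presents_at_most inverting_relations 16"
proof (rule presents_at_mostI)
  let ?R = "inverting_relations"
  let ?P = "presented_group ?R"
  interpret P: group ?P by (rule group_presented_group)
  have "range (pres_gen ?R) = {pres_gen ?R a\<^sub>2, pres_gen ?R b\<^sub>2}" by (simp add: UNIV_two_gens)
  then show "finite (generate ?P (range (pres_gen ?R))) \<and> card (generate ?P (range (pres_gen ?R))) \<le> 16"
    using satisfies_presented_group[of ?R] 
      P.generate_metacyclic_card_le[of "pres_gen ?R a\<^sub>2" "pres_gen ?R b\<^sub>2" 4 4]
    by (simp add: P.satisfies_inverting generate.one generate.inv)
qed

lemma presents_dihedral_type: "presents_at_most (dihedral_type_relations s k) 16"
proof (rule presents_at_mostI)
  let ?R = "dihedral_type_relations s k"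
  let ?P = "presented_group ?R"
  interpret P: group ?P by (rule group_presented_group)
  let ?x = "pres_gen ?R a\<^sub>3" and ?y = "pres_gen ?R b\<^sub>3" and ?z = "pres_gen ?R c\<^sub>3"
  have gens: "range (pres_gen ?R) = {?z, ?x, ?y}" by (auto simp add: UNIV_three_gens)
  note sat = satisfies_presented_group[of ?R, unfolded P.satisfies_dihedral_type]
  have "finite (generate ?P {?x, ?y}) \<and> card (generate ?P {?x, ?y}) \<le> 4 * 2"
    using sat by (intro P.generate_metacyclic_card_le) (auto simp: P.pow_in_generate)
  moreover from this have "finite (generate ?P {?z, ?x, ?y}) \<and>
      card (generate ?P {?z, ?x, ?y}) \<le> 2 * card (generate ?P {?x, ?y})"
    using sat
    by (intro P.generate_insert_card_le) (auto simp: P.pow_in_generate P.m_assoc generate.incl)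
  ultimately show "finite (generate ?P (range (pres_gen ?R))) \<and>
      card (generate ?P (range (pres_gen ?R))) \<le> 16"
    by (simp add: gens)
qed

lemma presents_C4xC2_sdp_C2: "presents_at_most C4xC2_sdp_C2_relations 16"
proof (rule presents_at_mostI)
  let ?R = "C4xC2_sdp_C2_relations"
  let ?P = "presented_group ?R"
  interpret P: group ?P by (rule group_presented_group)
  let ?x = "pres_gen ?R a\<^sub>3" and ?y = "pres_gen ?R b\<^sub>3" and ?z = "pres_gen ?R c\<^sub>3"
  have gens: "range (pres_gen ?R) = {?z, ?x, ?y}" by (auto simp add: UNIV_three_gens)
  note sat = satisfies_presented_group[of ?R, unfolded P.satisfies_C4xC2_sdp_C2]
  have "?y \<otimes>\<^bsub>?P\<^esub> ?x \<otimes>\<^bsub>?P\<^esub> inv\<^bsub>?P\<^esub> ?y = ?x" "?z \<otimes>\<^bsub>?P\<^esub> ?y \<otimes>\<^bsub>?P\<^esub> inv\<^bsub>?P\<^esub> ?z = ?y"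
    using sat by (metis P.inv_closed P.m_assoc P.r_inv P.r_one)+
  then have fin: "finite (generate ?P {?x, ?y}) \<and> card (generate ?P {?x, ?y}) \<le> 4 * 2"
    using sat by (intro P.generate_metacyclic_card_le) (auto simp: generate.incl generate.one)
  have prod: "?y \<otimes>\<^bsub>?P\<^esub> ?x \<in> generate ?P {?x, ?y}"
    by (intro generate.eng generate.incl) auto
  then have "finite (generate ?P {?z, ?x, ?y}) \<and>
      card (generate ?P {?z, ?x, ?y}) \<le> 2 * card (generate ?P {?x, ?y})"
    using sat prod fin \<open>?z \<otimes>\<^bsub>?P\<^esub> ?y \<otimes>\<^bsub>?P\<^esub> inv\<^bsub>?P\<^esub> ?z = ?y\<close>
    by (intro P.generate_insert_card_le) (auto simp: generate.one generate.incl)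
  then show "finite (generate ?P (range (pres_gen ?R))) \<and>
      card (generate ?P (range (pres_gen ?R))) \<le> 16"
    using fin by (simp add: gens)
qed

lemma presents_SL_2_3: "presents_at_most SL_2_3_relations 24"
proof (rule presents_at_mostI)
  let ?R = "SL_2_3_relations"
  let ?P = "presented_group ?R"
  interpret P: group ?P by (rule group_presented_group)
  let ?x = "pres_gen ?R a\<^sub>3" and ?y = "pres_gen ?R b\<^sub>3" and ?z = "pres_gen ?R c\<^sub>3"
  have gens: "range (pres_gen ?R) = {?z, ?x, ?y}" by (auto simp add: UNIV_three_gens)
  note sat = satisfies_presented_group[of ?R, unfolded P.satisfies_SL_2_3]
  have fin: "finite (generate ?P {?x, ?y}) \<and> card (generate ?P {?x, ?y}) \<le> 4 * 2"
    using sat by (intro P.generate_metacyclic_card_le) (auto simp: P.pow_in_generate)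
  have prod: "?x \<otimes>\<^bsub>?P\<^esub> ?y \<in> generate ?P {?x, ?y}"
    by (intro generate.eng generate.incl) auto
  then have "finite (generate ?P {?z, ?x, ?y}) \<and>
      card (generate ?P {?z, ?x, ?y}) \<le> 3 * card (generate ?P {?x, ?y})"
    using sat prod fin
    by (intro P.generate_insert_card_le) (auto simp: generate.one generate.incl)
  then show "finite (generate ?P (range (pres_gen ?R))) \<and>
      card (generate ?P (range (pres_gen ?R))) \<le> 24"
    using fin by (simp add: gens)
qed

section \<open>Actions of p-groups\<close>

lemma (in group) group_actionI:
  assumes "\<And>g e. \<lbrakk>g \<in> carrier G; e \<in> E\<rbrakk> \<Longrightarrow> a g e \<in> E"
    and "\<And>e. e \<in> E \<Longrightarrow> a \<one> e = e"
    and "\<And>g h e. \<lbrakk>g \<in> carrier G; h \<in> carrier G; e \<in> E\<rbrakk> \<Longrightarrow> a (g \<otimes> h) e = a g (a h e)"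
  shows "group_action G E (\<lambda>g. restrict (a g) E)"
proof -
  have "bij_betw (a g) E E" if g: "g \<in> carrier G" for g
  proof (rule bij_betw_byWitness[where f' = "a (inv g)"])
    show "\<forall>e\<in>E. a (inv g) (a g e) = e" "\<forall>e\<in>E. a g (a (inv g) e) = e"
      using assms(2,3) g by (metis inv_closed l_inv, metis inv_closed r_inv)
  qed (use assms(1) g in auto)
  then have "(\<lambda>g. restrict (a g) E) \<in> hom G (BijGroup E)"
    using assms by (auto simp: hom_def BijGroup_def Bij_def compose_def intro!: restrict_ext)
  then show ?thesis
    by (simp add: group_action_def group_hom_def group_hom_axioms_def group_BijGroup)
qed

text \<open>The orbits of a group of order \<open>p ^ k\<close> have lengths that are powers of \<open>p\<close>, so the points
  that are not fixed lie in orbits of length divisible by \<open>p\<close>.\<close>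

lemma (in group) fixed_points_cong:
  assumes a: "\<And>g e. \<lbrakk>g \<in> carrier G; e \<in> E\<rbrakk> \<Longrightarrow> a g e \<in> E"
      "\<And>e. e \<in> E \<Longrightarrow> a \<one> e = e"
      "\<And>g h e. \<lbrakk>g \<in> carrier G; h \<in> carrier G; e \<in> E\<rbrakk> \<Longrightarrow> a (g \<otimes> h) e = a g (a h e)"
    and E: "finite E" and p: "Factorial_Ring.prime p" and G: "order G = p ^ k"
  shows "[card {e \<in> E. \<forall>g \<in> carrier G. a g e = e} = card E] (mod p)"
proof -
  define \<phi> where "\<phi> g = restrict (a g) E" for g
  interpret group_action G E \<phi>
    unfolding \<phi>_def by (rule group_actionI) (use a in auto)
  have orb: "orbit G \<phi> e = {a g e | g. g \<in> carrier G}" if "e \<in> E" for e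
    using that by (simp add: orbit_def \<phi>_def)
  let ?F = "{e \<in> E. \<forall>g \<in> carrier G. a g e = e}"
  define C where "C = {B \<in> orbits G E \<phi>. card B \<noteq> 1}"
  have card1: "card (orbit G \<phi> e) = 1 \<longleftrightarrow> e \<in> ?F" if e: "e \<in> E" for e
  proof
    assume "card (orbit G \<phi> e) = 1"
    moreover have "e \<in> orbit G \<phi> e" using orbit_refl[OF e] .
    ultimately have "orbit G \<phi> e = {e}" by (metis card_1_singletonE singletonD)
    then show "e \<in> ?F" using e orb[OF e] by blast
  next
    assume "e \<in> ?F"
    then have "orbit G \<phi> e = {e}" using orb[OF e] by (auto intro!: exI[of _ \<one>])
    then show "card (orbit G \<phi> e) = 1" by simp
  qed
  have "\<Union> C = E - ?F"
  proof (intro equalityI subsetI)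
    fix e assume "e \<in> \<Union> C"
    then obtain e' where e': "e' \<in> E" "e \<in> orbit G \<phi> e'" "card (orbit G \<phi> e') \<noteq> 1"
      by (auto simp: C_def orbits_def)
    then have e: "e \<in> E" using orb a(1) by auto
    have "orbit G \<phi> e = orbit G \<phi> e'"
      using disjoint_union[of "orbit G \<phi> e" "orbit G \<phi> e'"] e e' orbit_refl[OF e] 
      by (auto simp: orbits_def)
    then show "e \<in> E - ?F" using card1[OF e] e e' by simp
  next
    fix e assume e: "e \<in> E - ?F"
    then have "orbit G \<phi> e \<in> C" using card1 by (auto simp: C_def orbits_def)
    then show "e \<in> \<Union> C" using e orbit_refl by blast
  qed
  moreover have "p dvd card (\<Union> C)"
  proof (rule dvd_partition)
    show "finite (\<Union> C)" using \<open>\<Union> C = E - ?F\<close> E by simp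
    show "\<forall>c\<in>C. p dvd card c"
    proof
      fix c assume "c \<in> C"
      then obtain e where e: "e \<in> E" "c = orbit G \<phi> e" "card c \<noteq> 1"
        by (auto simp: C_def orbits_def)
      then have "card c dvd p ^ k"
        using orbit_stabilizer_theorem[of e] G by (metis dvd_triv_left)
      then obtain i where "card c = p ^ i" using divides_primepow_nat[OF p] by blast
      then show "p dvd card c" using e(3) by (cases i) auto
    qed
    show "\<forall>c1\<in>C. \<forall>c2\<in>C. c1 \<noteq> c2 \<longrightarrow> c1 \<inter> c2 = {}"
      using disjoint_union by (auto simp: C_def)
  qed
  moreover have "card E = card ?F + card (E - ?F)"
    using E by (simp add: card_Diff_subset card_mono)
  ultimately show ?thesis by (auto simp: cong_def elim!: dvdE)
qed

section \<open>Centralizers and conjugacy classes\<close>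

definition centralizer :: "('a, 'b) monoid_scheme \<Rightarrow> 'a \<Rightarrow> 'a set" where
  "centralizer G x = {y \<in> carrier G. x \<otimes>\<^bsub>G\<^esub> y = y \<otimes>\<^bsub>G\<^esub> x}"

definition conj_class :: "('a, 'b) monoid_scheme \<Rightarrow> 'a \<Rightarrow> 'a set" where
  "conj_class G x = (\<lambda>g. g \<otimes>\<^bsub>G\<^esub> x \<otimes>\<^bsub>G\<^esub> inv\<^bsub>G\<^esub> g) ` carrier G"

definition centralizer_level :: "('a, 'b) monoid_scheme \<Rightarrow> nat \<Rightarrow> 'a set" where
  "centralizer_level G k = {x \<in> carrier G. card (centralizer G x) = k}"

context group
begin

lemma subgroup_centralizer: "x \<in> carrier G \<Longrightarrow> subgroup (centralizer G x) G"
proof (rule subgroupI)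
  fix y assume x: "x \<in> carrier G" and y: "y \<in> centralizer G x"
  then have "y \<in> carrier G" "x \<otimes> y = y \<otimes> x" by (auto simp: centralizer_def)
  then have "inv y \<otimes> (x \<otimes> y) \<otimes> inv y = inv y \<otimes> (y \<otimes> x) \<otimes> inv y" by simp
  then show "inv y \<in> centralizer G x"
    using x \<open>y \<in> carrier G\<close> by (simp add: centralizer_def m_assoc)
next
  fix y z assume x: "x \<in> carrier G" and "y \<in> centralizer G x" "z \<in> centralizer G x"
  then have "y \<in> carrier G" "z \<in> carrier G" "x \<otimes> y = y \<otimes> x" "x \<otimes> z = z \<otimes> x"
    by (auto simp: centralizer_def)
  then have yz: "y \<in> carrier G" "z \<in> carrier G" "x \<otimes> y = y \<otimes> x" "x \<otimes> z = z \<otimes> x" by simp_all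
  have "x \<otimes> (y \<otimes> z) = (x \<otimes> y) \<otimes> z" using x yz(1,2) by (simp add: m_assoc)
  also have "\<dots> = y \<otimes> (x \<otimes> z)" using x yz(1,2) by (simp add: yz(3) m_assoc)
  also have "\<dots> = y \<otimes> z \<otimes> x" using x yz(1,2) by (simp add: yz(4) m_assoc)
  finally show "y \<otimes> z \<in> centralizer G x" using yz by (simp add: centralizer_def)
qed (auto simp: centralizer_def)

lemma center_eq_centralizers: "center G = {x \<in> carrier G. centralizer G x = carrier G}"
  by (auto simp: center_def centralizer_def)

lemma mem_center_iff:
  "z \<in> center G \<longleftrightarrow> z \<in> carrier G \<and> (\<forall>g \<in> carrier G. z \<in> centralizer G g)"
  unfolding center_def centralizer_def mem_Collect_eq by metis

lemma center_subset: "center G \<subseteq> carrier G"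
  by (auto simp: center_def)

lemma center_subset_centralizer: "x \<in> carrier G \<Longrightarrow> center G \<subseteq> centralizer G x"
  by (auto simp: center_def centralizer_def)

lemma subgroup_center: "subgroup (center G) G"
proof (rule subgroupI)
  fix y assume y: "y \<in> center G"
  have "inv y \<in> centralizer G g" if g: "g \<in> carrier G" for g
    using subgroup.m_inv_closed[OF subgroup_centralizer[OF g]] y center_subset_centralizer[OF g] by blast
  then show "inv y \<in> center G" using y center_subset mem_center_iff by blast
next
  fix y z assume yz: "y \<in> center G" "z \<in> center G"
  have "y \<otimes> z \<in> centralizer G g" if g: "g \<in> carrier G" for g
    using subgroup.m_closed[OF subgroup_centralizer[OF g]] yz center_subset_centralizer[OF g] by blast
  then show "y \<otimes> z \<in> center G"
    using yz center_subset mem_center_iff by blast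
qed (auto simp: center_def)

lemma mem_center_iff_generators:
  assumes "generate G B = carrier G" "B \<subseteq> carrier G" "z \<in> carrier G"
  shows "z \<in> center G \<longleftrightarrow> (\<forall>b \<in> B. z \<otimes> b = b \<otimes> z)"
proof
  assume "\<forall>b \<in> B. z \<otimes> b = b \<otimes> z"
  then have "B \<subseteq> centralizer G z" using assms by (auto simp: centralizer_def)
  then have "carrier G \<subseteq> centralizer G z"
    using generate_subgroup_incl[OF _ subgroup_centralizer[OF assms(3)], of B] assms(1) by simp
  then show "z \<in> center G" using assms by (auto simp: center_def centralizer_def)
qed (use assms in \<open>auto simp: center_def\<close>)

lemma abelian_iff_center: "comm_group G \<longleftrightarrow> center G = carrier G"
proof
  assume "comm_group G"
  then show "center G = carrier G"
    using comm_group.axioms(1) comm_monoid.m_comm by (fastforce simp: center_def)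
next
  assume "center G = carrier G"
  then show "comm_group G"
    by (intro group.group_comm_groupI[OF is_group]) (auto simp: center_def)
qed

lemma centralizer_sym: "x \<in> carrier G \<Longrightarrow> y \<in> centralizer G x \<Longrightarrow> x \<in> centralizer G y"
  by (simp add: centralizer_def)

lemma card_dvd_subgroups:
  assumes "subgroup H G" "subgroup K G" "H \<subseteq> K" 
  shows "card H dvd card K"
proof -
  interpret K: group "G\<lparr>carrier := K\<rparr>" using assms by (simp add: subgroup_imp_group)
  have "subgroup H (G\<lparr>carrier := K\<rparr>)" using assms by (simp add: subgroup_incl)
  then have "card (rcosets\<^bsub>G\<lparr>carrier := K\<rparr>\<^esub> H) * card H = card K"
    using K.lagrange by (simp add: order_def)
  then show ?thesis by (metis dvd_triv_right)
qed

lemma card_dvd_order: "subgroup H G \<Longrightarrow> card H dvd order G"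
  using lagrange by (metis dvd_triv_right)

text \<open>The orbit-stabilizer theorem for the action of \<open>G\<close> on itself by conjugation.\<close>

lemma card_conj_class:
  assumes x: "x \<in> carrier G"
  shows "card (conj_class G x) * card (centralizer G x) = order G"
proof -
  let ?\<phi> = "\<lambda>g. \<lambda>h \<in> carrier G. g \<otimes> h \<otimes> inv g"
  have "orbit G ?\<phi> x = conj_class G x" using x by (auto simp: orbit_def conj_class_def)
  moreover have "stabilizer G ?\<phi> x = centralizer G x"
  proof -
    have "g \<otimes> x \<otimes> inv g = x \<longleftrightarrow> x \<otimes> g = g \<otimes> x" if "g \<in> carrier G" for g
      using that x inv_solve_right'[of x "g \<otimes> x" g] by auto
    then show ?thesis using x by (auto simp: stabilizer_def centralizer_def)
  qed
  ultimately show ?thesis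
    using group_action.orbit_stabilizer_theorem[OF action_by_conjugation x] by simp
qed

lemma conj_classI: "g \<in> carrier G \<Longrightarrow> g \<otimes> x \<otimes> inv g \<in> conj_class G x"
  by (simp add: conj_class_def)

lemma conj_class_subset: "x \<in> carrier G \<Longrightarrow> conj_class G x \<subseteq> carrier G"
  by (auto simp: conj_class_def)

lemma conj_class_refl: "x \<in> carrier G \<Longrightarrow> x \<in> conj_class G x"
  using conj_classI[of \<one> x] by simp

lemma conj_class_eq: 
  assumes "x \<in> carrier G" "y \<in> conj_class G x" shows "conj_class G y = conj_class G x"
proof -
  obtain g where g: "g \<in> carrier G" "y = g \<otimes> x \<otimes> inv g" using assms by (auto simp: conj_class_def)
  have 1: "h \<otimes> y \<otimes> inv h = (h \<otimes> g) \<otimes> x \<otimes> inv (h \<otimes> g)" if "h \<in> carrier G" for h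
    using that g assms by (simp add: m_assoc inv_mult_group)
  have 2: "h \<otimes> x \<otimes> inv h = (h \<otimes> inv g) \<otimes> y \<otimes> inv (h \<otimes> inv g)" if "h \<in> carrier G" for h
    using that g assms by (simp add: m_assoc inv_mult_group)
  have "h \<otimes> y \<otimes> inv h \<in> conj_class G x" if h: "h \<in> carrier G" for h
    unfolding 1[OF h] using h g(1) by (intro conj_classI m_closed)
  moreover have "h \<otimes> x \<otimes> inv h \<in> conj_class G y" if h: "h \<in> carrier G" for h
    unfolding 2[OF h] using h g(1) by (intro conj_classI m_closed inv_closed)
  ultimately show ?thesis unfolding conj_class_def[of G x] conj_class_def[of G y] by blast
qed

lemma conj_pow: 
  assumes "g \<in> carrier G" "x \<in> carrier G"
  shows "(g \<otimes> x \<otimes> inv g) [^] (n::nat) = g \<otimes> x [^] n \<otimes> inv g"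
  using assms by (induction n) (simp_all add: m_assoc)

lemma conj_mult: 
  assumes "g \<in> carrier G" "x \<in> carrier G" "y \<in> carrier G"
  shows "g \<otimes> (x \<otimes> y) \<otimes> inv g = (g \<otimes> x \<otimes> inv g) \<otimes> (g \<otimes> y \<otimes> inv g)"
  using assms by (simp add: m_assoc)

lemma conj_eq_iff:
  assumes "g \<in> carrier G" "x \<in> carrier G" "y \<in> carrier G"
  shows "g \<otimes> x \<otimes> inv g = g \<otimes> y \<otimes> inv g \<longleftrightarrow> x = y"
  using assms by simp

lemma commutes_iff_conj:
  assumes "g \<in> carrier G" "x \<in> carrier G"
  shows "g \<otimes> x \<otimes> inv g = x \<longleftrightarrow> g \<otimes> x = x \<otimes> g"
  using assms inv_solve_right'[of x "g \<otimes> x" g] by auto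

end

section \<open>Finite groups\<close>

locale finite_group = group G for G (structure) +
  assumes finite_carrier [simp]: "finite (carrier G)"
begin

lemma order_pos: "order G > 0"
  by (simp add: order_gt_0_iff_finite)

lemma finite_subgroup: "subgroup H G \<Longrightarrow> finite H"
  by (rule finite_subset[OF subgroup.subset finite_carrier])

lemma card_subgroup_pos: "subgroup H G \<Longrightarrow> card H > 0"
  by (rule subgroup.finite_imp_card_positive[OF _ finite_carrier])

lemma finite_centralizer [simp]: "x \<in> carrier G \<Longrightarrow> finite (centralizer G x)"
  by (rule finite_subgroup[OF subgroup_centralizer])

lemma finite_center [simp]: "finite (center G)"
  by (rule finite_subgroup[OF subgroup_center])

lemma card_centralizer_conj_class:
  assumes "x \<in> carrier G" "y \<in> conj_class G x"
  shows "card (centralizer G y) = card (centralizer G x)"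
proof -
  have "y \<in> carrier G" using assms conj_class_subset by blast
  moreover have "card (conj_class G x) > 0" 
    using card_conj_class[OF assms(1)] order_pos by (intro Nat.gr0I) simp
  moreover have "card (conj_class G x) * card (centralizer G y) = card (conj_class G x) * card (centralizer G x)"
    using card_conj_class[of y] card_conj_class[of x] conj_class_eq[OF assms] assms(1) calculation(1) by simp
  ultimately show ?thesis by simp
qed

text \<open>Conjugate elements have centralizers of the same order, so the elements whose centralizer
  has order \<open>k\<close> form a union of \<open>m\<close> conjugacy classes, each of size \<open>|G| / k\<close>. If \<open>m = 1\<close>, a mere
  count of elements has shown that all of them are conjugate; the classification draws on this
  again and again.\<close>

lemma card_centralizer_level:
  obtains m where "k * card (centralizer_level G k) = m * order G"
    and "m = 0 \<longleftrightarrow> centralizer_level G k = {}"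
    and "\<And>x. m = 1 \<Longrightarrow> x \<in> centralizer_level G k \<Longrightarrow> centralizer_level G k = conj_class G x"
proof -
  let ?L = "centralizer_level G k"
  define C where "C = conj_class G ` ?L"
  have fin: "finite ?L" by (simp add: centralizer_level_def)
  have sub: "conj_class G x \<subseteq> ?L" if "x \<in> ?L" for x
    using that card_centralizer_conj_class conj_class_subset
    by (fastforce simp: centralizer_level_def)
  then have un: "\<Union> C = ?L"
    using conj_class_refl by (auto simp: C_def centralizer_level_def)
  have "card ?L * k = card C * order G"
  proof (cases "?L = {}")
    case False
    then obtain x where "x \<in> ?L" by blast
    define n where "n = card (conj_class G x)"
    have n: "card (conj_class G y) = n \<and> n * k = order G" if "y \<in> ?L" for y
    proof -
      have "card (conj_class G z) * k = order G" if "z \<in> ?L" for z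
        using card_conj_class[of z] that by (simp add: centralizer_level_def)
      then have "n * k = order G" "card (conj_class G y) * k = order G"
        using that \<open>x \<in> ?L\<close> by (simp_all add: n_def)
      moreover have "k \<noteq> 0" using calculation(1) order_pos by (intro notI) simp
      moreover from calculation have "card (conj_class G y) * k = n * k" by simp
      then have "card (conj_class G y) = n" using \<open>k \<noteq> 0\<close> by simp
      ultimately show ?thesis by simp
    qed
    have "n * card C = card (\<Union> C)"
    proof (rule card_partition)
      show "finite C" "finite (\<Union> C)" using fin un by (simp_all add: C_def)
      show "\<And>c. c \<in> C \<Longrightarrow> card c = n" using n by (auto simp: C_def)
      show "c1 \<inter> c2 = {}" if c: "c1 \<in> C" "c2 \<in> C" "c1 \<noteq> c2" for c1 c2
      proof (rule ccontr)
        assume "c1 \<inter> c2 \<noteq> {}"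
        then obtain z where z: "z \<in> c1" "z \<in> c2" by blast
        obtain x1 x2 where "x1 \<in> carrier G" "c1 = conj_class G x1" "x2 \<in> carrier G" "c2 = conj_class G x2"
          using c(1,2) by (auto simp: C_def centralizer_level_def)
        then show False using conj_class_eq[of x1 z] conj_class_eq[of x2 z] z c(3) by simp
      qed
    qed
    then have "card ?L * k = card C * (n * k)" unfolding un by (simp add: mult.commute mult.left_commute flip: mult.assoc)
    then show ?thesis using n[OF \<open>x \<in> ?L\<close>] by simp
  qed (simp add: C_def)
  moreover have "card C = 0 \<longleftrightarrow> ?L = {}" using fin by (simp add: C_def)
  moreover have "?L = conj_class G x" if C1: "card C = 1" "x \<in> ?L" for x
  proof -
    obtain c where "C = {c}" using C1(1) by (rule card_1_singletonE)
    moreover have "conj_class G x \<in> C" using C1(2) by (simp add: C_def)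
    ultimately have "C = {conj_class G x}" by blast
    then show ?thesis using un by simp
  qed
  ultimately show thesis using that[of "card C"] by (simp add: mult.commute)
qed

text \<open>When \<open>P\<close> acts on itself by conjugation, the number of fixed points is divisible by \<open>p\<close>, and
  \<open>\<one>\<close> is one of them.\<close>

lemma p_subgroup_center:
  assumes P: "subgroup P G" "card P = p ^ k" "Factorial_Ring.prime p" "k > 0"
  obtains z where "z \<in> P" "z \<noteq> \<one>" "P \<subseteq> centralizer G z"
proof -
  interpret P: group "G\<lparr>carrier := P\<rparr>" using P by (simp add: subgroup_imp_group)
  note sub = subgroup.mem_carrier[OF P(1)] subgroup.m_closed[OF P(1)] subgroup.m_inv_closed[OF P(1)]
    subgroup.one_closed[OF P(1)]
  let ?F = "{z \<in> P. \<forall>g \<in> P. g \<otimes> z \<otimes> inv g = z}"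
  have "[card {z \<in> P. \<forall>g \<in> carrier (G\<lparr>carrier := P\<rparr>). g \<otimes> z \<otimes> inv g = z} = card P] (mod p)"
  proof (rule P.fixed_points_cong[where k = k])
    show "finite P" using P finite_subgroup by blast
    show "order (G\<lparr>carrier := P\<rparr>) = p ^ k" using P by (simp add: order_def)
  qed (use sub P in \<open>simp_all add: m_assoc inv_mult_group\<close>)
  then have "p dvd card ?F" using P by (simp add: cong_dvd_iff)
  moreover have "\<one> \<in> ?F" "finite ?F" using sub P finite_subgroup by auto
  ultimately have "card ?F \<noteq> 1" "card ?F > 0" using P(3) prime_nat_iff card_gt_0_iff by auto
  then have "?F \<noteq> {\<one>}" by auto
  then obtain z where "z \<in> ?F" "z \<noteq> \<one>" using \<open>\<one> \<in> ?F\<close> by blast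
  moreover from this have "P \<subseteq> centralizer G z" using sub commutes_iff_conj by (auto simp: centralizer_def)
  ultimately show thesis using that by blast
qed

lemma exists_p_subgroup:
  assumes "Factorial_Ring.prime p" "p ^ k dvd order G"
  obtains P where "subgroup P G" "card P = p ^ k"
  using assms sylow_thm[of p G k] is_group by (metis dvdE finite_carrier)

text \<open>This turns a bound on the orders of centralizers into a bound on the prime powers that
  divide the order of the group: a \<open>p\<close>-subgroup lies in the centralizer of a non-trivial element
  of its own center.\<close>

lemma exists_p_central:
  assumes "Factorial_Ring.prime p" "p ^ k dvd order G" "k > 0"
  obtains P z where "subgroup P G" "card P = p ^ k" "z \<in> P" "z \<noteq> \<one>" "P \<subseteq> centralizer G z"
    "p ^ k dvd card (centralizer G z)"
proof -
  obtain P where P: "subgroup P G" "card P = p ^ k" using exists_p_subgroup assms by blast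
  moreover obtain z where "z \<in> P" "z \<noteq> \<one>" "P \<subseteq> centralizer G z"
    using p_subgroup_center P assms by blast
  moreover from this have "p ^ k dvd card (centralizer G z)"
    using card_dvd_subgroups[OF P(1) subgroup_centralizer] P subgroup.mem_carrier by metis
  ultimately show thesis using that by blast
qed

text \<open>Cauchy's theorem: every non-trivial element of a subgroup of order \<open>p\<close> has order \<open>p\<close>.\<close>

lemma exists_ord_prime:
  assumes "subgroup H G" "Factorial_Ring.prime p" "p dvd card H"
  obtains x where "x \<in> H" "ord x = p"
proof -
  interpret H: finite_group "G\<lparr>carrier := H\<rparr>"
    using assms finite_subgroup by (simp add: finite_group_def finite_group_axioms_def subgroup_imp_group)
  obtain P where P: "subgroup P (G\<lparr>carrier := H\<rparr>)" "card P = p"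
    using H.exists_p_subgroup[of p 1] assms by (auto simp: order_def)
  then have "card P > 1" using assms prime_gt_1_nat by blast
  then obtain x where x: "x \<in> P" "x \<noteq> \<one>"
    by (metis card_le_Suc0_iff_eq card_gt_0_iff less_imp_le_nat not_less One_nat_def subgroup.one_closed[OF P(1)] monoid.simps(2) less_trans zero_less_one)
  have sub: "subgroup P G" using P assms incl_subgroup by blast
  have xG: "x \<in> carrier G" using x sub subgroup.mem_carrier by metis
  interpret P: group "G\<lparr>carrier := P\<rparr>" using sub by (simp add: subgroup_imp_group)
  have "x [^]\<^bsub>G\<lparr>carrier := P\<rparr>\<^esub> p = \<one>" using P.pow_order_eq_1[of x] x P(2) by (simp add: order_def)
  then have "x [^] p = \<one>" using nat_pow_consistent by metis
  then have "ord x dvd p" using xG pow_eq_id by blast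
  then have "ord x = p" using x ord_eq_1[OF xG] assms(2) prime_nat_iff by blast
  moreover have "x \<in> H" using x P subgroup.mem_carrier[OF P(1)] by simp
  ultimately show thesis using that by blast
qed

lemma ord_dvd_card_subgroup: "subgroup H G \<Longrightarrow> x \<in> H \<Longrightarrow> ord x dvd card H"
  using card_dvd_subgroups[of "generate G {x}" H] generate_pow_card[of x]
  by (metis empty_subsetI generate_is_subgroup generate_subgroup_incl insert_subset subgroup.mem_carrier)

lemma prime_index_maximal:
  assumes H: "subgroup H G" and K: "subgroup K G" "H \<subseteq> K" "K \<noteq> H"
    and p: "order G = p * card H" "Factorial_Ring.prime p"
  shows "K = carrier G"
proof -
  have "card H dvd card K" "card K dvd p * card H"
    using card_dvd_subgroups card_dvd_order assms by metis+
  then obtain k where k: "card K = k * card H" by (metis dvdE mult.commute)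
  have "card H > 0" using card_subgroup_pos H by blast
  then have "k dvd p" using k \<open>card K dvd p * card H\<close> by auto
  moreover have "card H < card K" using K psubset_card_mono[OF finite_subgroup[OF K(1)]] by blast
  then have "k \<noteq> 1" using k by auto
  ultimately have "k = p" using p(2) prime_nat_iff by blast
  then have "card K = card (carrier G)" using k p by (simp add: order_def)
  then show ?thesis using K(1) by (metis card_subset_eq finite_carrier subgroup.subset)
qed

end

lemma (in group) pow_eq_pow_iff:
  assumes "x \<in> carrier G"
  shows "x [^] (i::nat) = x [^] (j::nat) \<longleftrightarrow> [i = j] (mod (ord x))"
proof -
  have "x [^] i = x [^] j \<longleftrightarrow> x [^] int i = x [^] int j" by (simp add: int_pow_int)
  also have "\<dots> \<longleftrightarrow> int (ord x) dvd int j - int i" by (rule int_pow_eq[OF assms])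
  also have "\<dots> \<longleftrightarrow> [int j = int i] (mod int (ord x))" by (simp add: cong_iff_dvd_diff)
  also have "\<dots> \<longleftrightarrow> [i = j] (mod (ord x))" by (simp add: cong_int_iff cong_sym_eq)
  finally show ?thesis .
qed

context finite_group
begin

lemma ord_pos: "x \<in> carrier G \<Longrightarrow> ord x > 0"
  using ord_ge_1[OF finite_carrier] by fastforce

lemma generate_singleton_elem:
  assumes x: "x \<in> carrier G" and h: "h \<in> generate G {x}"
  obtains k where "k < ord x" "h = x [^] (k::nat)"
proof -
  have pos: "ord x > 0" using ord_pos[OF x] .
  obtain k where "h = x [^] (k::nat)" using generate_pow_nat[OF x] h pos by auto
  then have "h = x [^] (k mod ord x)" using pow_eq_pow_iff[OF x, of k "k mod ord x"] by (simp add: cong_def)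
  then show thesis using that[of "k mod ord x"] pos by simp
qed

lemma card_generate_singleton: "x \<in> carrier G \<Longrightarrow> card (generate G {x}) = ord x"
  using generate_pow_card by simp

lemma ord_prime_generator:
  assumes x: "x \<in> carrier G" "ord x = p" "Factorial_Ring.prime p" and y: "y \<in> generate G {x}" "y \<noteq> \<one>"
  shows "ord y = p" "generate G {y} = generate G {x}"
proof -
  have sub: "subgroup (generate G {x}) G" using x by (intro generate_is_subgroup) simp
  have yG: "y \<in> carrier G" using y sub subgroup.mem_carrier by metis
  have "ord y dvd p" using ord_dvd_card_subgroup[OF sub y(1)] card_generate_singleton[OF x(1)] x(2) by simp
  then show "ord y = p" using x(3) y(2) ord_eq_1[OF yG] prime_nat_iff by blast
  then have "card (generate G {y}) = card (generate G {x})"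
    using card_generate_singleton x yG by simp
  moreover have "generate G {y} \<subseteq> generate G {x}"
    using y by (intro generate_subgroup_incl[OF _ sub]) simp
  ultimately show "generate G {y} = generate G {x}"
    using card_subset_eq[OF finite_subgroup[OF sub]] by blast
qed

section \<open>Subgroups of index two\<close>

text \<open>The elements outside a subgroup of index two form a single coset.\<close>

lemma index2_coset:
  assumes A: "subgroup A G" "order G = 2 * card A"
    and "g \<in> carrier G" "g \<notin> A" "h \<in> carrier G" "h \<notin> A"
  shows "inv g \<otimes> h \<in> A"
proof -
  let ?gA = "(\<lambda>a. g \<otimes> a) ` A"
  note sub = subgroup.mem_carrier[OF A(1)] subgroup.m_closed[OF A(1)] subgroup.m_inv_closed[OF A(1)]
  have finA: "finite A" using finite_subgroup A by blast
  have "inj_on (\<lambda>a. g \<otimes> a) A" using assms(3) sub by (auto simp: inj_on_def)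
  then have card: "card ?gA = card A" by (rule card_image)
  have "g \<otimes> a \<notin> A" if a: "a \<in> A" for a
  proof
    assume "g \<otimes> a \<in> A"
    then have "g \<otimes> a \<otimes> inv a \<in> A" using sub a by blast
    then show False using assms(3,4) a sub by (simp add: m_assoc)
  qed
  then have "A \<inter> ?gA = {}" by blast
  then have "card (A \<union> ?gA) = card (carrier G)"
    using card finA A(2) by (simp add: card_Un_disjoint order_def)
  moreover have "A \<union> ?gA \<subseteq> carrier G" using assms(3) sub by blast
  ultimately have "A \<union> ?gA = carrier G" by (simp add: card_subset_eq)
  then obtain a where "a \<in> A" "h = g \<otimes> a" using assms(5,6) by blast
  then show ?thesis using assms(3) sub by simp
qed

lemma index2_conj:
  assumes A: "subgroup A G" "order G = 2 * card A" and "g \<in> carrier G" "a \<in> A"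
  shows "g \<otimes> a \<otimes> inv g \<in> A"
proof (cases "g \<in> A")
  case True
  then show ?thesis
    using assms subgroup.m_closed[OF A(1)] subgroup.m_inv_closed[OF A(1)] by simp
next
  case False
  show ?thesis
  proof (rule ccontr)
    have aG: "a \<in> carrier G" using assms subgroup.mem_carrier by metis
    assume "g \<otimes> a \<otimes> inv g \<notin> A"
    then have "inv g \<otimes> (g \<otimes> a \<otimes> inv g) \<in> A"
      using index2_coset[OF A \<open>g \<in> carrier G\<close> False] assms aG by simp
    then have "a \<otimes> inv g \<in> A" using assms aG by (simp add: m_assoc)
    then have "inv a \<otimes> (a \<otimes> inv g) \<in> A"
      using subgroup.m_closed[OF A(1)] subgroup.m_inv_closed[OF A(1)] assms(4) by blast
    then have "inv g \<in> A" using assms aG by simp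
    then show False using False subgroup.m_inv_closed[OF A(1), of "inv g"] assms by simp
  qed
qed

lemma index2_square:
  assumes A: "subgroup A G" "order G = 2 * card A" and g: "g \<in> carrier G"
  shows "g \<otimes> g \<in> A"
proof (rule ccontr)
  assume n: "g \<otimes> g \<notin> A"
  then have "g \<notin> A" using subgroup.m_closed[OF A(1)] by blast
  then have "inv g \<otimes> (g \<otimes> g) \<in> A" using index2_coset[OF A g _ _ n] g by simp
  then show False using \<open>g \<notin> A\<close> g by simp
qed

section \<open>Sylow subgroups\<close>

text \<open>The group generated by \<open>h\<close> acts by translation on the \<open>m\<close> cosets of \<open>Q\<close>. As \<open>p\<close> does not
  divide \<open>m\<close>, it fixes some coset \<open>Q x\<close>, and then \<open>x h x\<^sup>-\<^sup>1 \<in> Q\<close>.\<close>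

lemma conj_into_p_subgroup:
  assumes Q: "subgroup Q G" "card Q = p ^ k" and G: "order G = p ^ k * m" "\<not> p dvd m"
    and p: "Factorial_Ring.prime p" and h: "h \<in> carrier G" "ord h = p"
  obtains g where "g \<in> carrier G" "g \<otimes> h \<otimes> inv g \<in> Q"
proof -
  let ?H = "generate G {h}"
  have H: "subgroup ?H G" using h by (intro generate_is_subgroup) simp
  interpret H: group "G\<lparr>carrier := ?H\<rparr>" using H by (rule subgroup_imp_group)
  have HG: "g \<in> carrier G" if "g \<in> ?H" for g using that H subgroup.mem_carrier by metis
  have QG: "Q \<subseteq> carrier G" using Q subgroup.subset by blast
  have act: "(Q #> x) #> inv g = Q #> (x \<otimes> inv g)" if "x \<in> carrier G" "g \<in> carrier G" for x g
    using coset_mult_assoc[OF QG] that by simp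
  have "[card {M \<in> rcosets Q. \<forall>g \<in> carrier (G\<lparr>carrier := ?H\<rparr>). M #> inv g = M} = card (rcosets Q)] (mod p)"
  proof (rule H.fixed_points_cong[where k = 1])
    fix g M assume "g \<in> carrier (G\<lparr>carrier := ?H\<rparr>)" "M \<in> rcosets Q"
    then obtain x where "x \<in> carrier G" "M = Q #> x" "g \<in> carrier G" using HG by (auto simp: RCOSETS_def)
    then show "M #> inv g \<in> rcosets Q" using rcosetsI[OF QG, of "x \<otimes> inv g"] act by simp
  next
    fix M assume "M \<in> rcosets Q"
    then have "M \<subseteq> carrier G" using rcosets_part_G[OF Q(1)] by blast
    then show "M #> inv \<one>\<^bsub>G\<lparr>carrier := ?H\<rparr>\<^esub> = M" by simp
  next
    fix g g' M assume "g \<in> carrier (G\<lparr>carrier := ?H\<rparr>)" "g' \<in> carrier (G\<lparr>carrier := ?H\<rparr>)" "M \<in> rcosets Q"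
    then have "M \<subseteq> carrier G" "g \<in> carrier G" "g' \<in> carrier G"
      using rcosets_part_G[OF Q(1)] HG by auto
    then show "M #> inv (g \<otimes>\<^bsub>G\<lparr>carrier := ?H\<rparr>\<^esub> g') = (M #> inv g') #> inv g"
      using coset_mult_assoc[of M "inv g'" "inv g"] by (simp add: inv_mult_group)
  next
    show "finite (rcosets Q)" using rcosets_part_G[OF Q(1)] finite_carrier by (metis finite_UnionD)
    show "order (G\<lparr>carrier := ?H\<rparr>) = p ^ 1" using card_generate_singleton h by (simp add: order_def)
  qed (use p in auto)
  moreover have "card (rcosets Q) = m"
  proof -
    have "card (rcosets Q) * p ^ k = m * p ^ k" using lagrange[OF Q(1)] G Q(2) by (simp add: mult.commute)
    then show ?thesis using p by (simp add: prime_gt_0_nat)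
  qed
  ultimately have "\<not> p dvd card {M \<in> rcosets Q. \<forall>g \<in> ?H. M #> inv g = M}"
    using G(2) cong_dvd_iff by auto
  then have "{M \<in> rcosets Q. \<forall>g \<in> ?H. M #> inv g = M} \<noteq> {}" by (metis card.empty dvd_0_right)
  then obtain x where x: "x \<in> carrier G" "\<forall>g \<in> ?H. (Q #> x) #> inv g = Q #> x"
    by (auto simp: RCOSETS_def)
  have "inv h \<in> ?H" by (rule generate.inv) simp
  then have "(Q #> x) #> h = Q #> x" using x(2) h by fastforce
  then have "Q #> (x \<otimes> h) = Q #> x" using coset_mult_assoc[OF QG] x h by simp
  then have "x \<otimes> h \<in> Q #> x" using rcos_self[of "x \<otimes> h" Q] x h Q by simp
  then obtain q where "q \<in> Q" "x \<otimes> h = q \<otimes> x" by (auto simp: r_coset_def)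
  then have "x \<otimes> h \<otimes> inv x = q" using x h QG by (simp add: m_assoc subset_iff)
  then show thesis using that x \<open>q \<in> Q\<close> by simp
qed

text \<open>If \<open>s\<close> is not central in \<open>Q\<close>, then its centralizer in \<open>Q\<close> contains \<open>\<one>\<close>, \<open>s\<close> and a
  non-trivial element \<open>z\<close> of the center of \<open>Q\<close>, which is more than half of the four elements.\<close>

lemma subgroup_order_4_abelian:
  assumes Q: "subgroup Q G" "card Q = 4" and s: "s \<in> Q"
  shows "Q \<subseteq> centralizer G s"
proof -
  have QG: "q \<in> carrier G" if "q \<in> Q" for q using that Q subgroup.mem_carrier by metis
  obtain z where z: "z \<in> Q" "z \<noteq> \<one>" "Q \<subseteq> centralizer G z"
    by (rule p_subgroup_center[OF Q(1), of 2 2]) (use Q in auto)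
  show ?thesis
  proof (cases "s = z \<or> s = \<one>")
    case True
    then show ?thesis using z QG by (auto simp: centralizer_def)
  next
    case False
    let ?C = "Q \<inter> centralizer G s"
    have sub: "subgroup ?C G" using Q subgroup_centralizer QG s subgroups_Inter_pair by blast
    have "s \<in> centralizer G z" using z s by blast
    then have "z \<in> centralizer G s" using centralizer_sym QG z by blast
    then have "{\<one>, s, z} \<subseteq> ?C"
      using z s QG subgroup.one_closed[OF Q(1)] by (auto simp: centralizer_def)
    moreover have "card {\<one>, s, z} = 3" using False z by auto
    moreover have finQ: "finite Q" using finite_subgroup Q by blast
    ultimately have "card ?C \<ge> 3" by (metis card_mono finite_Int)
    moreover have "card ?C dvd card Q" using card_dvd_subgroups[OF sub Q(1)] by blast
    moreover have "card ?C \<le> 4" using card_mono[OF finQ, of ?C] Q(2) by simp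
    ultimately have "card ?C = 4" using Q(2) by (cases "card ?C = 3") auto
    then have "?C = Q" using card_subset_eq[OF finQ, of ?C] Q(2) by simp
    then show ?thesis by blast
  qed
qed

end

section \<open>Groups that act on cosets as an alternating group\<close>

text \<open>The kernel of the action on the \<open>n\<close> cosets is a union of conjugacy classes contained in \<open>H\<close>,
  and no non-trivial class fits into \<open>H - {\<one>}\<close>. So \<open>G\<close> is isomorphic to a subgroup of index two of
  the symmetric group. Such a subgroup contains all squares, hence all 3-cycles, and these
  generate the alternating group.\<close>

lemma coset_action_iso_alt_group:
  assumes G: "finite_group G" and H: "subgroup H G" "order G = n * card H" and n: "2 \<le> n" "2 * order G = fact n"
    and core: "\<And>h. h \<in> H \<Longrightarrow> h \<noteq> \<one>\<^bsub>G\<^esub> \<Longrightarrow> card H \<le> card (conj_class G h)"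
  shows "G \<cong> alt_group n"
proof -
  interpret G: finite_group G by (rule G)
  interpret S: finite_group "sym_group n"
    using sym_group_is_group by (simp add: finite_group_def finite_group_axioms_def sym_group_def finite_permutations)
  let ?E = "rcosets\<^bsub>G\<^esub> H"
  have HG: "H \<subseteq> carrier G" using H subgroup.subset by blast
  have cardE: "card ?E = n"
  proof -
    have "card ?E * card H = n * card H" using G.lagrange[OF H(1)] H(2) by simp
    then show ?thesis using G.card_subgroup_pos[OF H(1)] by simp
  qed
  then have "finite ?E" using n by (intro card_ge_0_finite) simp
  then obtain b where b: "bij_betw b {1..n} ?E" 
    using ex_bij_betw_nat_finite_1[of ?E] cardE by blast
  define act where "act g M = M #>\<^bsub>G\<^esub> inv\<^bsub>G\<^esub> g" for g M
  have act_coset: "act g (H #>\<^bsub>G\<^esub> x) = H #>\<^bsub>G\<^esub> (x \<otimes>\<^bsub>G\<^esub> inv\<^bsub>G\<^esub> g)"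
    if "g \<in> carrier G" "x \<in> carrier G" for g x
    using that G.coset_mult_assoc[OF HG] by (simp add: act_def)
  have E: "\<exists>x \<in> carrier G. M = H #>\<^bsub>G\<^esub> x" if "M \<in> ?E" for M using that by (auto simp: RCOSETS_def)
  have act_closed: "act g M \<in> ?E" if "g \<in> carrier G" "M \<in> ?E" for g M
    using that E[OF that(2)] act_coset G.rcosetsI[OF HG] by fastforce
  have act_one: "act \<one>\<^bsub>G\<^esub> M = M" if "M \<in> ?E" for M
    using E[OF that] act_coset by fastforce
  have act_mult: "act (g \<otimes>\<^bsub>G\<^esub> h) M = act g (act h M)"
    if "g \<in> carrier G" "h \<in> carrier G" "M \<in> ?E" for g h M
    using E[OF that(3)] that by (auto simp: act_coset G.inv_mult_group G.m_assoc)
  define b' where "b' = the_inv_into {1..n} b"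
  have b'b: "b' (b i) = i" if "i \<in> {1..n}" for i
    using that b by (simp add: b'_def the_inv_into_f_f bij_betw_def)
  have bb': "b (b' M) = M" "b' M \<in> {1..n}" if "M \<in> ?E" for M
    using that b f_the_inv_into_f[of b "{1..n}" M] the_inv_into_into[of b "{1..n}" M "{1..n}"]
    by (auto simp: b'_def bij_betw_def)
  have bE: "b i \<in> ?E" if "i \<in> {1..n}" for i using that b by (auto simp: bij_betw_def)
  \<comment> \<open>The action on cosets, transported to permutations of \<open>{1..n}\<close> along the numbering \<open>b\<close>.\<close>
  define \<psi> where "\<psi> g i = (if i \<in> {1..n} then b' (act g (b i)) else i)" for g i
  have \<psi>_mult: "\<psi> (g \<otimes>\<^bsub>G\<^esub> h) = \<psi> g \<circ> \<psi> h" if "g \<in> carrier G" "h \<in> carrier G" for g h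
    using that act_closed bE bb' by (auto simp: \<psi>_def fun_eq_iff act_mult)
  have \<psi>_one: "\<psi> \<one>\<^bsub>G\<^esub> = id"
    using bE by (auto simp: \<psi>_def fun_eq_iff act_one b'b)
  have perm: "\<psi> g permutes {1..n}" if g: "g \<in> carrier G" for g
  proof (rule bij_imp_permutes)
    have inv: "\<psi> (inv\<^bsub>G\<^esub> g) (\<psi> g i) = i" "\<psi> g (\<psi> (inv\<^bsub>G\<^esub> g) i) = i" for i
      using \<psi>_mult[of "inv\<^bsub>G\<^esub> g" g] \<psi>_mult[of g "inv\<^bsub>G\<^esub> g"] \<psi>_one g
      by (simp_all add: fun_eq_iff)
    have cl: "\<psi> g i \<in> {1..n}" if "g \<in> carrier G" "i \<in> {1..n}" for g i
      using that bb'(2)[OF act_closed[OF that(1) bE[OF that(2)]]] by (simp add: \<psi>_def)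
    show "bij_betw (\<psi> g) {1..n} {1..n}"
      by (rule bij_betw_byWitness[where f' = "\<psi> (inv\<^bsub>G\<^esub> g)"]) (use inv cl g in auto)
  qed (auto simp: \<psi>_def)
  have hom: "\<psi> \<in> hom G (sym_group n)"
    using perm \<psi>_mult by (auto simp: hom_def sym_group_def)
  interpret \<psi>: group_hom G "sym_group n" \<psi>
    using hom by (simp add: group_hom_def group_hom_axioms_def G.is_group S.is_group)
  have "g = \<one>\<^bsub>G\<^esub>" if g: "g \<in> carrier G" "\<psi> g = id" for g
  proof (rule ccontr)
    assume ne: "g \<noteq> \<one>\<^bsub>G\<^esub>"
    have fixed: "act g M = M" if M: "M \<in> ?E" for M
      using fun_cong[OF g(2), of "b' M"] bb'[OF M] bb'(1)[OF act_closed[OF g(1) M]]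
      by (auto simp: \<psi>_def)
    have conj: "x \<otimes>\<^bsub>G\<^esub> g \<otimes>\<^bsub>G\<^esub> inv\<^bsub>G\<^esub> x \<in> H" if x: "x \<in> carrier G" for x
    proof -
      have "H #>\<^bsub>G\<^esub> (x \<otimes>\<^bsub>G\<^esub> inv\<^bsub>G\<^esub> g) = H #>\<^bsub>G\<^esub> x"
        using fixed[of "H #>\<^bsub>G\<^esub> x"] act_coset G.rcosetsI[OF HG x] g x by simp
      then have "x \<in> H #>\<^bsub>G\<^esub> (x \<otimes>\<^bsub>G\<^esub> inv\<^bsub>G\<^esub> g)" using G.rcos_self[OF x H(1)] by simp
      then obtain h where h: "h \<in> H" "x = h \<otimes>\<^bsub>G\<^esub> (x \<otimes>\<^bsub>G\<^esub> inv\<^bsub>G\<^esub> g)" by (auto simp: r_coset_def)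
      then have hG: "h \<in> carrier G" using HG by blast
      have "x \<otimes>\<^bsub>G\<^esub> g \<otimes>\<^bsub>G\<^esub> inv\<^bsub>G\<^esub> x = h \<otimes>\<^bsub>G\<^esub> (x \<otimes>\<^bsub>G\<^esub> inv\<^bsub>G\<^esub> g) \<otimes>\<^bsub>G\<^esub> g \<otimes>\<^bsub>G\<^esub> inv\<^bsub>G\<^esub> x"
        using h(2) by simp
      also have "\<dots> = h" using hG x g(1) by (simp add: G.m_assoc)
      finally show ?thesis using h(1) by simp
    qed
    have gH: "g \<in> H" using conj[of "\<one>\<^bsub>G\<^esub>"] g by simp
    have "conj_class G g \<subseteq> H - {\<one>\<^bsub>G\<^esub>}"
    proof
      fix y assume "y \<in> conj_class G g"
      then obtain x where x: "x \<in> carrier G" "y = x \<otimes>\<^bsub>G\<^esub> g \<otimes>\<^bsub>G\<^esub> inv\<^bsub>G\<^esub> x" by (auto simp: conj_class_def)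
      have "y \<noteq> \<one>\<^bsub>G\<^esub>"
        using G.conj_eq_iff[OF x(1) g(1) G.one_closed] x ne by simp
      then show "y \<in> H - {\<one>\<^bsub>G\<^esub>}" using conj x by simp
    qed
    moreover have "finite H" using G.finite_subgroup H by blast
    ultimately have "card (conj_class G g) < card H"
      using subgroup.one_closed[OF H(1)] by (metis Diff_iff card_Diff1_less card_mono finite_Diff le_less_trans)
    then show False using core[OF gH ne] by simp
  qed
  then have inj: "inj_on \<psi> (carrier G)"
    unfolding \<psi>.inj_on_one_iff by (simp add: sym_group_def)
  let ?K = "\<psi> ` carrier G"
  have K: "subgroup ?K (sym_group n)" by (rule \<psi>.img_is_subgroup)
  have cardK: "card ?K = order G" using card_image[OF inj] by (simp add: order_def)
  have ord: "order (sym_group n) = 2 * card ?K"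
    using sym_group_card_carrier[of n] n cardK by (simp add: order_def)
  have sq: "p \<circ> p \<in> ?K" if "p permutes {1..n}" for p
    using S.index2_square[OF K ord, of p] that by (simp add: sym_group_def)
  \<comment> \<open>A 3-cycle \<open>p\<close> is the square of \<open>p\<^sup>2\<close>.\<close>
  have "three_cycles n \<subseteq> ?K"
  proof
    fix p assume "p \<in> three_cycles n"
    then obtain cs where cs: "p = cycle_of_list cs" "cycle cs" "length cs = 3" "set cs \<subseteq> {1..n}" by auto
    have "p ^^ 3 = id" using cycle_is_id_root[OF cs(2)] cs by simp
    then have p3: "p \<circ> (p \<circ> p) = id" by (simp add: numeral_3_eq_3)
    have "p permutes {1..n}" using cs permutes_subset[OF cycle_permutes] by blast
    then have "(p \<circ> p) \<circ> (p \<circ> p) \<in> ?K" using sq permutes_compose by blast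
    moreover have "(p \<circ> p) \<circ> (p \<circ> p) = p \<circ> (p \<circ> (p \<circ> p))" by (simp add: comp_assoc)
    ultimately show "p \<in> ?K" using p3 by simp
  qed
  moreover have "carrier (alt_group n) = generate (sym_group n) (three_cycles n)"
    using alt_group_carrier_as_three_cycles[of n]
      S.generate_consistent[OF three_cycles_incl alt_group_is_subgroup] by (simp add: alt_group_def)
  ultimately have "carrier (alt_group n) \<subseteq> ?K"
    using S.generate_subgroup_incl[OF _ K] by simp
  moreover have "card (carrier (alt_group n)) = card ?K"
    using alt_group_card_carrier[OF n(1)] n(2) cardK by linarith
  ultimately have im: "?K = carrier (alt_group n)"
    using card_subset_eq[of ?K "carrier (alt_group n)"] by simp
  have "\<psi> \<in> hom G (alt_group n)"
    using hom im by (auto simp: hom_def alt_group_def sym_group_def)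
  then show ?thesis using inj im by (auto simp: is_iso_def iso_def bij_betw_def)
qed

section \<open>The class equation of groups with small centralizers\<close>

lemma dvd_if_prime_powers_dvd:
  assumes "n > 0" "m > 0"
    and pp: "\<And>p k. \<lbrakk>Factorial_Ring.prime p; k > 0; p ^ k dvd n\<rbrakk> \<Longrightarrow> p ^ k dvd m"
  shows "n dvd (m::nat)"
proof (rule multiplicity_le_imp_dvd)
  fix p :: nat assume p: "Factorial_Ring.prime p"
  show "multiplicity p n \<le> multiplicity p m"
  proof (cases "multiplicity p n = 0")
    case False
    then have "p ^ multiplicity p n dvd m" using pp[OF p] multiplicity_dvd by blast
    then show ?thesis using p assms(2) by (intro multiplicity_geI) auto
  qed simp
qed (use assms in auto)

lemma dvd_60_cases:
  assumes "(d::nat) dvd 60" shows "d \<in> {1, 2, 3, 4, 5, 6, 10, 12, 15, 20, 30, 60}"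
proof -
  obtain e where e: "60 = d * e" using assms by (elim dvdE)
  have "d < 8 \<or> e < 8"
    using mult_le_mono[of 8 d 8 e] e by linarith
  then have "d = 0 \<or> d = 1 \<or> d = 2 \<or> d = 3 \<or> d = 4 \<or> d = 5 \<or> d = 6 \<or> d = 7 \<or>
      e = 0 \<or> e = 1 \<or> e = 2 \<or> e = 3 \<or> e = 4 \<or> e = 5 \<or> e = 6 \<or> e = 7" by arith
  then show ?thesis using e by (elim disjE; hypsubst; simp; presburger)
qed

text \<open>In a non-abelian finite group this says that the commuting graph has maximum degree less
  than 5.\<close>

definition small_centralizers :: "('a, 'b) monoid_scheme \<Rightarrow> bool" where
  "small_centralizers G \<longleftrightarrow>
    (\<forall>x \<in> carrier G - center G. card (centralizer G x) \<le> card (center G) + 5)"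

context finite_group
begin

text \<open>The class equation, with the classes collected according to the orders of their
  centralizers. Combined with \<open>card_centralizer_level\<close> it becomes a linear Diophantine equation
  for the numbers of classes.\<close>

lemma order_eq_center_levels:
  assumes K: "finite K" "order G \<notin> K" and "\<And>x. x \<in> carrier G - center G \<Longrightarrow> card (centralizer G x) \<in> K"
  shows "order G = card (center G) + (\<Sum>k \<in> K. card (centralizer_level G k))"
proof -
  have disj: "x \<notin> center G" if "x \<in> centralizer_level G k" "k \<in> K" for x k
    using that K by (auto simp: centralizer_level_def center_eq_centralizers order_def)
  have "carrier G = center G \<union> (\<Union>k \<in> K. centralizer_level G k)"
    using assms(3) center_subset by (auto simp: centralizer_level_def)
  moreover have "card (center G \<union> (\<Union>k \<in> K. centralizer_level G k)) =
      card (center G) + card (\<Union>k \<in> K. centralizer_level G k)"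
    using K disj by (intro card_Un_disjoint) (auto simp: centralizer_level_def)
  moreover have "card (\<Union>k \<in> K. centralizer_level G k) = (\<Sum>k \<in> K. card (centralizer_level G k))"
    using K by (intro card_UN_disjoint) (auto simp: centralizer_level_def)
  ultimately show ?thesis by (simp add: order_def)
qed

lemma centralizer_proper:
  assumes "x \<in> carrier G" "x \<notin> center G"
  shows "card (centralizer G x) dvd order G" "card (centralizer G x) < order G"
    "card (center G) dvd card (centralizer G x)" "card (center G) < card (centralizer G x)"
proof -
  have sub: "subgroup (centralizer G x) G" using subgroup_centralizer assms by blast
  then show "card (centralizer G x) dvd order G" by (rule card_dvd_order)
  have "centralizer G x \<subset> carrier G"
    using assms subgroup.subset[OF sub] by (auto simp: center_eq_centralizers)
  then show "card (centralizer G x) < order G" unfolding order_def by (simp add: psubset_card_mono)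
  show "card (center G) dvd card (centralizer G x)"
    by (rule card_dvd_subgroups[OF subgroup_center sub center_subset_centralizer[OF assms(1)]])
  have "x \<in> centralizer G x" using assms by (simp add: centralizer_def)
  then have "center G \<subset> centralizer G x" using assms center_subset_centralizer by blast
  then show "card (center G) < card (centralizer G x)"
    using assms by (simp add: psubset_card_mono)
qed

lemma self_in_centralizer: "x \<in> carrier G \<Longrightarrow> x \<in> centralizer G x"
  by (simp add: centralizer_def)

lemma ord_dvd_card_centralizer: "x \<in> carrier G \<Longrightarrow> y \<in> centralizer G x \<Longrightarrow> ord y dvd card (centralizer G x)"
  using ord_dvd_card_subgroup subgroup_centralizer by blast

lemma not_comm_noncentral:
  assumes "\<not> comm_group G" obtains x where "x \<in> carrier G" "x \<notin> center G"
  using assms abelian_iff_center center_subset by blast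

lemma comm_of_generators:
  assumes "generate G {x, y} = carrier G" "x \<in> carrier G" "y \<in> carrier G" "x \<otimes> y = y \<otimes> x"
  shows "comm_group G"
proof -
  have c: "x \<in> center G" "y \<in> center G"
    using mem_center_iff_generators[OF assms(1)] assms by auto
  then have "generate G {x, y} \<subseteq> center G" by (intro generate_subgroup_incl[OF _ subgroup_center]) simp
  then show ?thesis using assms(1) center_subset by (simp add: abelian_iff_center subset_antisym)
qed

lemma generate_pair_index:
  assumes x: "x \<in> carrier G" and y: "y \<in> carrier G" "y \<notin> generate G {x}"
    and ord: "order G = 2 * ord x"
  shows "generate G {x, y} = carrier G"
proof (rule prime_index_maximal[of "generate G {x}" _ 2])
  show "subgroup (generate G {x}) G" "subgroup (generate G {x, y}) G"
    using x y by (simp_all add: generate_is_subgroup)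
  show "generate G {x} \<subseteq> generate G {x, y}" by (rule mono_generate) simp
  show "generate G {x, y} \<noteq> generate G {x}" using y generate.incl[of y "{x, y}" G] by auto
qed (use ord x card_generate_singleton in auto)

text \<open>An involution \<open>y\<close> conjugates an element \<open>x\<close> of order \<open>p\<close> to some \<open>x ^ k\<close> with \<open>k\<^sup>2 = 1\<close>
  modulo \<open>p\<close>. Here \<open>k = 1\<close> would make the group abelian, so \<open>k = p - 1\<close> and the group is
  dihedral.\<close>

lemma order_2p_nonabelian:
  assumes p: "Factorial_Ring.prime p" "odd p" and G: "order G = 2 * p" "\<not> comm_group G"
  shows "presented_by G (metacyclic_relations p 2 (p - 1) 0)"
proof -
  have whole: "subgroup (carrier G) G" by (rule subgroup_self)
  obtain x where x: "x \<in> carrier G" "ord x = p"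
    using exists_ord_prime[OF whole p(1)] G by (auto simp: order_def)
  obtain y where y: "y \<in> carrier G" "ord y = 2"
    using exists_ord_prime[OF whole two_is_prime_nat] G by (auto simp: order_def)
  let ?A = "generate G {x}"
  have A: "subgroup ?A G" "card ?A = p" using x card_generate_singleton by (auto intro: generate_is_subgroup)
  have yA: "y \<notin> ?A" using ord_dvd_card_subgroup[OF A(1), of y] A(2) y p(2) by auto
  have gen: "generate G {x, y} = carrier G" using generate_pair_index x y yA G by simp
  have y2: "y \<otimes> y = \<one>" using y pow_ord_eq_1[of y] by (simp add: numeral_2_eq_2)
  have "y \<otimes> x \<otimes> inv y \<in> ?A"
    using index2_conj[OF A(1) _ y(1), of x] G A(2) generate.incl[of x "{x}" G] by simp
  then obtain k where k: "k < p" "y \<otimes> x \<otimes> inv y = x [^] k"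
    using generate_singleton_elem[OF x(1)] x(2) by metis
  have "y \<otimes> (y \<otimes> x \<otimes> inv y) \<otimes> inv y = x"
  proof -
    have "y \<otimes> (y \<otimes> x \<otimes> inv y) \<otimes> inv y = (y \<otimes> y) \<otimes> x \<otimes> inv (y \<otimes> y)"
      using x(1) y(1) by (simp add: inv_mult_group m_assoc)
    then show ?thesis using y2 x(1) by simp
  qed
  moreover have "y \<otimes> (y \<otimes> x \<otimes> inv y) \<otimes> inv y = x [^] (k * k)"
    unfolding k(2) using conj_pow[OF y(1) x(1), of k] k(2) x(1) by (simp add: nat_pow_pow)
  ultimately have "x [^] (k * k) = x [^] (1::nat)" using x by simp
  then have "[k * k = 1] (mod p)" using pow_eq_pow_iff x by blast
  then have "[int k * int k = 1] (mod int p)" by (metis cong_int_iff of_nat_1 of_nat_mult)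
  then have "int p dvd (int k - 1) * (int k + 1)"
    by (simp add: cong_iff_dvd_diff algebra_simps)
  then consider "int p dvd int k - 1" | "int p dvd int k + 1"
    using p(1) prime_dvd_mult_iff[of "int p"] by auto
  then have "k = p - 1"
  proof cases
    case 1
    then have "[int k = int 1] (mod int p)" by (simp add: cong_iff_dvd_diff)
    then have "[k = 1] (mod p)" using cong_int_iff by blast
    then have "x [^] k = x" using pow_eq_pow_iff[OF x(1), of k 1] x by simp
    then have "x \<otimes> y = y \<otimes> x" using k(2) commutes_iff_conj[OF y(1) x(1)] by simp
    then show ?thesis using comm_of_generators gen x y G by blast
  next
    case 2
    then have "p dvd k + 1" by (metis int_dvd_int_iff of_nat_1 of_nat_add)
    then show ?thesis using k(1) dvd_imp_le[of p "k + 1"] by simp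
  qed
  then show ?thesis
    using x y gen k(2) y2 pow_ord_eq_1[OF x(1)]
    by (intro presented_by_two_gensI) (auto simp: satisfies_metacyclic numeral_2_eq_2)
qed

end

section \<open>Groups with trivial center\<close>

locale trivial_center_case = finite_group +
  assumes not_comm: "\<not> comm_group G"
    and trivial_center: "center G = {\<one>}"
    and small: "\<And>x. \<lbrakk>x \<in> carrier G; x \<noteq> \<one>\<rbrakk> \<Longrightarrow> card (centralizer G x) \<le> 6"
begin

lemma whole: "subgroup (carrier G) G"
  by (rule subgroup_self)

lemma exists_ord: "Factorial_Ring.prime p \<Longrightarrow> p dvd order G \<Longrightarrow> \<exists>x. x \<in> carrier G \<and> ord x = p"
  using exists_ord_prime[OF whole] by (auto simp: order_def)

lemma ne_one: "ord x = p \<Longrightarrow> p \<ge> 2 \<Longrightarrow> x \<noteq> \<one>"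
  using ord_id by fastforce

lemma card_centralizer_dvd: "x \<in> carrier G \<Longrightarrow> card (centralizer G x) dvd order G"
  using subgroup_centralizer card_dvd_order by blast

lemma card_centralizer_gt_1:
  assumes "x \<in> carrier G" "x \<noteq> \<one>" shows "1 < card (centralizer G x)"
  using centralizer_proper(4)[of x] assms trivial_center by simp

text \<open>A subgroup of order \<open>p ^ k\<close> is contained in the centralizer of one of its non-trivial
  elements, and this centralizer has at most 6 elements and is not the whole group.\<close>

lemma prime_power_dvd_order:
  assumes "Factorial_Ring.prime p" "k > 0" "p ^ k dvd order G"
  shows "p ^ k \<le> 6" "p ^ k < order G"
proof -
  obtain P z where z: "subgroup P G" "z \<in> P" "z \<noteq> \<one>" "p ^ k dvd card (centralizer G z)"
    using exists_p_central[OF assms(1,3,2)] by metis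
  then have "z \<in> carrier G" using subgroup.mem_carrier by metis
  then show "p ^ k \<le> 6" "p ^ k < order G"
    using small[of z] z card_centralizer_gt_1[of z] dvd_imp_le[OF z(4)] centralizer_proper(2)[of z] trivial_center
    by auto
qed

lemma order_dvd_60: "order G dvd 60"
proof (rule dvd_if_prime_powers_dvd)
  fix p k :: nat assume p: "Factorial_Ring.prime p" "k > 0" "p ^ k dvd order G"
  have "0 < p ^ k" "p ^ k \<le> 6" using prime_power_dvd_order[OF p] p(1) by (simp_all add: prime_gt_0_nat)
  then have "p ^ k = 1 \<or> p ^ k = 2 \<or> p ^ k = 3 \<or> p ^ k = 4 \<or> p ^ k = 5 \<or> p ^ k = 6" by arith
  then show "p ^ k dvd 60" by (elim disjE; simp only:; simp)
qed (use order_pos in auto)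

lemma order_cases: "order G \<in> {6, 10, 12, 15, 20, 30, 60}"
proof -
  have "order G \<in> {1, 2, 3, 4, 5, 6, 10, 12, 15, 20, 30, 60}"
    using dvd_60_cases[OF order_dvd_60] .
  moreover have "order G \<noteq> 1"
  proof
    assume "order G = 1"
    then have "card (carrier G) = card (center G)" by (simp add: order_def trivial_center)
    then have "center G = carrier G" using card_subset_eq[OF finite_carrier center_subset] by simp
    then show False using abelian_iff_center not_comm by blast
  qed
  moreover have "order G \<noteq> p ^ k" if "Factorial_Ring.prime p" "k > 0" for p k
    using prime_power_dvd_order(2)[OF that] by (metis dvd_refl less_irrefl)
  from this[of 2 1] this[of 3 1] this[of 2 2] this[of 5 1]
  have "order G \<noteq> 2" "order G \<noteq> 3" "order G \<noteq> 4" "order G \<noteq> 5" by simp_all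
  ultimately show ?thesis by simp
qed

lemma levels:
  assumes K: "finite K" "order G \<notin> K" and "\<And>x. x \<in> carrier G \<Longrightarrow> x \<noteq> \<one> \<Longrightarrow> card (centralizer G x) \<in> K"
  shows "order G = 1 + (\<Sum>k \<in> K. card (centralizer_level G k))"
  using order_eq_center_levels[OF K] assms(3) trivial_center by simp

lemma level_nonempty: "x \<in> carrier G \<Longrightarrow> card (centralizer G x) = k \<Longrightarrow> centralizer_level G k \<noteq> {}"
  by (auto simp: centralizer_level_def)

lemma centralizer_5:
  assumes "x \<in> carrier G" "ord x = 5" shows "card (centralizer G x) = 5"
proof -
  have "5 dvd card (centralizer G x)" using ord_dvd_card_centralizer self_in_centralizer assms by metis
  moreover have "card (centralizer G x) \<le> 6" using small assms ne_one[of x 5] by simp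
  moreover have "card (centralizer G x) > 1" using card_centralizer_gt_1 assms ne_one[of x 5] by simp
  ultimately show ?thesis by (auto elim!: dvdE)
qed

text \<open>With \<open>m\<^sub>k\<close> classes of elements whose centralizer has order \<open>k\<close>, the class equation is
  \<open>29 = 15 m\<^sub>2 + 10 m\<^sub>3 + 6 m\<^sub>5 + 5 m\<^sub>6\<close>. As there are elements of order 5, \<open>m\<^sub>5 > 0\<close>, and then
  the only solution is \<open>m\<^sub>5 = 4\<close> and \<open>m\<^sub>6 = 1\<close>. So the elements of orders 2 and 3 all lie in one
  conjugacy class, which is absurd.\<close>

lemma not_order_30: "order G \<noteq> 30"
proof
  assume G: "order G = 30"
  have c: "card (centralizer G x) \<in> {2, 3, 5, 6}" if "x \<in> carrier G" "x \<noteq> \<one>" for x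
  proof -
    have "card (centralizer G x) \<in> {2..6}" using small[OF that] card_centralizer_gt_1[OF that] by simp
    moreover have "{2..6} = {2, 3, 4, 5, 6::nat}" by auto
    moreover have "card (centralizer G x) \<noteq> 4"
      using card_centralizer_dvd[OF that(1)] G by (intro notI) simp
    ultimately show ?thesis by auto
  qed
  then have sum: "30 = 1 + (card (centralizer_level G 2) + (card (centralizer_level G 3) +
      (card (centralizer_level G 5) + card (centralizer_level G 6))))"
    using levels[of "{2, 3, 5, 6}"] G by simp
  obtain m2 where m2: "2 * card (centralizer_level G 2) = m2 * 30" "m2 = 0 \<longleftrightarrow> centralizer_level G 2 = {}"
    using card_centralizer_level[of 2] G by metis
  obtain m3 where m3: "3 * card (centralizer_level G 3) = m3 * 30" "m3 = 0 \<longleftrightarrow> centralizer_level G 3 = {}"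
    using card_centralizer_level[of 3] G by metis
  obtain m5 where m5: "5 * card (centralizer_level G 5) = m5 * 30" "m5 = 0 \<longleftrightarrow> centralizer_level G 5 = {}"
    using card_centralizer_level[of 5] G by metis
  obtain m6 where m6: "6 * card (centralizer_level G 6) = m6 * 30"
    "\<And>x. m6 = 1 \<Longrightarrow> x \<in> centralizer_level G 6 \<Longrightarrow> centralizer_level G 6 = conj_class G x"
    using card_centralizer_level[of 6] G by metis
  obtain x5 where "x5 \<in> carrier G" "ord x5 = 5" using exists_ord[of 5] G by auto
  then have "m5 \<noteq> 0" using m5 level_nonempty centralizer_5 by blast
  moreover have "29 = 15 * m2 + 10 * m3 + 6 * m5 + 5 * m6" using sum m2(1) m3(1) m5(1) m6(1) by linarith
  \<comment> \<open>Collecting the multiples of 5 leaves an equation in two unknowns.\<close>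
  moreover define t where "t = 3 * m2 + 2 * m3 + m6"
  ultimately have "29 = 5 * t + 6 * m5" "m5 \<noteq> 0" by simp_all
  then have "t = 1" by presburger
  then have "m2 = 0 \<and> m3 = 0 \<and> m6 = 1" unfolding t_def by arith
  then have empty: "centralizer_level G 2 = {}" "centralizer_level G 3 = {}"
    and single: "\<And>x. x \<in> centralizer_level G 6 \<Longrightarrow> centralizer_level G 6 = conj_class G x"
    using m2 m3 m6 by auto
  have level6: "x \<in> centralizer_level G 6" if x: "x \<in> carrier G" "ord x = p" "p = 2 \<or> p = 3" for x p
  proof -
    have "card (centralizer G x) \<noteq> 5"
      using ord_dvd_card_centralizer[OF x(1) self_in_centralizer[OF x(1)]] x by (intro notI) auto
    moreover have "card (centralizer G x) \<notin> {2, 3}" using empty level_nonempty x(1) by blast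
    moreover have "card (centralizer G x) \<in> {2, 3, 5, 6}"
      using c[OF x(1)] ne_one[OF x(2)] x(3) by auto
    ultimately show ?thesis using x(1) by (auto simp: centralizer_level_def)
  qed
  obtain u where u: "u \<in> carrier G" "ord u = 2" using exists_ord[of 2] G by auto
  obtain w where w: "w \<in> carrier G" "ord w = 3" using exists_ord[of 3] G by auto
  have "w \<in> conj_class G u" using single[of u] level6[OF u] level6[OF w] by simp
  then obtain g where g: "g \<in> carrier G" "w = g \<otimes> u \<otimes> inv g" by (auto simp: conj_class_def)
  have "u [^] (2::nat) = \<one>" using pow_ord_eq_1[OF u(1)] u(2) by simp
  then have "w [^] (2::nat) = \<one>" using conj_pow[OF g(1) u(1), of 2] g by simp
  then show False using pow_eq_id[OF w(1)] w(2) by simp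
qed

text \<open>The class equation \<open>14 = 5 m\<^sub>3 + 3 m\<^sub>5\<close> has the only solution \<open>m\<^sub>3 = 1\<close>, so an element \<open>y\<close>
  of order 3 is conjugate to its inverse by some \<open>g\<close>. Then \<open>g\<^sup>2\<close> lies in \<open>C(y)\<close>, which has order
  3. In a group of order 15 this makes \<open>g\<close> a power of \<open>g\<^sup>2\<close>, so \<open>g\<close> centralizes \<open>y\<close> itself, and
  \<open>y\<close> equals its inverse.\<close>

lemma not_order_15: "order G \<noteq> 15"
proof
  assume G: "order G = 15"
  have c: "card (centralizer G x) \<in> {3, 5}" if "x \<in> carrier G" "x \<noteq> \<one>" for x
  proof -
    have "card (centralizer G x) \<in> {2..6}" using small[OF that] card_centralizer_gt_1[OF that] by simp
    moreover have "{2..6} = {2, 3, 4, 5, 6::nat}" by auto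
    moreover have "card (centralizer G x) dvd 15" using card_centralizer_dvd[OF that(1)] G by simp
    ultimately show ?thesis by auto
  qed
  then have sum: "15 = 1 + (card (centralizer_level G 3) + card (centralizer_level G 5))"
    using levels[of "{3, 5}"] G by simp
  obtain m3 where m3: "3 * card (centralizer_level G 3) = m3 * 15"
    "m3 = 0 \<longleftrightarrow> centralizer_level G 3 = {}"
    "\<And>x. m3 = 1 \<Longrightarrow> x \<in> centralizer_level G 3 \<Longrightarrow> centralizer_level G 3 = conj_class G x"
    using card_centralizer_level[of 3] G by metis
  obtain m5 where m5: "5 * card (centralizer_level G 5) = m5 * 15"
    using card_centralizer_level[of 5] G by metis
  have "14 = 5 * m3 + 3 * m5" using sum m3(1) m5(1) by linarith
  then have "m3 = 1" by presburger
  obtain y where y: "y \<in> carrier G" "ord y = 3" using exists_ord[of 3] G by auto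
  have level3: "y' \<in> centralizer_level G 3" if "y' \<in> carrier G" "ord y' = 3" for y'
  proof -
    have "card (centralizer G y') \<noteq> 5"
      using ord_dvd_card_centralizer[OF that(1) self_in_centralizer[OF that(1)]] that by (intro notI) auto
    then show ?thesis using c[OF that(1)] ne_one[OF that(2)] that(1) by (auto simp: centralizer_level_def)
  qed
  have "inv y \<in> conj_class G y" using m3(3)[OF \<open>m3 = 1\<close> level3[OF y]] level3[of "inv y"] y by simp
  then obtain g where g: "g \<in> carrier G" "inv y = g \<otimes> y \<otimes> inv g" by (auto simp: conj_class_def)
  have ginv: "g \<otimes> inv y \<otimes> inv g = y"
  proof -
    have "inv (inv y) = inv (g \<otimes> y \<otimes> inv g)" using g(2) by simp
    then show ?thesis using g(1) y(1) by (simp add: inv_mult_group m_assoc)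
  qed
  have "(g \<otimes> g) \<otimes> y \<otimes> inv (g \<otimes> g) = g \<otimes> (g \<otimes> y \<otimes> inv g) \<otimes> inv g"
    using g(1) y(1) by (simp add: inv_mult_group m_assoc)
  also have "\<dots> = y" unfolding g(2)[symmetric] by (rule ginv)
  finally have g2: "g \<otimes> g \<in> centralizer G y"
    using commutes_iff_conj[of "g \<otimes> g" y] g(1) y(1) by (simp add: centralizer_def)
  have card3: "card (centralizer G y) = 3" using level3[OF y] by (simp add: centralizer_level_def)
  have "ord (g \<otimes> g) dvd 3" using ord_dvd_card_centralizer[OF y(1) g2] card3 by simp
  then have "(g \<otimes> g) [^] (3::nat) = \<one>" using pow_eq_id g(1) by simp
  then have "g [^] (6::nat) = \<one>" using g(1) nat_pow_pow[OF g(1), of 2 3] by (simp add: numeral_2_eq_2)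
  then have "ord g dvd 6" using pow_eq_id g(1) by simp
  moreover have "ord g dvd 15" using ord_dvd_group_order[OF g(1)] G by simp
  ultimately have "ord g dvd gcd 6 15" by (rule gcd_greatest)
  moreover have "gcd 6 (15::nat) = 3" by (simp add: gcd_non_0_nat)
  ultimately have "g [^] (4::nat) = g [^] (1::nat)" 
    using pow_eq_pow_iff[OF g(1), of 4 1] cong_dvd_modulus_nat[of 4 1 3 "ord g"] by (simp add: cong_def)
  then have "g = (g \<otimes> g) \<otimes> (g \<otimes> g)"
    using g(1) nat_pow_pow[OF g(1), of 2 2] by (simp add: numeral_eq_Suc m_assoc)
  then have "g \<in> centralizer G y" using subgroup.m_closed[OF subgroup_centralizer[OF y(1)] g2 g2] by simp
  then have "inv y = y" using g commutes_iff_conj[OF g(1) y(1)] by (simp add: centralizer_def)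
  then have "y \<otimes> y = \<one>" using r_inv[OF y(1)] by simp
  then have "ord y dvd 2" using pow_eq_id[OF y(1), of 2] y(1) by (simp add: numeral_2_eq_2)
  then show False using y(2) by simp
qed

end

lemma dvd_6_cases: 
  assumes "(d::nat) dvd 6" shows "d \<in> {1, 2, 3, 6}"
proof -
  have "d \<le> 6" using assms by (rule dvd_imp_le) simp
  then have "d = 0 \<or> d = 1 \<or> d = 2 \<or> d = 3 \<or> d = 4 \<or> d = 5 \<or> d = 6" by arith
  then show ?thesis using assms by (elim disjE) simp_all
qed

lemma dvd_4_cases: 
  assumes "(d::nat) dvd 4" shows "d \<in> {1, 2, 4}"
proof -
  have "d \<le> 4" using assms by (rule dvd_imp_le) simp
  then have "d = 0 \<or> d = 1 \<or> d = 2 \<or> d = 3 \<or> d = 4" by arith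
  then show ?thesis using assms by (elim disjE) simp_all
qed

context trivial_center_case
begin

lemma order_eq_4m:
  assumes "4 dvd order G" obtains m where "order G = 2 ^ 2 * m" "\<not> 2 dvd m"
proof -
  obtain m where m: "order G = 4 * m" using assms by (elim dvdE)
  then have "m = 3 \<or> m = 5 \<or> m = 15" using order_cases by simp presburger
  then have "\<not> 2 dvd m" by auto
  then show thesis using that m by simp
qed

text \<open>An involution is conjugate to an element of a Sylow 2-subgroup, which has order 4 and
  therefore is abelian.\<close>

lemma centralizer_2:
  assumes G: "4 dvd order G" and h: "h \<in> carrier G" "ord h = 2"
  shows "card (centralizer G h) = 4"
proof -
  obtain m where m: "order G = 2 ^ 2 * m" "\<not> 2 dvd m" using order_eq_4m[OF G] .
  then have "2 ^ 2 dvd order G" by simp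
  then obtain Q where Q: "subgroup Q G" "card Q = 2 ^ 2" using exists_p_subgroup[OF two_is_prime_nat] by metis
  obtain g where g: "g \<in> carrier G" "g \<otimes> h \<otimes> inv g \<in> Q"
    using conj_into_p_subgroup[OF Q m two_is_prime_nat h] .
  have yG: "g \<otimes> h \<otimes> inv g \<in> carrier G" using g h by simp
  have "card Q dvd card (centralizer G (g \<otimes> h \<otimes> inv g))"
    using card_dvd_subgroups[OF Q(1) subgroup_centralizer[OF yG]] subgroup_order_4_abelian[OF Q(1) _ g(2)] Q(2)
    by simp
  then have "4 dvd card (centralizer G h)"
    using card_centralizer_conj_class[OF h(1) conj_classI[OF g(1)]] Q(2) by simp
  moreover have "card (centralizer G h) \<le> 6" "1 < card (centralizer G h)"
    using small card_centralizer_gt_1 h ne_one[of h 2] by simp_all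
  ultimately show ?thesis by (auto elim!: dvdE)
qed

text \<open>A centralizer of order 6 would contain an involution, and the centralizer of that involution
  would have order divisible by 3.\<close>

lemma centralizer_3:
  assumes G: "4 dvd order G" and h: "h \<in> carrier G" "ord h = 3"
  shows "card (centralizer G h) = 3"
proof (rule ccontr)
  assume ne: "card (centralizer G h) \<noteq> 3"
  have "3 dvd card (centralizer G h)"
    using ord_dvd_card_centralizer[OF h(1) self_in_centralizer[OF h(1)]] h by simp
  moreover have "card (centralizer G h) \<le> 6" "1 < card (centralizer G h)"
    using small card_centralizer_gt_1 h ne_one[of h 3] by simp_all
  ultimately have "card (centralizer G h) = 6" using ne by (auto elim!: dvdE)
  then obtain u where u: "u \<in> centralizer G h" "ord u = 2"
    using exists_ord_prime[OF subgroup_centralizer[OF h(1)] two_is_prime_nat] by auto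
  then have uG: "u \<in> carrier G" by (simp add: centralizer_def)
  then have "ord h dvd card (centralizer G u)"
    using ord_dvd_card_centralizer[OF uG] centralizer_sym[OF h(1) u(1)] by simp
  then show False using centralizer_2[OF G uG u(2)] h by simp
qed

lemma ord_eq_prime:
  assumes "x \<in> carrier G" "x \<noteq> \<one>" "ord x dvd p" "Factorial_Ring.prime p"
  shows "ord x = p"
  using assms ord_eq_1[OF assms(1)] prime_nat_iff by blast

text \<open>If \<open>|C(x)| = 6\<close>, then \<open>x\<close> has order 6, since elements of order 2 and 3 have centralizers of
  order 4 and 3; but \<open>x\<close> centralizes the involution \<open>x\<^sup>3\<close>.\<close>

lemma centralizers_345:
  assumes G: "4 dvd order G" and x: "x \<in> carrier G" "x \<noteq> \<one>"
  shows "card (centralizer G x) \<in> {3, 4, 5}"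
proof -
  have "card (centralizer G x) \<le> 6" "1 < card (centralizer G x)"
    using small card_centralizer_gt_1 x by simp_all
  then have "card (centralizer G x) \<in> {2, 3, 4, 5, 6}" by auto
  moreover have dvd: "ord x dvd card (centralizer G x)"
    using ord_dvd_card_centralizer[OF x(1) self_in_centralizer[OF x(1)]] .
  have ne1: "ord x \<noteq> 1" using ord_eq_1 x by simp
  have "card (centralizer G x) \<noteq> 2"
  proof
    assume c: "card (centralizer G x) = 2"
    then have "ord x = 2" using ord_eq_prime[OF x, of 2] dvd by simp
    then show False using centralizer_2[OF G x(1)] c by simp
  qed
  moreover have "card (centralizer G x) \<noteq> 6"
  proof
    assume c: "card (centralizer G x) = 6"
    then have "ord x \<in> {1, 2, 3, 6}" using dvd dvd_6_cases by simp
    then have "ord x = 6" using centralizer_2[OF G x(1)] centralizer_3[OF G x(1)] c ne1 by auto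
    then have "ord (x [^] (3::nat)) = 2" using ord_pow[OF x(1), of 3] by simp
    then have "card (centralizer G (x [^] (3::nat))) = 4" using centralizer_2[OF G] x by simp
    moreover have "x \<in> centralizer G (x [^] (3::nat))"
      using x by (simp add: centralizer_def numeral_3_eq_3 m_assoc)
    ultimately show False
      using ord_dvd_card_centralizer[of "x [^] (3::nat)" x] x \<open>ord x = 6\<close> by auto
  qed
  ultimately show ?thesis by blast
qed

text \<open>A non-trivial element of a subgroup of order 3 has 4 conjugates, so \<open>G\<close> acts faithfully on
  the four cosets of this subgroup.\<close>

lemma order_12_iso_alt_group_4:
  assumes G: "order G = 12" shows "G \<cong> alt_group 4"
proof -
  have G4: "4 dvd order G" using G by simp
  obtain w where w: "w \<in> carrier G" "ord w = 3" using exists_ord[of 3] G by auto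
  let ?H = "generate G {w}"
  have H: "subgroup ?H G" "card ?H = 3"
    using w card_generate_singleton by (auto intro: generate_is_subgroup)
  show ?thesis
  proof (rule coset_action_iso_alt_group[OF finite_group_axioms H(1)])
    fix h assume h: "h \<in> ?H" "h \<noteq> \<one>"
    then have "ord h = 3" using ord_prime_generator(1)[OF w] by simp
    moreover have hG: "h \<in> carrier G" using h H subgroup.mem_carrier by metis
    ultimately show "card ?H \<le> card (conj_class G h)"
      using card_conj_class[OF hG] centralizer_3[OF G4 hG] G H(2) by simp
  qed (use G H in \<open>simp_all add: fact_numeral\<close>)
qed

text \<open>The class equation is \<open>19 = 5 m\<^sub>4 + 4 m\<^sub>5\<close> and forces \<open>m\<^sub>5 = 1\<close>. So an element \<open>x\<close> of order
  5 is conjugate to \<open>x\<^sup>2\<close>, by an element \<open>y\<close> that acts on the powers of \<open>x\<close> as an automorphism of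
  order 4. The power \<open>y\<^sup>4\<close> centralizes \<open>x\<close>. Were it not trivial, its centralizer would consist of
  the powers of \<open>x\<close>; but \<open>y\<close> lies in this centralizer and does not commute with \<open>x\<close>.\<close>

lemma order_20_presented:
  assumes G: "order G = 20" shows "presented_by G (metacyclic_relations 5 4 2 0)"
proof -
  have G4: "4 dvd order G" using G by simp
  have c45: "card (centralizer G x) \<in> {4, 5}" if x: "x \<in> carrier G" "x \<noteq> \<one>" for x
  proof -
    have "card (centralizer G x) \<noteq> 3" using card_centralizer_dvd[OF x(1)] G by (intro notI) simp
    then show ?thesis using centralizers_345[OF G4 x] by simp
  qed
  then have sum: "20 = 1 + (card (centralizer_level G 4) + card (centralizer_level G 5))"
    using levels[of "{4, 5}"] G by simp
  obtain m4 where m4: "4 * card (centralizer_level G 4) = m4 * 20"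
      "m4 = 0 \<longleftrightarrow> centralizer_level G 4 = {}"
    using card_centralizer_level[of 4] G by metis
  obtain m5 where m5: "5 * card (centralizer_level G 5) = m5 * 20"
    "\<And>x. m5 = 1 \<Longrightarrow> x \<in> centralizer_level G 5 \<Longrightarrow> centralizer_level G 5 = conj_class G x"
    using card_centralizer_level[of 5] G by metis
  obtain u where u: "u \<in> carrier G" "ord u = 2" using exists_ord[of 2] G by auto
  have "m4 \<noteq> 0" using m4(2) level_nonempty[OF u(1) centralizer_2[OF G4 u]] by blast
  moreover have "19 = 5 * m4 + 4 * m5" using sum m4(1) m5(1) by linarith
  ultimately have "m5 = 1" by presburger
  have level5: "x \<in> centralizer_level G 5" if "x \<in> carrier G" "ord x = 5" for x
    using centralizer_5[OF that] that by (simp add: centralizer_level_def)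
  obtain x where x: "x \<in> carrier G" "ord x = 5" using exists_ord[of 5] G by auto
  have x2: "ord (x [^] (2::nat)) = 5"
    using ord_pow_gen[OF x(1), of 2] x(2) by simp
  have "x [^] (2::nat) \<in> conj_class G x" using m5(2)[OF \<open>m5 = 1\<close> level5[OF x]] level5[OF _ x2] x(1) by simp
  then obtain y where y: "y \<in> carrier G" "y \<otimes> x \<otimes> inv y = x [^] (2::nat)" by (auto simp: conj_class_def)
  have conj: "y [^] (2::nat) \<otimes> x \<otimes> inv (y [^] (2::nat)) = x [^] (4::nat)"
  proof -
    have "y [^] (2::nat) \<otimes> x \<otimes> inv (y [^] (2::nat)) = y \<otimes> (y \<otimes> x \<otimes> inv y) \<otimes> inv y"
      using x(1) y(1) by (simp add: numeral_2_eq_2 inv_mult_group m_assoc)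
    also have "\<dots> = (y \<otimes> x \<otimes> inv y) [^] (2::nat)"
      unfolding y(2) using conj_pow[OF y(1) x(1), of 2] y(2) by simp
    also have "\<dots> = x [^] (4::nat)" unfolding y(2) using x(1) by (simp add: nat_pow_pow)
    finally show ?thesis .
  qed
  have conj4: "y [^] (4::nat) \<otimes> x \<otimes> inv (y [^] (4::nat)) = x"
  proof -
    let ?z = "y [^] (2::nat)"
    have "y [^] (4::nat) = ?z \<otimes> ?z" using y(1) by (simp add: nat_pow_mult)
    then have "y [^] (4::nat) \<otimes> x \<otimes> inv (y [^] (4::nat)) = ?z \<otimes> (?z \<otimes> x \<otimes> inv ?z) \<otimes> inv ?z"
      using x(1) y(1) by (simp add: inv_mult_group m_assoc)
    also have "\<dots> = (?z \<otimes> x \<otimes> inv ?z) [^] (4::nat)"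
      unfolding conj using conj_pow[of ?z x 4] x(1) y(1) conj by simp
    also have "\<dots> = x [^] (16::nat)" unfolding conj using x(1) by (simp add: nat_pow_pow)
    also have "\<dots> = x [^] (1::nat)" using pow_eq_pow_iff[OF x(1), of 16 1] x(2) by (simp add: cong_def)
    finally show ?thesis using x(1) by simp
  qed
  have y4: "y [^] (4::nat) = \<one>"
  proof (rule ccontr)
    let ?v = "y [^] (4::nat)"
    assume v: "?v \<noteq> \<one>"
    have vG: "?v \<in> carrier G" using y by simp
    have vC: "?v \<in> centralizer G x"
      using commutes_iff_conj[OF vG x(1)] conj4 vG by (simp add: centralizer_def)
    then have "ord ?v = 5"
      using ord_dvd_card_centralizer[OF x(1) vC] centralizer_5[OF x] ord_eq_prime[OF vG v, of 5] by simp
    then have c: "card (centralizer G ?v) = 5" using centralizer_5[OF vG] by simp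
    have "y \<in> centralizer G ?v" using y(1) by (simp add: centralizer_def flip: nat_pow_Suc nat_pow_Suc2)
    moreover have "x \<in> centralizer G ?v" using centralizer_sym[OF x(1) vC] .
    moreover have "generate G {x} = centralizer G ?v"
    proof (rule card_subset_eq)
      show "generate G {x} \<subseteq> centralizer G ?v"
        using generate_subgroup_incl[OF _ subgroup_centralizer[OF vG]] calculation by simp
      show "card (generate G {x}) = card (centralizer G ?v)" using card_generate_singleton x c by simp
    qed (use vG in simp)
    ultimately have "y \<in> generate G {x}" by simp
    then obtain k where "y = x [^] (k::nat)" using generate_singleton_elem[OF x(1)] by metis
    then have "y \<otimes> x = x \<otimes> y" using nat_pow_Suc2[OF x(1), of k] nat_pow_Suc[of x k] by simp
    then have "x = x [^] (2::nat)" using y commutes_iff_conj[OF y(1) x(1)] by simp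
    then have "x [^] (1::nat) = x [^] (2::nat)" using x(1) by simp
    then show False using pow_eq_pow_iff[OF x(1), of 1 2] x(2) by (simp add: cong_def)
  qed
  have "y [^] (2::nat) \<noteq> \<one>"
  proof
    assume "y [^] (2::nat) = \<one>"
    then have "x [^] (1::nat) = x [^] (4::nat)" using conj x(1) by simp
    then show False using pow_eq_pow_iff[OF x(1), of 1 4] x(2) by (simp add: cong_def)
  qed
  then have "\<not> ord y dvd 2" "ord y dvd 4" using y4 pow_eq_id[OF y(1)] by simp_all
  then have "ord y = 4" using dvd_4_cases[of "ord y"] by auto
  let ?H = "generate G {x, y}"
  have H: "subgroup ?H G" using x y by (intro generate_is_subgroup) simp
  have "4 dvd card ?H" "5 dvd card ?H"
    using ord_dvd_card_subgroup[OF H, of y] ord_dvd_card_subgroup[OF H, of x] \<open>ord y = 4\<close> x(2)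
    by (simp_all add: generate.incl)
  then have "20 dvd card ?H" by presburger
  then have "card ?H \<ge> card (carrier G)"
    using G card_subgroup_pos[OF H] by (auto simp: order_def dest: dvd_imp_le)
  then have "?H = carrier G" by (rule card_seteq[OF finite_carrier subgroup.subset[OF H]])
  then show ?thesis
    using x y y4 pow_ord_eq_1[OF x(1)]
    by (intro presented_by_two_gensI) (auto simp: satisfies_metacyclic)
qed

text \<open>In the class equation \<open>59 = 20 m\<^sub>3 + 15 m\<^sub>4 + 12 m\<^sub>5\<close> all three numbers of classes are
  positive, so \<open>m\<^sub>4 = 1\<close> and all involutions are conjugate. Each involution of a Sylow 2-subgroup
  \<open>Q\<close> has \<open>Q\<close> as its centralizer; hence an element that conjugates one involution of \<open>Q\<close> to
  another normalizes \<open>Q\<close>. The normalizer of \<open>Q\<close> thus has order \<open>3 \<cdot> 4 = 12\<close>, and the action of \<open>G\<close>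
  on its five cosets is faithful, as non-trivial conjugacy classes have at least 12 elements.\<close>

lemma order_60_iso_alt_group_5:
  assumes G: "order G = 60" shows "G \<cong> alt_group 5"
proof -
  have G4: "4 dvd order G" using G by simp
  have sum: "60 = 1 + (card (centralizer_level G 3) + (card (centralizer_level G 4) + card (centralizer_level G 5)))"
    using levels[of "{3, 4, 5}"] centralizers_345[OF G4] G by simp
  obtain m3 where m3: "3 * card (centralizer_level G 3) = m3 * 60"
      "m3 = 0 \<longleftrightarrow> centralizer_level G 3 = {}"
    using card_centralizer_level[of 3] G by metis
  obtain m4 where m4: "4 * card (centralizer_level G 4) = m4 * 60"
      "m4 = 0 \<longleftrightarrow> centralizer_level G 4 = {}"
      "\<And>x. m4 = 1 \<Longrightarrow> x \<in> centralizer_level G 4 \<Longrightarrow> centralizer_level G 4 = conj_class G x"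
    using card_centralizer_level[of 4] G by metis
  obtain m5 where m5: "5 * card (centralizer_level G 5) = m5 * 60"
      "m5 = 0 \<longleftrightarrow> centralizer_level G 5 = {}"
    using card_centralizer_level[of 5] G by metis
  obtain x3 where x3: "x3 \<in> carrier G" "ord x3 = 3" using exists_ord[of 3] G by auto
  obtain x5 where x5: "x5 \<in> carrier G" "ord x5 = 5" using exists_ord[of 5] G by auto
  obtain Q where Q: "subgroup Q G" "card Q = 4" using exists_p_subgroup[of 2 2] G by auto
  have QG: "q \<in> carrier G" if "q \<in> Q" for q using that Q subgroup.mem_carrier by metis
  have cQ: "card (centralizer G s) = 4" "centralizer G s = Q" if s: "s \<in> Q" "s \<noteq> \<one>" for s
  proof -
    have sub: "Q \<subseteq> centralizer G s" using subgroup_order_4_abelian Q s by blast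
    then have "4 dvd card (centralizer G s)"
      using card_dvd_subgroups[OF Q(1) subgroup_centralizer[OF QG[OF s(1)]]] Q(2) by simp
    then show c: "card (centralizer G s) = 4" using centralizers_345[OF G4 QG[OF s(1)] s(2)] by auto
    show "centralizer G s = Q"
      using card_subset_eq[of "centralizer G s" Q] sub c Q(2) QG[OF s(1)] by simp
  qed
  have finQ: "finite Q" using finite_subgroup Q by blast
  obtain s where s: "s \<in> Q" "s \<noteq> \<one>"
  proof -
    have "Q \<noteq> {\<one>}" using Q(2) by auto
    then show ?thesis using that subgroup.one_closed[OF Q(1)] by blast
  qed
  have sG: "s \<in> carrier G" using QG s by blast
  have "m3 \<noteq> 0" using m3(2) level_nonempty[OF x3(1) centralizer_3[OF G4 x3]] by blast
  moreover have "m4 \<noteq> 0" using m4(2) level_nonempty[OF sG cQ(1)[OF s]] by blast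
  moreover have "m5 \<noteq> 0" using m5(2) level_nonempty[OF x5(1) centralizer_5[OF x5]] by blast
  moreover have "59 = 20 * m3 + 15 * m4 + 12 * m5" using sum m3(1) m4(1) m5(1) by linarith
  ultimately have "m4 = 1" by arith
  have level4: "t \<in> centralizer_level G 4" if "t \<in> Q" "t \<noteq> \<one>" for t
    using cQ(1)[OF that] QG[OF that(1)] by (simp add: centralizer_level_def)
  \<comment> \<open>The normalizer of \<open>Q\<close>; it permutes the three involutions of \<open>Q\<close> transitively.\<close>
  define N where "N = {g \<in> carrier G. \<forall>q \<in> Q. g \<otimes> q \<otimes> inv g \<in> Q}"
  have N: "subgroup N G"
  proof -
    have onto: "(\<lambda>q. g \<otimes> q \<otimes> inv g) ` Q = Q" if "g \<in> N" for g
    proof (rule card_subset_eq[OF finQ])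
      show "(\<lambda>q. g \<otimes> q \<otimes> inv g) ` Q \<subseteq> Q" using that by (auto simp: N_def)
      have "inj_on (\<lambda>q. g \<otimes> q \<otimes> inv g) Q"
        using that QG conj_eq_iff by (auto simp: inj_on_def N_def)
      then show "card ((\<lambda>q. g \<otimes> q \<otimes> inv g) ` Q) = card Q" by (rule card_image)
    qed
    show ?thesis
    proof (rule subgroupI)
      fix g assume g: "g \<in> N"
      then have gG: "g \<in> carrier G" by (simp add: N_def)
      have "inv g \<otimes> q \<otimes> inv (inv g) \<in> Q" if "q \<in> Q" for q
      proof -
        obtain q' where "q' \<in> Q" "q = g \<otimes> q' \<otimes> inv g" using onto[OF g] \<open>q \<in> Q\<close> by blast
        then show ?thesis using gG QG by (simp add: m_assoc)
      qed
      then show "inv g \<in> N" using gG by (simp add: N_def)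
    next
      fix g h assume "g \<in> N" "h \<in> N"
      then have gh: "g \<in> carrier G" "h \<in> carrier G"
        "\<And>q. q \<in> Q \<Longrightarrow> g \<otimes> q \<otimes> inv g \<in> Q" "\<And>q. q \<in> Q \<Longrightarrow> h \<otimes> q \<otimes> inv h \<in> Q"
        by (auto simp: N_def)
      have "g \<otimes> h \<otimes> q \<otimes> inv (g \<otimes> h) \<in> Q" if "q \<in> Q" for q
        using gh(3)[OF gh(4)[OF that]] gh(1,2) QG[OF that] by (simp add: m_assoc inv_mult_group)
      then show "g \<otimes> h \<in> N" using gh by (simp add: N_def)
    qed (use QG in \<open>auto simp: N_def\<close>)
  qed
  have QN: "Q \<subseteq> N"
  proof
    fix g assume g: "g \<in> Q"
    have "g \<otimes> q \<otimes> inv g \<in> Q" if "q \<in> Q" for q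
      using g that subgroup.m_closed[OF Q(1)] subgroup.m_inv_closed[OF Q(1)] by blast
    then show "g \<in> N" using QG[OF g] by (simp add: N_def)
  qed
  interpret N: finite_group "G\<lparr>carrier := N\<rparr>"
    using N finite_subgroup by (simp add: finite_group_def finite_group_axioms_def subgroup_imp_group)
  have "conj_class (G\<lparr>carrier := N\<rparr>) s = Q - {\<one>}"
  proof (intro equalityI subsetI)
    fix t assume "t \<in> conj_class (G\<lparr>carrier := N\<rparr>) s"
    then obtain g where g: "g \<in> N" "t = g \<otimes> s \<otimes> inv g"
      using N by (auto simp: conj_class_def m_inv_consistent)
    then have "g \<in> carrier G" by (simp add: N_def)
    then have "t \<noteq> \<one>" using conj_eq_iff[OF _ sG one_closed, of g] g(2) s(2) by simp
    then show "t \<in> Q - {\<one>}" using g s by (simp add: N_def)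
  next
    fix t assume t: "t \<in> Q - {\<one>}"
    have "t \<in> conj_class G s" using m4(3)[OF \<open>m4 = 1\<close> level4[OF s]] level4[of t] t by simp
    then obtain g where g: "g \<in> carrier G" "t = g \<otimes> s \<otimes> inv g" by (auto simp: conj_class_def)
    have "g \<otimes> q \<otimes> inv g \<in> Q" if q: "q \<in> Q" for q
    proof -
      have "q \<in> centralizer G s" using q cQ(2)[OF s] by simp
      then have "s \<otimes> q = q \<otimes> s" by (simp add: centralizer_def)
      then have "g \<otimes> (s \<otimes> q) \<otimes> inv g = g \<otimes> (q \<otimes> s) \<otimes> inv g" by simp
      then have "t \<otimes> (g \<otimes> q \<otimes> inv g) = (g \<otimes> q \<otimes> inv g) \<otimes> t"
        using conj_mult g sG QG[OF q] by simp
      then have "g \<otimes> q \<otimes> inv g \<in> centralizer G t" using g QG[OF q] by (simp add: centralizer_def)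
      then show ?thesis using cQ(2)[of t] t by simp
    qed
    then have "g \<in> N" using g by (simp add: N_def)
    then show "t \<in> conj_class (G\<lparr>carrier := N\<rparr>) s"
      using g N by (auto simp: conj_class_def m_inv_consistent)
  qed
  moreover have "centralizer (G\<lparr>carrier := N\<rparr>) s = Q"
    using cQ(2)[OF s] QN subgroup.subset[OF N] unfolding centralizer_def by auto
  moreover have "card (Q - {\<one>}) = 3" using Q subgroup.one_closed[OF Q(1)] finQ by simp
  ultimately have cardN: "card N = 12"
    using N.card_conj_class[of s] s QN Q(2) by (simp add: order_def subset_iff)
  show ?thesis
  proof (rule coset_action_iso_alt_group[OF finite_group_axioms N])
    fix h assume h: "h \<in> N" "h \<noteq> \<one>"
    then have hG: "h \<in> carrier G" by (simp add: N_def)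
    have "card (centralizer G h) \<le> 5" using centralizers_345[OF G4 hG h(2)] by auto
    then have "60 \<le> card (conj_class G h) * 5"
      using card_conj_class[OF hG] G by (metis mult_le_mono2)
    then show "card N \<le> card (conj_class G h)" using cardN by simp
  qed (use G cardN in \<open>simp_all add: fact_numeral\<close>)
qed

theorem classification:
  "order G = 6 \<and> presented_by G (metacyclic_relations 3 2 2 0) \<or>
   order G = 10 \<and> presented_by G (metacyclic_relations 5 2 4 0) \<or>
   G \<cong> alt_group 4 \<or> order G = 20 \<and> presented_by G (metacyclic_relations 5 4 2 0) \<or> G \<cong> alt_group 5"
  using order_cases not_order_15 not_order_30 order_12_iso_alt_group_4 order_20_presented
    order_60_iso_alt_group_5 order_2p_nonabelian[of 3] order_2p_nonabelian[of 5] not_comm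
  by auto

end

section \<open>Non-abelian groups of order eight\<close>

lemma dvd_8_cases: 
  assumes "(d::nat) dvd 8" shows "d \<in> {1, 2, 4, 8}"
proof -
  have "d \<le> 8" using assms by (rule dvd_imp_le) simp
  then have "d = 0 \<or> d = 1 \<or> d = 2 \<or> d = 3 \<or> d = 4 \<or> d = 5 \<or> d = 6 \<or> d = 7 \<or> d = 8" by arith
  then show ?thesis using assms by (elim disjE) simp_all
qed

context finite_group
begin

lemma comm_if_exponent_2:
  assumes "\<And>x. x \<in> carrier G \<Longrightarrow> x \<otimes> x = \<one>"
  shows "comm_group G"
proof (rule group.group_comm_groupI[OF is_group])
  fix x y assume x: "x \<in> carrier G" and y: "y \<in> carrier G"
  have inv: "inv u = u" if "u \<in> carrier G" for u using assms[OF that] that inv_equality by blast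
  have "x \<otimes> y = inv (x \<otimes> y)" using inv[of "x \<otimes> y"] x y by simp
  also have "\<dots> = y \<otimes> x" using inv_mult_group[OF x y] inv[OF x] inv[OF y] by simp
  finally show "x \<otimes> y = y \<otimes> x" .
qed

lemma comm_if_cyclic:
  assumes "x \<in> carrier G" "ord x = order G" shows "comm_group G"
proof -
  have "generate G {x} = carrier G"
  proof (rule card_subset_eq[OF finite_carrier])
    show "generate G {x} \<subseteq> carrier G" using assms by (intro generate_incl) simp
    show "card (generate G {x}) = card (carrier G)"
      using card_generate_singleton assms by (simp add: order_def)
  qed
  then show ?thesis using comm_of_generators[of x x] assms by simp
qed

lemma order_8_exists_ord_4:
  assumes "order G = 8" "\<not> comm_group G"
  obtains x where "x \<in> carrier G" "ord x = 4"
proof -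
  obtain x where x: "x \<in> carrier G" "x \<otimes> x \<noteq> \<one>" using comm_if_exponent_2 assms by blast
  have dvd: "ord x dvd 8" using ord_dvd_group_order[OF x(1)] assms by simp
  moreover have "ord x \<noteq> 8" using comm_if_cyclic x assms by auto
  moreover have "\<not> ord x dvd 2" using pow_eq_id[OF x(1), of 2] x by (simp add: numeral_2_eq_2)
  ultimately have "ord x = 4" using dvd_8_cases[of "ord x"] by auto
  then show thesis using that x by blast
qed

text \<open>An element \<open>x\<close> of order 4 generates a subgroup of index two, and an element \<open>y\<close> outside it
  inverts \<open>x\<close>. So \<open>y\<^sup>2\<close> is a power of \<open>x\<close> that is equal to its own inverse, that is, \<open>\<one>\<close> or \<open>x\<^sup>2\<close>;
  these are the dihedral and the quaternion group.\<close>

lemma order_8_nonabelian: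
  assumes G: "order G = 8" "\<not> comm_group G"
  shows "presented_by G (metacyclic_relations 4 2 3 0) \<or> presented_by G (metacyclic_relations 4 2 3 2)"
proof -
  obtain x where x: "x \<in> carrier G" "ord x = 4" using order_8_exists_ord_4[OF G] .
  let ?A = "generate G {x}"
  have A: "subgroup ?A G" "order G = 2 * card ?A"
    using x G card_generate_singleton by (auto intro: generate_is_subgroup)
  have "?A \<noteq> carrier G" using A(2) order_pos by (auto simp: order_def)
  then obtain y where y: "y \<in> carrier G" "y \<notin> ?A" using subgroup.subset[OF A(1)] by blast
  have gen: "generate G {x, y} = carrier G" using generate_pair_index x y G by simp
  have "y \<otimes> x \<otimes> inv y \<in> ?A"
    using index2_conj[OF A y(1), of x] generate.incl[of x "{x}" G] by simp
  from generate_singleton_elem[OF x(1) this, unfolded x(2)]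
  obtain k :: nat where k: "k < 4" "y \<otimes> x \<otimes> inv y = x [^] k" by blast
  have "k \<noteq> 1"
  proof
    assume "k = 1"
    then have "x \<otimes> y = y \<otimes> x" using k(2) commutes_iff_conj[OF y(1) x(1)] x(1) by simp
    then show False using comm_of_generators[OF gen x(1) y(1)] G(2) by blast
  qed
  moreover have "\<not> 2 dvd k"
  proof
    assume "2 dvd k"
    then have "[k * 2 = 0] (mod 4)" by (auto simp: cong_def elim!: dvdE)
    then have "(y \<otimes> x \<otimes> inv y) [^] (2::nat) = \<one>"
      using pow_eq_pow_iff[OF x(1), of "k * 2" 0] x k(2) by (simp add: nat_pow_pow)
    then have "y \<otimes> x [^] (2::nat) \<otimes> inv y = y \<otimes> \<one> \<otimes> inv y"
      using conj_pow[OF y(1) x(1), of 2] y(1) by simp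
    then have "x [^] (2::nat) = \<one>" using conj_eq_iff[OF y(1), of "x [^] (2::nat)" \<one>] x by simp
    then show False using pow_eq_id[OF x(1)] x(2) by simp
  qed
  ultimately have "k = 3" using k(1) by presburger
  have "y \<otimes> y \<in> ?A" by (rule index2_square[OF A y(1)])
  from generate_singleton_elem[OF x(1) this, unfolded x(2)]
  obtain j :: nat where j: "j < 4" "y \<otimes> y = x [^] j" by blast
  have "x [^] (3 * j) = (y \<otimes> x \<otimes> inv y) [^] j" using k(2) \<open>k = 3\<close> x(1) by (simp add: nat_pow_pow)
  also have "\<dots> = y \<otimes> (y \<otimes> y) \<otimes> inv y" using conj_pow[OF y(1) x(1)] j(2) by simp
  also have "\<dots> = y \<otimes> y" using y(1) by (simp add: m_assoc)
  also have "\<dots> = x [^] j" by (rule j(2))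
  finally have "[3 * j = j] (mod 4)" using pow_eq_pow_iff[OF x(1)] x(2) by simp
  then have "j = 0 \<or> j = 2" using j(1) unfolding cong_def by presburger
  moreover have "x [^] (4::nat) = \<one>" using pow_ord_eq_1[OF x(1)] x(2) by simp
  ultimately have "satisfies G (case_two_gens x y) (metacyclic_relations 4 2 3 0) \<or>
      satisfies G (case_two_gens x y) (metacyclic_relations 4 2 3 2)"
    using x y k(2) \<open>k = 3\<close> j(2) by (auto simp: satisfies_metacyclic numeral_2_eq_2)
  then show ?thesis using presented_by_two_gensI gen by blast
qed

end

section \<open>Groups with a center of order two\<close>

locale center_2_case = finite_group +
  fixes z
  assumes center_eq: "center G = {\<one>, z}" and z_ne: "z \<noteq> \<one>"
    and not_comm: "\<not> comm_group G"
    and small: "\<And>x. \<lbrakk>x \<in> carrier G; x \<notin> center G\<rbrakk> \<Longrightarrow> card (centralizer G x) \<le> 7"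
begin

lemma z_closed [simp]: "z \<in> carrier G"
  using center_subset center_eq by blast

lemma z_comm: "x \<in> carrier G \<Longrightarrow> z \<otimes> x = x \<otimes> z"
  using center_eq unfolding center_def by blast

lemma z_square: "z \<otimes> z = \<one>"
proof -
  have "z \<otimes> z \<in> {\<one>, z}" using subgroup.m_closed[OF subgroup_center, of z z] center_eq by simp
  moreover have "z \<otimes> z \<noteq> z" using z_ne z_closed by simp
  ultimately show ?thesis by blast
qed

lemma zz_cancel [simp]: "x \<in> carrier G \<Longrightarrow> x \<otimes> z \<otimes> z = x" 
  by (simp add: m_assoc z_square)

lemma ord_z: "ord z = 2"
proof -
  have "ord z dvd 2" using pow_eq_id[of z 2] z_square by (simp add: numeral_2_eq_2)
  moreover have "ord z \<noteq> 1" using ord_eq_1 z_ne by simp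
  ultimately show ?thesis using prime_nat_iff two_is_prime_nat by blast
qed

lemma whole: "subgroup (carrier G) G"
  by (rule subgroup_self)

lemma exists_ord: "Factorial_Ring.prime p \<Longrightarrow> p dvd order G \<Longrightarrow> \<exists>x. x \<in> carrier G \<and> ord x = p"
  using exists_ord_prime[OF whole] by (auto simp: order_def)

lemma noncentral_if_ord: "ord x \<noteq> 1 \<Longrightarrow> ord x \<noteq> 2 \<Longrightarrow> x \<notin> center G"
  using center_eq ord_z ord_id by auto

lemma card_centralizer_46:
  assumes "x \<in> carrier G" "x \<notin> center G" shows "card (centralizer G x) \<in> {4, 6}"
proof -
  have "card (center G) = 2" using center_eq z_ne by simp
  then have "2 dvd card (centralizer G x)" "2 < card (centralizer G x)"
    using centralizer_proper[OF assms] by auto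
  moreover have "card (centralizer G x) \<le> 7" using small assms by blast
  ultimately show ?thesis by simp presburger
qed

text \<open>A subgroup of order \<open>p ^ k\<close> lies in the centralizer of one of its non-trivial elements, and
  that element is not central since \<open>p\<close> is odd; so \<open>p ^ k\<close> divides 4 or 6.\<close>

lemma odd_prime_power_dvd:
  assumes "Factorial_Ring.prime p" "odd p" "k > 0" "p ^ k dvd order G"
  shows "p ^ k = 3"
proof -
  obtain P x where P: "subgroup P G" "card P = p ^ k" "x \<in> P" "x \<noteq> \<one>" "p ^ k dvd card (centralizer G x)"
    using exists_p_central[OF assms(1,4,3)] by metis
  have xG: "x \<in> carrier G" using P subgroup.mem_carrier by metis
  have odd: "odd (p ^ k)" using assms(2) by simp
  have "ord x dvd p ^ k" using ord_dvd_card_subgroup[OF P(1,3)] P(2) by simp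
  then have "ord x \<noteq> 2" using odd by auto
  moreover have "ord x \<noteq> 1" using ord_eq_1 xG P(4) by simp
  ultimately have "card (centralizer G x) \<in> {4, 6}" using card_centralizer_46 xG noncentral_if_ord by simp
  then have "p ^ k dvd 12" using P(5) by (auto intro: dvd_trans)
  then have "p ^ k dvd 60" by (rule dvd_trans) simp
  then have "p ^ k \<in> {1, 2, 3, 4, 5, 6, 10, 12, 15, 20, 30, 60}" by (rule dvd_60_cases)
  moreover have "p ^ k \<noteq> 5" "p ^ k \<noteq> 15" using \<open>p ^ k dvd 12\<close> by (intro notI; simp)+
  moreover have "p ^ k > 1" using assms(1,3) by (intro one_less_power prime_gt_1_nat)
  moreover have "q = 3" if "q \<in> {1, 2, 3, 4, 5, 6, 10, 12, 15, 20, 30, 60}" "q \<noteq> 5" "q \<noteq> 15" "q > 1" "odd q" for q :: nat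
    using that by auto
  ultimately show ?thesis using odd by blast
qed

text \<open>In a subgroup of order 16, all elements other than \<open>\<one>\<close> and \<open>z\<close> would have centralizers of
  order 4. So its class equation would be \<open>14 = 4 m\<close>.\<close>

lemma not_16_dvd: "\<not> 16 dvd order G"
proof
  assume "16 dvd order G"
  then obtain P x where P: "subgroup P G" "card P = 16" "x \<in> P" "x \<noteq> \<one>" "P \<subseteq> centralizer G x"
      "16 dvd card (centralizer G x)"
    using exists_p_central[OF two_is_prime_nat, of 4, simplified] by metis
  interpret P: finite_group "G\<lparr>carrier := P\<rparr>"
    using P finite_subgroup by (simp add: finite_group_def finite_group_axioms_def subgroup_imp_group)
  have PG: "q \<in> carrier G" if "q \<in> P" for q using that P subgroup.mem_carrier by metis
  have "x \<in> center G"
  proof (rule ccontr)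
    assume "x \<notin> center G"
    then show False using card_centralizer_46[of x] P PG by auto
  qed
  then have zP: "z \<in> P" using center_eq P by simp
  have cent: "centralizer (G\<lparr>carrier := P\<rparr>) q = P \<inter> centralizer G q" if "q \<in> P" for q
    using PG by (auto simp: centralizer_def)
  have c4: "card (centralizer (G\<lparr>carrier := P\<rparr>) q) = 4" if q: "q \<in> P" "q \<noteq> \<one>" "q \<noteq> z" for q
  proof -
    let ?C = "P \<inter> centralizer G q"
    have fin: "finite (centralizer G q)" using PG q by simp
    have "q \<notin> center G" using q center_eq by simp
    then have "card (centralizer G q) \<le> 6" using card_centralizer_46[of q] PG q by auto
    then have "card ?C \<le> 6" using card_mono[OF fin, of ?C] by simp
    moreover have "card ?C dvd 16"
      using P.card_dvd_order[OF P.subgroup_centralizer[of q]] q cent P(2) by (simp add: order_def)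
    moreover have "{\<one>, z, q} \<subseteq> ?C"
      using PG q zP z_comm subgroup.one_closed[OF P(1)] by (auto simp: centralizer_def)
    then have "3 \<le> card ?C" using card_mono[of ?C "{\<one>, z, q}"] fin q z_ne by auto
    ultimately have "card ?C = 4"
    proof -
      assume a: "card ?C \<le> 6" "card ?C dvd 16" "3 \<le> card ?C"
      then have "card ?C = 3 \<or> card ?C = 4 \<or> card ?C = 5 \<or> card ?C = 6" by arith
      then show ?thesis using a(2) by (elim disjE) simp_all
    qed
    then show ?thesis using cent q by simp
  qed
  have centP: "center (G\<lparr>carrier := P\<rparr>) = {\<one>, z}"
  proof (intro equalityI subsetI)
    fix q assume "q \<in> center (G\<lparr>carrier := P\<rparr>)"
    then have q: "q \<in> P" "centralizer (G\<lparr>carrier := P\<rparr>) q = P" by (auto simp: P.center_eq_centralizers)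
    then show "q \<in> {\<one>, z}" using c4[OF q(1)] P(2) by auto
  next
    fix q assume "q \<in> {\<one>, z}"
    then show "q \<in> center (G\<lparr>carrier := P\<rparr>)"
      using PG zP z_comm subgroup.one_closed[OF P(1)] by (auto simp: center_def)
  qed
  have oP: "order (G\<lparr>carrier := P\<rparr>) = 16" using P(2) by (simp add: order_def)
  have "16 = card {\<one>, z} + card (centralizer_level (G\<lparr>carrier := P\<rparr>) 4)"
    using P.order_eq_center_levels[of "{4}"] c4 centP P(2) by (simp add: order_def)
  moreover obtain m where "4 * card (centralizer_level (G\<lparr>carrier := P\<rparr>) 4) = m * 16"
    using P.card_centralizer_level[of 4, unfolded oP] by metis
  ultimately have "14 = 4 * m" using z_ne by simp
  then show False by presburger
qed

lemma order_cases: "order G \<in> {8, 12, 24}"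
proof -
  have "order G dvd 24"
  proof (rule dvd_if_prime_powers_dvd)
    fix p k :: nat assume p: "Factorial_Ring.prime p" "k > 0" "p ^ k dvd order G"
    show "p ^ k dvd 24"
    proof (cases "odd p")
      case False
      then have "p = 2" using p(1) prime_odd_nat by (metis le_neq_implies_less prime_ge_2_nat)
      have "k < 4"
      proof (rule ccontr)
        assume "\<not> k < 4"
        then have "(2::nat) ^ 4 dvd 2 ^ k" by (intro le_imp_power_dvd) simp
        then show False using not_16_dvd p(3) \<open>p = 2\<close> by (auto dest: dvd_trans)
      qed
      then have "(2::nat) ^ k dvd 2 ^ 3" by (intro le_imp_power_dvd) simp
      then have "(2::nat) ^ k dvd 8" by simp
      moreover have "8 dvd (24::nat)" by simp
      ultimately show ?thesis unfolding \<open>p = 2\<close> by (rule dvd_trans)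
    qed (use odd_prime_power_dvd[OF p(1) _ p(2,3)] in simp)
  qed (use order_pos in auto)
  then obtain e where e: "24 = order G * e" by (elim dvdE)
  obtain x where x: "x \<in> carrier G" "x \<notin> center G" using not_comm_noncentral[OF not_comm] .
  have "card (centralizer G x) = 4 \<or> card (centralizer G x) = 6" using card_centralizer_46[OF x] by simp
  moreover have "card (centralizer G x) dvd order G" "card (centralizer G x) < order G"
    using centralizer_proper[OF x] by simp_all
  ultimately have c: "4 dvd order G \<and> 4 < order G \<or> 6 dvd order G \<and> 6 < order G" by auto
  then have "4 < order G" by auto
  then have "e < 6" using mult_le_mono[of 5 "order G" 6 e] e by (intro notI[THEN not_le_imp_less]) simp
  then have "e = 0 \<or> e = 1 \<or> e = 2 \<or> e = 3 \<or> e = 4 \<or> e = 5" by arith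
  then show ?thesis using e c by (elim disjE; hypsubst; simp; presburger)
qed

text \<open>The centralizer of an element \<open>x\<close> of order 3 has order 6, and an element \<open>y\<close> of a Sylow
  2-subgroup outside this centralizer inverts \<open>x\<close>. If \<open>y\<^sup>2 = \<one>\<close>, then \<open>y\<close> inverts the element
  \<open>x z\<close> of order 6 and the group is \<open>D\<^sub>1\<^sub>2\<close>. Otherwise \<open>y\<close> has order 4 and the group is
  \<open>C\<^sub>3 \<rtimes> C\<^sub>4\<close>.\<close>

lemma order_12_presented:
  assumes G: "order G = 12"
  shows "presented_by G (metacyclic_relations 6 2 5 0) \<or> presented_by G (metacyclic_relations 3 4 2 0)"
proof -
  obtain x where x: "x \<in> carrier G" "ord x = 3" using exists_ord[of 3] G by auto
  let ?A = "centralizer G x"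
  have "3 dvd card ?A"
    using ord_dvd_card_centralizer[OF x(1) self_in_centralizer[OF x(1)]] x by simp
  then have "card ?A = 6" using card_centralizer_46[OF x(1)] noncentral_if_ord[of x] x(2) by auto
  then have A: "subgroup ?A G" "order G = 2 * card ?A" using subgroup_centralizer x G by simp_all
  interpret A: finite_group "G\<lparr>carrier := ?A\<rparr>"
    using A finite_subgroup by (simp add: finite_group_def finite_group_axioms_def subgroup_imp_group)
  obtain P where P: "subgroup P G" "card P = 4" using exists_p_subgroup[of 2 2] G by auto
  have "\<not> P \<subseteq> ?A"
    using card_dvd_subgroups[OF P(1) A(1)] P(2) \<open>card ?A = 6\<close> by auto
  then obtain y where y: "y \<in> P" "y \<notin> ?A" by blast
  have yG: "y \<in> carrier G" using P y subgroup.mem_carrier by metis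
  have y4: "y [^] (4::nat) = \<one>" using ord_dvd_card_subgroup[OF P(1) y(1)] P(2) pow_eq_id[OF yG] by simp
  let ?v = "y \<otimes> x \<otimes> inv y"
  have vG: "?v \<in> carrier G" using x yG by simp
  have X: "subgroup (generate G {x}) G" "card (generate G {x}) = 3"
    using x card_generate_singleton by (auto intro: generate_is_subgroup)
  have XA: "generate G {x} \<subseteq> ?A"
    using self_in_centralizer x by (intro generate_subgroup_incl[OF _ A(1)]) simp
  have vA: "?v \<in> ?A" using index2_conj[OF A yG self_in_centralizer[OF x(1)]] .
  have v3: "?v [^] (3::nat) = \<one>"
    using conj_pow[OF yG x(1), of 3] pow_ord_eq_1[OF x(1)] x(2) yG by simp
  \<comment> \<open>As \<open>?v\<close> has order 3, it is a square in \<open>C(x)\<close>, and all squares of \<open>C(x)\<close> lie in the subgroup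
    of order 3.\<close>
  have vX: "?v \<in> generate G {x}"
  proof -
    have XA': "subgroup (generate G {x}) (G\<lparr>carrier := ?A\<rparr>)" using X A XA by (simp add: subgroup_incl)
    have sq: "u \<otimes> u \<in> generate G {x}" if "u \<in> ?A" for u
      using A.index2_square[OF XA', of u] that X(2) \<open>card ?A = 6\<close> by (simp add: order_def)
    have "?v = (?v \<otimes> ?v) \<otimes> (?v \<otimes> ?v)"
    proof -
      have "(?v \<otimes> ?v) \<otimes> (?v \<otimes> ?v) = ?v [^] (3::nat) \<otimes> ?v"
        using vG by (simp add: numeral_3_eq_3 m_assoc)
      then show ?thesis using v3 vG by simp
    qed
    moreover have "?v \<otimes> ?v \<in> ?A" using subgroup.m_closed[OF A(1) vA vA] .
    ultimately show ?thesis using sq[of "?v \<otimes> ?v"] by simp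
  qed
  obtain k where "k < ord x" "?v = x [^] k" by (rule generate_singleton_elem[OF x(1) vX])
  then have k: "k < 3" "?v = x [^] k" using x(2) by simp_all
  have "k \<noteq> 0"
  proof
    assume "k = 0"
    then have "?v = y \<otimes> \<one> \<otimes> inv y" using k(2) yG by simp
    then have "x = \<one>" using conj_eq_iff[OF yG x(1) one_closed] by simp
    then show False using x(2) ord_id by simp
  qed
  moreover have "k \<noteq> 1"
  proof
    assume "k = 1"
    then have "y \<otimes> x = x \<otimes> y" using k(2) commutes_iff_conj[OF yG x(1)] x(1) by simp
    then show False using y(2) yG by (simp add: centralizer_def)
  qed
  ultimately have v: "?v = x [^] (2::nat)" using k by (cases "k = 2") auto
  have x3: "x [^] (3::nat) = \<one>" using pow_ord_eq_1[OF x(1)] x(2) by simp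
  show ?thesis
  proof (cases "y [^] (2::nat) = \<one>")
    case True
    let ?u = "x \<otimes> z"
    have uG: "?u \<in> carrier G" using x by simp
    have upow: "?u [^] (n::nat) = x [^] n \<otimes> z [^] n" for n
      using pow_mult_distrib[of x z n] z_comm[OF x(1)] x(1) by simp
    have zpow: "z [^] (2::nat) = \<one>" using z_square by (simp add: numeral_2_eq_2)
    have zpow3: "z [^] (3::nat) = z" "z [^] (5::nat) = z" "z [^] (6::nat) = \<one>" 
      using pow_eq_pow_iff[of z 3 1] pow_eq_pow_iff[of z 5 1] pow_eq_pow_iff[of z 6 0] ord_z
      by (simp_all add: cong_def)
    have xpow: "x [^] (5::nat) = x [^] (2::nat)" "x [^] (6::nat) = \<one>"
      using pow_eq_pow_iff[OF x(1), of 5 2] pow_eq_pow_iff[OF x(1), of 6 0] x(2) by (simp_all add: cong_def)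
    have u6: "?u [^] (6::nat) = \<one>" using upow[of 6] zpow3 xpow by simp
    have "?u [^] (2::nat) = x [^] (2::nat)" using upow[of 2] zpow x(1) by simp
    then have u2: "?u [^] (2::nat) \<noteq> \<one>" using pow_eq_id[OF x(1), of 2] x(2) by simp
    have u3: "?u [^] (3::nat) \<noteq> \<one>" using upow[of 3] zpow3 x3 z_ne by simp
    have "ord ?u dvd 6" "\<not> ord ?u dvd 2" "\<not> ord ?u dvd 3"
      using u2 u3 u6 pow_eq_id[OF uG] by simp_all
    then have ordu: "ord ?u = 6" using dvd_6_cases[of "ord ?u"] by auto
    have "?u \<in> ?A" using subgroup.m_closed[OF A(1) self_in_centralizer[OF x(1)]]
        center_subset_centralizer[OF x(1)] center_eq by simp
    then have "generate G {?u} \<subseteq> ?A" by (intro generate_subgroup_incl[OF _ A(1)]) simp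
    then have gen: "generate G {?u, y} = carrier G"
      using generate_pair_index[OF uG yG] y(2) ordu G by auto
    have "y \<otimes> ?u \<otimes> inv y = ?v \<otimes> (y \<otimes> z \<otimes> inv y)" using conj_mult[OF yG x(1) z_closed] .
    also have "y \<otimes> z \<otimes> inv y = z" using commutes_iff_conj[OF yG z_closed] z_comm[OF yG] by simp
    finally have "y \<otimes> ?u \<otimes> inv y = ?u [^] (5::nat)" using upow[of 5] v zpow3 xpow by simp
    then have "presented_by G (metacyclic_relations 6 2 5 0)"
      using gen uG yG u6 True by (intro presented_by_two_gensI) (simp_all add: satisfies_metacyclic)
    then show ?thesis by blast
  next
    case False
    have "ord y dvd 4" "\<not> ord y dvd 2" using False y4 pow_eq_id[OF yG] by simp_all
    then have "ord y = 4" using dvd_4_cases[of "ord y"] by auto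
    let ?H = "generate G {x, y}"
    have H: "subgroup ?H G" using x yG by (intro generate_is_subgroup) simp
    have "4 dvd card ?H" "3 dvd card ?H"
      using ord_dvd_card_subgroup[OF H, of y] ord_dvd_card_subgroup[OF H, of x] \<open>ord y = 4\<close> x(2)
      by (simp_all add: generate.incl)
    then have "12 dvd card ?H" by presburger
    then have "card ?H \<ge> card (carrier G)"
      using G card_subgroup_pos[OF H] by (auto simp: order_def dest: dvd_imp_le)
    then have "?H = carrier G" by (rule card_seteq[OF finite_carrier subgroup.subset[OF H]])
    then have "presented_by G (metacyclic_relations 3 4 2 0)"
      using x yG y4 x3 v by (intro presented_by_two_gensI) (simp_all add: satisfies_metacyclic)
    then show ?thesis by blast
  qed
qed

end

context center_2_case
begin

lemma z_conj: "g \<in> carrier G \<Longrightarrow> g \<otimes> z \<otimes> inv g = z"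
  using commutes_iff_conj[of g z] z_comm[of g] by simp

text \<open>For a non-central involution \<open>g\<close> this subgroup is contained in \<open>C(g)\<close>, so \<open>|C(g)|\<close> is
  divisible by 4.\<close>

lemma card_generate_involution_z:
  assumes g: "g \<in> carrier G" "ord g = 2" "g \<noteq> z"
  shows "card (generate G {g, z}) = 4"
proof -
  have gne: "g \<noteq> \<one>" using g ord_id by auto
  have sub: "subgroup (generate G {g, z}) G" using g by (intro generate_is_subgroup) simp
  have "z \<otimes> g \<otimes> inv z = g" using commutes_iff_conj[OF z_closed g(1)] z_comm[OF g(1)] by simp
  then have le: "finite (generate G {g, z}) \<and> card (generate G {g, z}) \<le> 2 * 2"
    using g pow_ord_eq_1[OF g(1)] z_square
    by (intro generate_metacyclic_card_le) (simp_all add: generate.incl generate.one numeral_2_eq_2)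
  have "{\<one>, g, z, g \<otimes> z} \<subseteq> generate G {g, z}"
    by (auto intro: generate.one generate.incl generate.eng)
  moreover have "card {\<one>, g, z, g \<otimes> z} = 4"
  proof -
    have "g \<otimes> z \<noteq> \<one>"
    proof
      assume "g \<otimes> z = \<one>"
      then have "g \<otimes> z \<otimes> z = z" by simp
      then show False using g zz_cancel by simp
    qed
    then show ?thesis using gne z_ne g by auto
  qed
  ultimately have "4 \<le> card (generate G {g, z})" using le card_mono by metis
  then show ?thesis using le by simp
qed

text \<open>The class equation is \<open>22 = 6 m\<^sub>4 + 4 m\<^sub>6\<close>. If \<open>w\<close> has order 3, then \<open>w\<close> and \<open>w z\<close> both have
  centralizers of order 6, and they are not conjugate as their cubes differ. So \<open>m\<^sub>6 > 1\<close>, which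
  leaves \<open>m\<^sub>4 = 1\<close> and \<open>m\<^sub>6 = 4\<close>. The elements with a centralizer of order 4 therefore form a
  single class \<open>L\<close> of size 6, and the Sylow 2-subgroup is \<open>{\<one>, z} \<union> L\<close>. All elements of \<open>L\<close> square
  to \<open>z\<close>, so this is a quaternion group with \<open>L = {\<plusminus>i, \<plusminus>j, \<plusminus>k}\<close>, and \<open>w\<close> permutes the three pairs
  cyclically. Up to replacing \<open>w\<close> by its inverse, it maps \<open>i\<close> to \<open>j\<close> and \<open>j\<close> to \<open>i j\<close>, as in
  \<open>SL(2,3)\<close>.\<close>

lemma order_24_presented:
  assumes G: "order G = 24" shows "presented_by G SL_2_3_relations"
proof -
  have cz: "card (center G) = 2" using center_eq z_ne by simp
  have sum: "24 = 2 + (card (centralizer_level G 4) + card (centralizer_level G 6))"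
    using order_eq_center_levels[of "{4, 6}"] card_centralizer_46 G cz by simp
  obtain m4 where m4: "4 * card (centralizer_level G 4) = m4 * 24"
    "\<And>x. m4 = 1 \<Longrightarrow> x \<in> centralizer_level G 4 \<Longrightarrow> centralizer_level G 4 = conj_class G x"
    using card_centralizer_level[of 4, unfolded G] by metis
  obtain m6 where m6: "6 * card (centralizer_level G 6) = m6 * 24"
    "m6 = 0 \<longleftrightarrow> centralizer_level G 6 = {}"
    "\<And>x. m6 = 1 \<Longrightarrow> x \<in> centralizer_level G 6 \<Longrightarrow> centralizer_level G 6 = conj_class G x"
    using card_centralizer_level[of 6, unfolded G] by metis
  obtain w where w: "w \<in> carrier G" "ord w = 3" using exists_ord[of 3] G by auto
  have w3: "w [^] (3::nat) = \<one>" using pow_ord_eq_1[OF w(1)] w(2) by simp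
  have wzG: "w \<otimes> z \<in> carrier G" using w by simp
  have z3: "z [^] (3::nat) = z" using pow_eq_pow_iff[of z 3 1] ord_z by (simp add: cong_def)
  have wz3: "(w \<otimes> z) [^] (3::nat) = z"
    using pow_mult_distrib[of w z 3] z_comm[OF w(1)] w w3 z3 by simp
  have L6: "v \<in> centralizer_level G 6" if v: "v \<in> carrier G" "v \<notin> center G" "w \<in> centralizer G v" for v
  proof -
    have "3 dvd card (centralizer G v)" using ord_dvd_card_centralizer[OF v(1,3)] w(2) by simp
    then show ?thesis using card_centralizer_46[OF v(1,2)] v(1) by (auto simp: centralizer_level_def)
  qed
  have w6: "w \<in> centralizer_level G 6"
    using L6[OF w(1) _ self_in_centralizer[OF w(1)]] noncentral_if_ord[of w] w(2) by simp
  have wz6: "w \<otimes> z \<in> centralizer_level G 6"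
  proof (rule L6[OF wzG])
    show "w \<otimes> z \<notin> center G"
    proof
      assume "w \<otimes> z \<in> center G"
      then have "w \<otimes> z \<otimes> z \<in> center G" using subgroup.m_closed[OF subgroup_center] center_eq by blast
      then show False using noncentral_if_ord[of w] w by simp
    qed
    have "w \<otimes> z \<in> centralizer G w"
      using subgroup.m_closed[OF subgroup_centralizer[OF w(1)] self_in_centralizer[OF w(1)]]
        center_subset_centralizer[OF w(1)] center_eq by simp
    then show "w \<in> centralizer G (w \<otimes> z)" using centralizer_sym[OF w(1)] by blast
  qed
  have "m6 \<noteq> 1"
  proof
    assume "m6 = 1"
    then have "w \<otimes> z \<in> conj_class G w" using m6(3)[OF _ w6] wz6 by simp
    then obtain g where g: "g \<in> carrier G" "w \<otimes> z = g \<otimes> w \<otimes> inv g" by (auto simp: conj_class_def)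
    have "(w \<otimes> z) [^] (3::nat) = \<one>" using conj_pow[OF g(1) w(1), of 3] w3 g by simp
    then show False using wz3 z_ne by simp
  qed
  moreover have "m6 \<noteq> 0" using m6(2) w6 by blast
  moreover have "22 = 6 * m4 + 4 * m6" using sum m4(1) m6(1) by linarith
  ultimately have "m4 = 1" by presburger
  define L where "L = centralizer_level G 4"
  have cardL: "card L = 6" using m4(1) \<open>m4 = 1\<close> by (simp add: L_def)
  then have finL: "finite L" by (intro card_ge_0_finite) simp
  have LG: "t \<in> carrier G" if "t \<in> L" for t using that by (simp add: L_def centralizer_level_def)
  have Lc: "t \<notin> center G" if "t \<in> L" for t
    using that cz by (auto simp: L_def centralizer_level_def center_eq_centralizers order_def G[unfolded order_def])
  have L_conj: "g \<otimes> t \<otimes> inv g \<in> L" if "t \<in> L" "g \<in> carrier G" for t g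
    using card_centralizer_conj_class[OF LG[OF that(1)] conj_classI[OF that(2)]] that LG[OF that(1)]
    by (simp add: L_def centralizer_level_def)
  obtain P where P: "subgroup P G" "card P = 8" using exists_p_subgroup[of 2 3] G by auto
  have PG: "q \<in> carrier G" if "q \<in> P" for q using that P subgroup.mem_carrier by metis
  \<comment> \<open>An element of \<open>P\<close> outside \<open>{\<one>, z} \<union> L\<close> has a centralizer of order 6. So it is an involution
    and centralizes a Klein four-group, whose order does not divide 6.\<close>
  have "P \<subseteq> {\<one>, z} \<union> L"
  proof
    fix g assume g: "g \<in> P"
    show "g \<in> {\<one>, z} \<union> L"
    proof (rule ccontr)
      assume "g \<notin> {\<one>, z} \<union> L"
      then have n: "g \<notin> center G" "g \<notin> L" using center_eq by auto
      then have c6: "card (centralizer G g) = 6"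
        using card_centralizer_46[OF PG[OF g]] PG[OF g] by (auto simp: L_def centralizer_level_def)
      have "ord g dvd 8" using ord_dvd_card_subgroup[OF P(1) g] P(2) by simp
      moreover have "ord g dvd 6"
        using ord_dvd_card_centralizer[OF PG[OF g] self_in_centralizer[OF PG[OF g]]] c6 by simp
      moreover have "ord g \<noteq> 1" using ord_eq_1[OF PG[OF g]] n center_eq by simp
      ultimately have "ord g = 2" using dvd_6_cases[of "ord g"] by auto
      then have "card (generate G {g, z}) = 4"
        using card_generate_involution_z[OF PG[OF g]] n center_eq by simp
      moreover have "generate G {g, z} \<subseteq> centralizer G g"
        using self_in_centralizer[OF PG[OF g]] center_subset_centralizer[OF PG[OF g]] center_eq
        by (intro generate_subgroup_incl[OF _ subgroup_centralizer[OF PG[OF g]]]) simp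
      then have "card (generate G {g, z}) dvd card (centralizer G g)"
        using PG[OF g] by (intro card_dvd_subgroups subgroup_centralizer generate_is_subgroup) auto
      ultimately show False using c6 by simp
    qed
  qed
  moreover have "card ({\<one>, z} \<union> L) = 8"
  proof -
    have "{\<one>, z} \<inter> L = {}" using Lc center_eq by blast
    then show ?thesis using card_Un_disjoint[of "{\<one>, z}" L] finL cardL z_ne by simp
  qed
  ultimately have P_eq: "P = {\<one>, z} \<union> L" using P(2) finL by (intro card_subset_eq) simp_all
  interpret P: finite_group "G\<lparr>carrier := P\<rparr>"
    using P finite_subgroup by (simp add: finite_group_def finite_group_axioms_def subgroup_imp_group)
  \<comment> \<open>\<open>P\<close> is not abelian, so some \<open>q \<in> L\<close> has a non-trivial square. That square is not in \<open>L\<close>,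
    since it would be conjugate to \<open>q\<close> but of smaller order; so it is \<open>z\<close>, and the same holds for
    all conjugates of \<open>q\<close>.\<close>
  obtain t0 where t0: "t0 \<in> L" using cardL by fastforce
  have "\<exists>q \<in> P. q \<otimes> q \<notin> {\<one>}"
  proof (rule ccontr)
    assume "\<not> (\<exists>q \<in> P. q \<otimes> q \<notin> {\<one>})"
    then have "comm_group (G\<lparr>carrier := P\<rparr>)" using P.comm_if_exponent_2 by simp
    then have comm: "p \<otimes> q = q \<otimes> p" if "p \<in> P" "q \<in> P" for p q
      using comm_monoid.m_comm[OF comm_group.axioms(1), of "G\<lparr>carrier := P\<rparr>" p q] that by simp
    then have "P \<subseteq> centralizer G t0" using PG t0 P_eq by (auto simp: centralizer_def)
    then have "8 \<le> card (centralizer G t0)"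
      using card_mono[of "centralizer G t0" P] P(2) LG[OF t0] by simp
    then show False using t0 by (simp add: L_def centralizer_level_def)
  qed
  then obtain q where q: "q \<in> P" "q \<otimes> q \<noteq> \<one>" by blast
  have qL: "q \<in> L" using q P_eq z_square by auto
  have Lclass: "L = conj_class G q" using m4(2)[OF \<open>m4 = 1\<close>] qL unfolding L_def by blast
  have qq: "q \<otimes> q = z"
  proof (rule ccontr)
    assume "q \<otimes> q \<noteq> z"
    then have "q \<otimes> q \<in> L" using q subgroup.m_closed[OF P(1) q(1) q(1)] P_eq by auto
    then obtain g where g: "g \<in> carrier G" "q \<otimes> q = g \<otimes> q \<otimes> inv g"
      using Lclass by (auto simp: conj_class_def)
    have "ord q dvd 8" using ord_dvd_card_subgroup[OF P(1) q(1)] P(2) by simp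
    have ordqq: "ord (q \<otimes> q) = ord q"
    proof -
      have "(q \<otimes> q) [^] n = \<one> \<longleftrightarrow> q [^] n = \<one>" for n :: nat
      proof -
        have "(q \<otimes> q) [^] n = g \<otimes> q [^] n \<otimes> inv g" using conj_pow[OF g(1) LG[OF qL]] g(2) by simp
        moreover have "g \<otimes> \<one> \<otimes> inv g = \<one>" using g by simp
        ultimately show ?thesis using conj_eq_iff[OF g(1), of "q [^] n" \<one>] LG[OF qL] by simp
      qed
      then show ?thesis using ord_unique[of "q \<otimes> q" "ord q"] pow_eq_id[OF LG[OF qL]] LG[OF qL] by simp
    qed
    have "even (ord q)"
    proof -
      have "ord q \<noteq> 1" using ord_eq_1[OF LG[OF qL]] q(2) by auto
      then show ?thesis using dvd_8_cases[OF \<open>ord q dvd 8\<close>] by auto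
    qed
    then have "ord (q \<otimes> q) = ord q div 2"
      using ord_pow[OF LG[OF qL], of 2] LG[OF qL] by (simp add: numeral_2_eq_2)
    then show False using ordqq ord_pos[OF LG[OF qL]] by simp
  qed
  have sq: "t \<otimes> t = z" if t: "t \<in> L" for t
  proof -
    obtain g where g: "g \<in> carrier G" "t = g \<otimes> q \<otimes> inv g" using t Lclass by (auto simp: conj_class_def)
    have "t \<otimes> t = g \<otimes> (q \<otimes> q) \<otimes> inv g" using conj_mult[OF g(1) LG[OF qL] LG[OF qL]] g(2) by simp
    then show ?thesis using qq z_conj[OF g(1)] by simp
  qed
  have invL: "inv t = t \<otimes> z" if t: "t \<in> L" for t
  proof (rule inv_equality)
    have "t \<otimes> z \<otimes> t = (t \<otimes> t) \<otimes> z" using LG[OF t] z_comm[OF LG[OF t]] by (simp add: m_assoc)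
    then show "t \<otimes> z \<otimes> t = \<one>" using sq[OF t] z_square by simp
  qed (use LG[OF t] in simp_all)
  have ne_z: "t \<noteq> \<one>" "t \<noteq> z" if "t \<in> L" for t using that Lc center_eq by auto
  have mulP: "s \<otimes> t \<in> L" if st: "s \<in> L" "t \<in> L" "t \<noteq> s" "t \<noteq> s \<otimes> z" for s t
  proof -
    have "s \<otimes> t \<in> P" using subgroup.m_closed[OF P(1)] st P_eq by blast
    moreover have "s \<otimes> t \<noteq> \<one>"
    proof
      assume "s \<otimes> t = \<one>"
      then have "t = inv s" using inv_equality[of t s] inv_unique'[of s t] LG st inv_comm[of s t] by simp
      then show False using invL[OF st(1)] st(4) by simp
    qed
    moreover have "s \<otimes> t \<noteq> z"
    proof
      assume "s \<otimes> t = z"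
      then have "s \<otimes> t = s \<otimes> s" using sq[OF st(1)] by simp
      then show False using LG st by simp
    qed
    ultimately show ?thesis using P_eq by blast
  qed
  \<comment> \<open>Invert both sides of \<open>s\<^sup>-\<^sup>1 t\<^sup>-\<^sup>1 = s t\<close>.\<close>
  have anti: "t \<otimes> s = s \<otimes> t \<otimes> z" if st: "s \<in> L" "t \<in> L" "t \<noteq> s" "t \<noteq> s \<otimes> z" for s t
  proof -
    have G: "s \<in> carrier G" "t \<in> carrier G" using LG st by simp_all
    have "t \<otimes> s = inv (inv s \<otimes> inv t)" using G by (simp add: inv_mult_group)
    also have "inv s \<otimes> inv t = s \<otimes> (z \<otimes> t) \<otimes> z" using invL st G by (simp add: m_assoc)
    also have "\<dots> = s \<otimes> t" unfolding z_comm[OF G(2)] using G zz_cancel by (simp flip: m_assoc)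
    also have "inv (s \<otimes> t) = s \<otimes> t \<otimes> z" by (rule invL[OF mulP[OF st]])
    finally show ?thesis .
  qed
  have tz: "t \<otimes> z \<in> L" if "t \<in> L" for t
  proof -
    have "t \<otimes> z \<in> P" using subgroup.m_closed[OF P(1)] that P_eq by blast
    moreover have "t \<otimes> z \<noteq> \<one>"
      using invL[OF that] ne_z(1)[OF that] LG[OF that] inv_eq_1_iff by metis
    moreover have "t \<otimes> z \<noteq> z" using ne_z(1)[OF that] LG[OF that] by simp
    ultimately show ?thesis using P_eq by blast
  qed
  have L_eq: "L = {s, s \<otimes> z, t, t \<otimes> z, s \<otimes> t, s \<otimes> t \<otimes> z}"
    if st: "s \<in> L" "t \<in> L" "t \<noteq> s" "t \<noteq> s \<otimes> z" for s t
  proof -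
    have G: "s \<in> carrier G" "t \<in> carrier G" using LG st by simp_all
    have tzs: "t \<otimes> z \<noteq> s"
    proof
      assume "t \<otimes> z = s"
      then have "t \<otimes> z \<otimes> z = s \<otimes> z" by simp
      then show False using st(4) G by simp
    qed
    have r: "a \<otimes> z = b \<otimes> z \<longleftrightarrow> a = b" if "a \<in> carrier G" "b \<in> carrier G" for a b using that by simp
    have neq: "a \<noteq> a \<otimes> z" if "a \<in> carrier G" for a
      using z_ne that r_cancel_one'[of a z] by simp
    have st1: "s \<otimes> t \<noteq> s" "s \<otimes> t \<noteq> t" using ne_z st G by simp_all
    have st2: "s \<otimes> t \<noteq> s \<otimes> z" using ne_z st G by simp
    have st3: "s \<otimes> t \<noteq> t \<otimes> z"
    proof
      assume "s \<otimes> t = t \<otimes> z"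
      then have "s \<otimes> t = z \<otimes> t" using z_comm[OF G(2)] by simp
      then show False using ne_z(2)[OF st(1)] G by simp
    qed
    have zl: "a \<otimes> z \<noteq> b" if "a \<noteq> b \<otimes> z" "a \<in> carrier G" "b \<in> carrier G" for a b
      using that zz_cancel by metis
    have "card {s, s \<otimes> z, t, t \<otimes> z, s \<otimes> t, s \<otimes> t \<otimes> z} = 6"
    proof -
      have "s \<otimes> z \<noteq> t" "s \<otimes> z \<noteq> t \<otimes> z" "s \<otimes> z \<noteq> s \<otimes> t" "s \<otimes> z \<noteq> s \<otimes> t \<otimes> z" "s \<noteq> s \<otimes> t \<otimes> z"
        using st(3,4) st1 st2 r G zl by (metis m_closed)+
      moreover have "t \<noteq> t \<otimes> z" "t \<noteq> s \<otimes> t \<otimes> z" "t \<otimes> z \<noteq> s \<otimes> t" "t \<otimes> z \<noteq> s \<otimes> t \<otimes> z" "s \<otimes> t \<noteq> s \<otimes> t \<otimes> z"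
        using st1 st3 neq r G zl by (metis m_closed)+
      ultimately show ?thesis using st(3) tzs st1 neq[OF G(1)] by auto
    qed
    moreover have "{s, s \<otimes> z, t, t \<otimes> z, s \<otimes> t, s \<otimes> t \<otimes> z} \<subseteq> L" using st mulP[OF st] tz by auto
    ultimately show ?thesis using card_subset_eq[OF finL] cardL by metis
  qed
  \<comment> \<open>If \<open>w\<close> preserved a pair \<open>{t, t z}\<close>, it would centralize \<open>t\<close>, as its order is odd, and 3 would
    divide \<open>|C(t)| = 4\<close>.\<close>
  have wt: "w \<otimes> t \<otimes> inv w \<noteq> t" "w \<otimes> t \<otimes> inv w \<noteq> t \<otimes> z" if t: "t \<in> L" for t
  proof -
    show 1: "w \<otimes> t \<otimes> inv w \<noteq> t"
    proof
      assume "w \<otimes> t \<otimes> inv w = t"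
      then have "w \<otimes> t = t \<otimes> w" using commutes_iff_conj[OF w(1) LG[OF t]] by simp
      then have "w \<in> centralizer G t" using w by (simp add: centralizer_def)
      then have "3 dvd card (centralizer G t)" using ord_dvd_card_centralizer[OF LG[OF t]] w(2) by metis
      then show False using t by (simp add: L_def centralizer_level_def)
    qed
    show "w \<otimes> t \<otimes> inv w \<noteq> t \<otimes> z"
    proof
      assume a: "w \<otimes> t \<otimes> inv w = t \<otimes> z"
      have b: "w \<otimes> (t \<otimes> z) \<otimes> inv w = t"
        using conj_mult[OF w(1) LG[OF t] z_closed] a z_conj[OF w(1)] LG[OF t] by simp
      have "w [^] (3::nat) \<otimes> t \<otimes> inv (w [^] (3::nat)) =
          w \<otimes> (w \<otimes> (w \<otimes> t \<otimes> inv w) \<otimes> inv w) \<otimes> inv w"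
        using w(1) LG[OF t] by (simp add: numeral_3_eq_3 inv_mult_group m_assoc)
      then have "t = w \<otimes> t \<otimes> inv w" using a b w3 LG[OF t] by simp
      then show False using 1 by simp
    qed
  qed
  have w_cube: "w \<otimes> (w \<otimes> (w \<otimes> t \<otimes> inv w) \<otimes> inv w) \<otimes> inv w = t" if t: "t \<in> carrier G" for t
  proof -
    have "w \<otimes> (w \<otimes> (w \<otimes> t \<otimes> inv w) \<otimes> inv w) \<otimes> inv w = w [^] (3::nat) \<otimes> t \<otimes> inv (w [^] (3::nat))"
      using w(1) t by (simp add: numeral_3_eq_3 inv_mult_group m_assoc)
    then show ?thesis using w3 t by simp
  qed
  \<comment> \<open>The conclusion for any cyclic permutation that matches the relations; it will be applied to
    \<open>w\<close> or to its inverse.\<close>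
  have presented: "presented_by G SL_2_3_relations"
    if st: "s \<in> L" "t \<in> L" "t \<noteq> s" "t \<noteq> s \<otimes> z" and c: "c \<in> carrier G" "c [^] (3::nat) = \<one>" "ord c = 3"
      "c \<otimes> s \<otimes> inv c = t" "c \<otimes> t \<otimes> inv c = s \<otimes> t" for s t c
  proof -
    have G: "s \<in> carrier G" "t \<in> carrier G" using LG st by simp_all
    have s2: "s [^] (2::nat) = z" "t [^] (2::nat) = z" using sq st G by (simp_all add: numeral_2_eq_2)
    have s3: "s [^] (3::nat) = s \<otimes> z" using s2 G z_comm by (simp add: numeral_3_eq_3 numeral_2_eq_2)
    have s4: "s [^] (4::nat) = \<one>"
    proof -
      have "s [^] (4::nat) = (s [^] (2::nat)) [^] (2::nat)" using nat_pow_pow[OF G(1), of 2 2] by simp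
      also have "\<dots> = z \<otimes> z" unfolding s2(1) by (simp add: numeral_2_eq_2)
      finally show ?thesis using z_square by simp
    qed
    have "t \<otimes> s \<otimes> inv t = s \<otimes> z"
    proof -
      have "t \<otimes> s \<otimes> inv t = s \<otimes> t \<otimes> z \<otimes> inv t" using anti[OF st] by simp
      also have "\<dots> = s \<otimes> t \<otimes> (z \<otimes> inv t)" using G by (simp add: m_assoc)
      also have "\<dots> = s \<otimes> t \<otimes> (inv t \<otimes> z)" using z_comm[of "inv t"] G by simp
      also have "\<dots> = s \<otimes> z" using G by (simp add: m_assoc)
      finally show ?thesis .
    qed
    moreover have "generate G {s, t, c} = carrier G"
    proof (rule prime_index_maximal[OF P(1), of _ 3])
      let ?H = "generate G {s, t, c}"
      show H: "subgroup ?H G" using G c by (intro generate_is_subgroup) simp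
      have m: "s \<in> ?H" "t \<in> ?H" "c \<in> ?H" by (auto intro: generate.incl)
      have "z \<in> ?H" using m(1) sq[OF st(1)] subgroup.m_closed[OF H] by metis
      then show "P \<subseteq> ?H"
        unfolding P_eq L_eq[OF st] using m subgroup.m_closed[OF H] subgroup.one_closed[OF H] by simp
      have "c \<notin> P" using ord_dvd_card_subgroup[OF P(1), of c] P(2) c(3) by auto
      then show "?H \<noteq> P" using m by blast
    qed (use G assms P(2) in auto)
    ultimately show ?thesis
      using G c s2 s3 s4 by (intro presented_by_three_gensI) (simp_all add: satisfies_SL_2_3)
  qed
  define i where "i = q"
  define j where "j = w \<otimes> i \<otimes> inv w"
  define k where "k = w \<otimes> j \<otimes> inv w"
  have iL: "i \<in> L" using qL by (simp add: i_def)
  have jL: "j \<in> L" using L_conj[OF iL w(1)] by (simp add: j_def)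
  have kL: "k \<in> L" using L_conj[OF jL w(1)] by (simp add: k_def)
  have wk: "w \<otimes> k \<otimes> inv w = i" using w_cube[OF LG[OF iL]] by (simp add: k_def j_def)
  have ij: "j \<noteq> i" "j \<noteq> i \<otimes> z" using wt[OF iL] by (simp_all add: j_def)
  have kj: "k \<noteq> j" "k \<noteq> j \<otimes> z" using wt[OF jL] by (simp_all add: k_def)
  have ki: "k \<noteq> i" "k \<noteq> i \<otimes> z"
  proof -
    show "k \<noteq> i" using wt(1)[OF kL] wk by simp
    show "k \<noteq> i \<otimes> z"
    proof
      assume "k = i \<otimes> z"
      then have "k \<otimes> z = i" using LG[OF iL] by simp
      then show False using wt(2)[OF kL] wk by simp
    qed
  qed
  have "k = i \<otimes> j \<or> k = i \<otimes> j \<otimes> z" using kL ij kj ki L_eq[OF iL jL ij] by blast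
  then show ?thesis
  proof
    assume "k = i \<otimes> j"
    then show ?thesis
      using presented[OF iL jL ij w(1) w3 w(2)] by (simp add: j_def k_def)
  next
    assume k: "k = i \<otimes> j \<otimes> z"
    have G: "i \<in> carrier G" "j \<in> carrier G" "k \<in> carrier G" using LG iL jL kL by simp_all
    have inv: "inv w \<otimes> (w \<otimes> t \<otimes> inv w) \<otimes> inv (inv w) = t" if "t \<in> carrier G" for t
      using that w(1) by (simp add: m_assoc)
    have 1: "inv w \<otimes> i \<otimes> inv (inv w) = k" using inv[OF G(3)] wk by simp
    have 2: "inv w \<otimes> k \<otimes> inv (inv w) = j" using inv[OF G(2)] by (simp add: k_def)
    have "i \<otimes> k = (i \<otimes> i) \<otimes> (j \<otimes> z)" using G k by (simp add: m_assoc)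
    also have "\<dots> = j \<otimes> z \<otimes> z" using sq[OF iL] z_comm[of "j \<otimes> z"] G by simp
    also have "\<dots> = j" using G by simp
    finally have "inv w \<otimes> k \<otimes> inv (inv w) = i \<otimes> k" using 2 by simp
    moreover have "(inv w) [^] (3::nat) = \<one>" using w3 w(1) by (simp add: nat_pow_inv)
    ultimately show ?thesis using presented[OF iL kL ki _ _ _ 1] w by simp
  qed
qed

theorem classification:
  "order G = 8 \<and> (presented_by G (metacyclic_relations 4 2 3 0) \<or> presented_by G (metacyclic_relations 4 2 3 2)) \<or>
   order G = 12 \<and> (presented_by G (metacyclic_relations 6 2 5 0) \<or> presented_by G (metacyclic_relations 3 4 2 0)) \<or>
   order G = 24 \<and> presented_by G SL_2_3_relations"
  using order_cases order_8_nonabelian not_comm order_12_presented order_24_presented by auto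

end

section \<open>Groups whose center has index two in the centralizers\<close>

definition commutator :: "('a, 'b) monoid_scheme \<Rightarrow> 'a \<Rightarrow> 'a \<Rightarrow> 'a" where
  "commutator G g x = g \<otimes>\<^bsub>G\<^esub> x \<otimes>\<^bsub>G\<^esub> inv\<^bsub>G\<^esub> g \<otimes>\<^bsub>G\<^esub> inv\<^bsub>G\<^esub> x"

context group
begin

lemma center_closed: "z \<in> center G \<Longrightarrow> z \<in> carrier G"
  using center_subset by blast

lemma center_comm: "z \<in> center G \<Longrightarrow> x \<in> carrier G \<Longrightarrow> z \<otimes> x = x \<otimes> z"
  unfolding center_def by blast

lemma conj_eq_commutator:
  "g \<in> carrier G \<Longrightarrow> x \<in> carrier G \<Longrightarrow> g \<otimes> x \<otimes> inv g = commutator G g x \<otimes> x"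
  by (simp add: commutator_def m_assoc)

lemma commutator_unique:
  assumes "g \<in> carrier G" "x \<in> carrier G" "t \<in> carrier G" "g \<otimes> x \<otimes> inv g = t \<otimes> x"
  shows "commutator G g x = t"
  using conj_eq_commutator[OF assms(1,2)] assms by (simp add: commutator_def)

lemma commutator_closed: "g \<in> carrier G \<Longrightarrow> x \<in> carrier G \<Longrightarrow> commutator G g x \<in> carrier G"
  by (simp add: commutator_def)

lemma mult_eq_commutator:
  assumes "g \<in> carrier G" "x \<in> carrier G" shows "g \<otimes> x = commutator G g x \<otimes> x \<otimes> g"
  using assms by (simp add: commutator_def m_assoc)

lemma commutator_eq_one_iff:
  assumes "g \<in> carrier G" "x \<in> carrier G" shows "commutator G g x = \<one> \<longleftrightarrow> g \<otimes> x = x \<otimes> g"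
proof
  assume "commutator G g x = \<one>"
  then show "g \<otimes> x = x \<otimes> g" using mult_eq_commutator[OF assms] assms by simp
next
  assume "g \<otimes> x = x \<otimes> g"
  then have "g \<otimes> x \<otimes> inv g = \<one> \<otimes> x" using commutes_iff_conj[OF assms] assms by simp
  then show "commutator G g x = \<one>" using commutator_unique[OF assms one_closed] by simp
qed

end

context finite_group
begin

text \<open>Both steps of the tower that adjoins first \<open>x\<close> and then \<open>y\<close> to the center at most double the
  order.\<close>

lemma order_le_4_center:
  assumes xy: "x \<in> carrier G" "y \<in> carrier G"
    and gen: "generate G (insert y (insert x (center G))) = carrier G"
    and c: "x \<otimes> x \<in> center G" "y \<otimes> y \<in> center G" "commutator G y x \<in> center G"
  shows "order G \<le> 4 * card (center G)"
proof -
  let ?Z = "center G"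
  have genZ: "generate G ?Z = ?Z"
    using generate_subgroup_incl[OF _ subgroup_center, of ?Z] generate.incl[of _ ?Z G] by blast
  have ZG: "?Z \<subseteq> carrier G" by (rule center_subset)
  have 1: "finite (generate G (insert x ?Z)) \<and> card (generate G (insert x ?Z)) \<le> 2 * card (generate G ?Z)"
  proof (rule generate_insert_card_le[OF ZG xy(1)])
    show "x \<otimes> z \<otimes> inv x \<in> generate G ?Z" if "z \<in> ?Z" for z
      using commutes_iff_conj[OF xy(1) center_closed[OF that]] center_comm[OF that xy(1)] that genZ by simp
    show "x [^] (2::nat) \<in> generate G ?Z"
      using c(1) genZ xy by (simp add: numeral_2_eq_2)
  qed (use genZ in simp_all)
  have "card (generate G (insert y (insert x ?Z))) \<le> 2 * card (generate G (insert x ?Z))"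
  proof (rule conjunct2[OF generate_insert_card_le[OF _ xy(2)]])
    fix b assume "b \<in> insert x ?Z"
    then consider "b = x" | "b \<in> ?Z" by blast
    then show "y \<otimes> b \<otimes> inv y \<in> generate G (insert x ?Z)"
    proof cases
      case 1
      have "commutator G y x \<in> generate G (insert x ?Z)" "x \<in> generate G (insert x ?Z)"
        using c(3) by (auto intro: generate.incl)
      then show ?thesis unfolding 1 conj_eq_commutator[OF xy(2,1)] by (rule generate.eng)
    next
      case 2
      then show ?thesis
        using commutes_iff_conj[OF xy(2) center_closed[OF 2]] center_comm[OF 2 xy(2)] by (simp add: generate.incl)
    qed
  next
    show "y [^] (2::nat) \<in> generate G (insert x ?Z)"
      using c(2) xy by (simp add: numeral_2_eq_2 generate.incl)
  qed (use 1 ZG xy in simp_all)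
  then show ?thesis using 1 genZ gen by (simp add: order_def)
qed

end

locale center_half_case = finite_group +
  assumes not_comm: "\<not> comm_group G"
    and half: "\<And>x. \<lbrakk>x \<in> carrier G; x \<notin> center G\<rbrakk> \<Longrightarrow> card (centralizer G x) = 2 * card (center G)"
begin

lemma center_subgroup_centralizer:
  assumes "x \<in> carrier G"
  shows "subgroup (center G) (G\<lparr>carrier := centralizer G x\<rparr>)"
  using subgroup_incl[OF subgroup_center subgroup_centralizer[OF assms] center_subset_centralizer[OF assms]] .

text \<open>The center has index two in \<open>C(x)\<close>, so it contains the square of every element of \<open>C(x)\<close>, in
  particular of \<open>x\<close>.\<close>

lemma square_central:
  assumes "x \<in> carrier G" shows "x \<otimes> x \<in> center G"
proof (cases "x \<in> center G")
  case True
  then show ?thesis using subgroup.m_closed[OF subgroup_center] by blast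
next
  case False
  interpret C: finite_group "G\<lparr>carrier := centralizer G x\<rparr>"
    using subgroup_centralizer[OF assms] assms
    by (simp add: finite_group_def finite_group_axioms_def subgroup_imp_group)
  show ?thesis
    using C.index2_square[OF center_subgroup_centralizer[OF assms], of x] half[OF assms False]
      self_in_centralizer[OF assms] by (simp add: order_def)
qed

text \<open>The elements of \<open>C(x)\<close> outside the center form a single coset of the center.\<close>

lemma centralizer_quotient:
  assumes "x \<in> carrier G" "x \<notin> center G" "g \<in> centralizer G x" "g \<notin> center G"
  shows "inv g \<otimes> x \<in> center G"
proof -
  interpret C: finite_group "G\<lparr>carrier := centralizer G x\<rparr>"
    using subgroup_centralizer[OF assms(1)] assms(1)
    by (simp add: finite_group_def finite_group_axioms_def subgroup_imp_group)
  have "inv\<^bsub>G\<lparr>carrier := centralizer G x\<rparr>\<^esub> g = inv g"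
    using m_inv_consistent[OF subgroup_centralizer[OF assms(1)] assms(3)] by simp
  then show ?thesis
    using C.index2_coset[OF center_subgroup_centralizer[OF assms(1)], of g x] half[OF assms(1,2)]
      self_in_centralizer[OF assms(1)] assms by (simp add: order_def)
qed

text \<open>The commutator of \<open>g\<close> and \<open>x\<close> is the product \<open>g\<^sup>2 (g\<^sup>-\<^sup>1 x)\<^sup>2 x\<^sup>-\<^sup>2\<close> of squares.\<close>

lemma commutator_central:
  assumes g: "g \<in> carrier G" and x: "x \<in> carrier G" shows "commutator G g x \<in> center G"
proof -
  let ?u = "inv g \<otimes> x"
  have "commutator G g x = (g \<otimes> g) \<otimes> (?u \<otimes> ?u) \<otimes> (inv x \<otimes> inv x)"
    using g x by (simp add: commutator_def m_assoc)
  then show ?thesis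
    using square_central[of g] square_central[of ?u] square_central[of "inv x"] g x
      subgroup.m_closed[OF subgroup_center] by simp
qed

text \<open>Since commutators are central, they can be moved past other elements, and forming
  commutators is bilinear.\<close>

lemma commutator_mult_right:
  assumes G: "g \<in> carrier G" "x \<in> carrier G" "y \<in> carrier G"
  shows "commutator G g (x \<otimes> y) = commutator G g x \<otimes> commutator G g y"
proof (rule commutator_unique)
  let ?a = "commutator G g x" and ?b = "commutator G g y"
  have c: "?a \<in> carrier G" "?b \<in> carrier G" using commutator_closed G by simp_all
  have "g \<otimes> (x \<otimes> y) \<otimes> inv g = (?a \<otimes> x) \<otimes> (?b \<otimes> y)"
    using conj_mult[OF G] conj_eq_commutator G by simp
  also have "\<dots> = ?a \<otimes> (x \<otimes> ?b) \<otimes> y" using G c by (simp add: m_assoc)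
  also have "\<dots> = ?a \<otimes> (?b \<otimes> x) \<otimes> y"
    using center_comm[OF commutator_central[OF G(1,3)] G(2)] by simp
  also have "\<dots> = ?a \<otimes> ?b \<otimes> (x \<otimes> y)" using G c by (simp add: m_assoc)
  finally show "g \<otimes> (x \<otimes> y) \<otimes> inv g = ?a \<otimes> ?b \<otimes> (x \<otimes> y)" .
qed (use G commutator_closed in simp_all)

lemma commutator_mult_left:
  assumes G: "g \<in> carrier G" "h \<in> carrier G" "x \<in> carrier G"
  shows "commutator G (g \<otimes> h) x = commutator G g x \<otimes> commutator G h x"
proof (rule commutator_unique)
  let ?a = "commutator G g x" and ?b = "commutator G h x"
  have c: "?a \<in> carrier G" "?b \<in> carrier G" using commutator_closed G by simp_all
  have "(g \<otimes> h) \<otimes> x \<otimes> inv (g \<otimes> h) = g \<otimes> (h \<otimes> x \<otimes> inv h) \<otimes> inv g"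
    using G by (simp add: m_assoc inv_mult_group)
  also have "\<dots> = g \<otimes> (?b \<otimes> x) \<otimes> inv g" using conj_eq_commutator G by simp
  also have "\<dots> = (g \<otimes> ?b) \<otimes> x \<otimes> inv g" using G c by (simp add: m_assoc)
  also have "\<dots> = (?b \<otimes> g) \<otimes> x \<otimes> inv g"
    using center_comm[OF commutator_central[OF G(2,3)] G(1)] by simp
  also have "\<dots> = ?b \<otimes> (g \<otimes> x \<otimes> inv g)" using G c by (simp add: m_assoc)
  also have "\<dots> = ?b \<otimes> (?a \<otimes> x)" using conj_eq_commutator G by simp
  also have "\<dots> = ?b \<otimes> ?a \<otimes> x" using G c by (simp add: m_assoc)
  also have "?b \<otimes> ?a = ?a \<otimes> ?b" using center_comm[OF commutator_central[OF G(2,3)] c(1)] .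
  finally show "(g \<otimes> h) \<otimes> x \<otimes> inv (g \<otimes> h) = ?a \<otimes> ?b \<otimes> x" .
qed (use G commutator_closed in simp_all)

text \<open>By bilinearity, this is the commutator of the central element \<open>g\<^sup>2\<close> with \<open>x\<close>.\<close>

lemma commutator_square:
  assumes "g \<in> carrier G" "x \<in> carrier G"
  shows "commutator G g x \<otimes> commutator G g x = \<one>"
proof -
  have "commutator G (g \<otimes> g) x = \<one>"
    using commutator_eq_one_iff[of "g \<otimes> g" x] center_comm[OF square_central[OF assms(1)] assms(2)] assms by simp
  then show ?thesis using commutator_mult_left[OF assms(1,1,2)] by simp
qed

lemma commutator_sym:
  assumes "g \<in> carrier G" "x \<in> carrier G"
  shows "commutator G x g = commutator G g x"
proof -
  have "commutator G x g = inv (commutator G g x)"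
    using assms by (simp add: commutator_def inv_mult_group m_assoc)
  also have "\<dots> = commutator G g x"
    using inv_equality[OF commutator_square[OF assms]] commutator_closed[OF assms] by simp
  finally show ?thesis .
qed

text \<open>Commutators lie in the center and have order at most 2. In a center of odd order they would
  all be trivial.\<close>

lemma even_card_center: "even (card (center G))"
proof (rule ccontr)
  assume odd: "odd (card (center G))"
  have "g \<otimes> x = x \<otimes> g" if G: "g \<in> carrier G" "x \<in> carrier G" for g x
  proof -
    let ?t = "commutator G g x"
    have tG: "?t \<in> carrier G" using commutator_closed G by simp
    have "ord ?t dvd 2"
      using pow_eq_id[OF tG, of 2] commutator_square[OF G] tG by (simp add: numeral_2_eq_2)
    have "ord ?t dvd card (center G)"
      using ord_dvd_card_subgroup[OF subgroup_center commutator_central[OF G]] .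
    then have "ord ?t \<noteq> 2" using odd by auto
    then have "ord ?t = 1"
      using \<open>ord ?t dvd 2\<close> two_is_prime_nat prime_nat_iff by blast
    then have "?t = \<one>" using ord_eq_1[OF tG] by simp
    then show ?thesis using commutator_eq_one_iff[OF G] by simp
  qed
  then have "comm_group G" by (intro group.group_comm_groupI[OF is_group]) simp
  then show False using not_comm by blast
qed

lemma noncommuting_pair:
  obtains x y where "x \<in> carrier G" "y \<in> carrier G" "commutator G x y \<noteq> \<one>"
proof -
  obtain x where x: "x \<in> carrier G" "x \<notin> center G" using not_comm_noncentral[OF not_comm] .
  then obtain y where "y \<in> carrier G" "x \<otimes> y \<noteq> y \<otimes> x" by (auto simp: center_def)
  then show thesis using that x commutator_eq_one_iff by blast
qed

end

section \<open>Groups with a center of order four\<close>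

locale center_4_case = center_half_case +
  assumes card_center: "card (center G) = 4"
begin

text \<open>With a non-trivial commutator as \<open>t\<close>, the two cases for \<open>s\<^sup>2\<close> say that the center is a Klein
  four-group or is cyclic and generated by \<open>s\<close>.\<close>

lemma center_cases:
  assumes t: "t \<in> center G" "t \<noteq> \<one>" "t \<otimes> t = \<one>"
  obtains s where "center G = {\<one>, t, s, s \<otimes> t}" "s \<in> center G" "s \<noteq> \<one>" "s \<noteq> t" "s \<otimes> s = \<one> \<or> s \<otimes> s = t"
proof -
  have "\<not> center G \<subseteq> {\<one>, t}" using card_mono[of "{\<one>, t}" "center G"] card_center card_insert_le_m1[of 2 "{t}" \<one>] by auto
  then obtain s where s: "s \<in> center G" "s \<noteq> \<one>" "s \<noteq> t" by blast
  note cl = center_closed[OF s(1)] center_closed[OF t(1)]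
  have m: "\<one> \<in> center G" "s \<otimes> t \<in> center G" "s \<otimes> s \<in> center G"
    using subgroup.m_closed[OF subgroup_center] subgroup.one_closed[OF subgroup_center] s t by auto
  have st1: "s \<otimes> t \<noteq> \<one>"
  proof
    assume "s \<otimes> t = \<one>"
    then have "s \<otimes> t = t \<otimes> t" using t by simp
    then show False using s cl by simp
  qed
  have "s \<otimes> t \<noteq> s" "s \<otimes> t \<noteq> t" using cl s t by simp_all
  then have "card {\<one>, t, s, s \<otimes> t} = 4" using s t st1 by auto
  then have eq: "center G = {\<one>, t, s, s \<otimes> t}"
    using card_subset_eq[of "center G" "{\<one>, t, s, s \<otimes> t}"] m s(1) t(1) card_center by simp
  moreover have "s \<otimes> s \<noteq> s" "s \<otimes> s \<noteq> s \<otimes> t" using cl s by simp_all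
  then have "s \<otimes> s = \<one> \<or> s \<otimes> s = t" using m(3) unfolding eq by blast
  ultimately show thesis using that s by blast
qed

text \<open>An element that commutes with \<open>g\<close> lies in the center or in its coset through \<open>g\<close>.\<close>

lemma mem_coset_if_commutes:
  assumes "r \<in> carrier G" "g \<in> carrier G" "g \<notin> center G" "commutator G r g = \<one>"
    and H: "subgroup H G" "center G \<subseteq> H" "g \<in> H"
  shows "r \<in> H"
proof (cases "r \<in> center G")
  case False
  have "g \<in> centralizer G r"
    using commutator_eq_one_iff[OF assms(1,2)] assms by (simp add: centralizer_def)
  then have "inv g \<otimes> r \<in> H" using centralizer_quotient[OF assms(1) False _ assms(3)] H by blast
  then have "g \<otimes> (inv g \<otimes> r) \<in> H" using H(3) subgroup.m_closed[OF H(1)] by blast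
  then show ?thesis using assms by simp
qed (use H in blast)

text \<open>Let \<open>t\<close> be the commutator of \<open>x\<close> and \<open>y\<close>. The commutators of any \<open>w\<close> with \<open>x\<close> and \<open>y\<close> lie in
  the center \<open>{\<one>, t, s, s t}\<close>. Multiplying \<open>w\<close> by \<open>y\<close> changes the first of them by the factor \<open>t\<close>,
  multiplying it by \<open>x\<close> does so with the second. So one may assume that both lie in \<open>{\<one>, s}\<close>. Then
  one of them is trivial, or both are \<open>s\<close> and the commutator of \<open>w\<close> with \<open>x y\<close> is \<open>s\<^sup>2 = \<one>\<close>. Thus
  \<open>w\<close> commutes with one of the non-central elements \<open>x\<close>, \<open>y\<close>, \<open>x y\<close>, and lies in the coset of the
  center through it.\<close>

lemma generated_by_pair_and_center:
  assumes x: "x \<in> carrier G" and y: "y \<in> carrier G" and t: "commutator G x y \<noteq> \<one>"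
    and H: "subgroup H G" "center G \<subseteq> H" "x \<in> H" "y \<in> H"
  shows "H = carrier G"
proof
  show "H \<subseteq> carrier G" using H subgroup.subset by blast
  show "carrier G \<subseteq> H"
  proof
    fix w assume w: "w \<in> carrier G"
    let ?t = "commutator G x y"
    have yx: "commutator G y x = ?t" using commutator_sym x y by simp
    have tt: "?t \<otimes> ?t = \<one>" by (rule commutator_square[OF x y])
    have tG: "?t \<in> carrier G" using commutator_closed x y by simp
    obtain s where Z: "center G = {\<one>, ?t, s, s \<otimes> ?t}" "s \<in> center G"
      using center_cases[OF commutator_central[OF x y] t tt] by metis
    have sG: "s \<in> carrier G" using Z(2) center_closed by blast
    have stt: "s \<otimes> ?t \<otimes> ?t = s" using sG tG tt by (simp add: m_assoc)
    have nc: "x \<notin> center G" "y \<notin> center G"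
      using t commutator_eq_one_iff[OF x y] center_comm[OF _ y, of x] center_comm[OF _ x, of y] by auto
    have "commutator G (x \<otimes> y) y = ?t"
      using commutator_mult_left[OF x y y] commutator_eq_one_iff[OF y y] tG by simp
    then have xync: "x \<otimes> y \<notin> center G"
      using t commutator_eq_one_iff[of "x \<otimes> y" y] center_comm[of "x \<otimes> y" y] x y by auto
    have xx: "commutator G x x = \<one>" and yy: "commutator G y y = \<one>"
      using commutator_eq_one_iff x y by simp_all
    \<comment> \<open>Adjust \<open>w\<close> so that its commutators with \<open>x\<close> and \<open>y\<close> lie in \<open>{1, s}\<close>.\<close>
    obtain w1 where w1: "w1 \<in> carrier G" "commutator G w1 x \<in> {\<one>, s}" "w1 \<in> H \<Longrightarrow> w \<in> H"
    proof (cases "commutator G w x \<in> {\<one>, s}")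
      case False
      then have "commutator G w x = ?t \<or> commutator G w x = s \<otimes> ?t"
        using commutator_central[OF w x] Z(1) by auto
      then have "commutator G (w \<otimes> y) x \<in> {\<one>, s}"
        using commutator_mult_left[OF w y x] yx tt stt by auto
      moreover have "w \<in> H" if "w \<otimes> y \<in> H"
      proof -
        have "w \<otimes> y \<otimes> inv y \<in> H"
          using that H(4) subgroup.m_closed[OF H(1)] subgroup.m_inv_closed[OF H(1)] by blast
        then show ?thesis using w y by (simp add: m_assoc)
      qed
      ultimately show ?thesis using that[of "w \<otimes> y"] w y by simp
    qed (use that w in blast)
    obtain r where r: "r \<in> carrier G" "commutator G r x \<in> {\<one>, s}" "commutator G r y \<in> {\<one>, s}"
      "r \<in> H \<Longrightarrow> w \<in> H"
    proof (cases "commutator G w1 y \<in> {\<one>, s}")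
      case False
      then have "commutator G w1 y = ?t \<or> commutator G w1 y = s \<otimes> ?t"
        using commutator_central[OF w1(1) y] Z(1) by auto
      then have "commutator G (w1 \<otimes> x) y \<in> {\<one>, s}"
        using commutator_mult_left[OF w1(1) x y] tt stt by auto
      moreover have "commutator G (w1 \<otimes> x) x \<in> {\<one>, s}"
        using commutator_mult_left[OF w1(1) x x] xx w1(2) sG by auto
      moreover have "w1 \<in> H" if "w1 \<otimes> x \<in> H"
      proof -
        have "w1 \<otimes> x \<otimes> inv x \<in> H"
          using that H(3) subgroup.m_closed[OF H(1)] subgroup.m_inv_closed[OF H(1)] by blast
        then show ?thesis using w1(1) x by (simp add: m_assoc)
      qed
      ultimately show ?thesis using that[of "w1 \<otimes> x"] w1 x by simp
    qed (use that w1 in blast)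
    have "commutator G r x = \<one> \<or> commutator G r y = \<one> \<or> commutator G r (x \<otimes> y) = \<one>"
    proof (rule ccontr)
      assume a: "\<not> ?thesis"
      then have "commutator G r x = s" "commutator G r y = s" using r by auto
      then have "commutator G r (x \<otimes> y) = \<one>"
        using commutator_mult_right[OF r(1) x y] commutator_square[OF r(1) x] by simp
      then show False using a by blast
    qed
    then have "r \<in> H"
      using mem_coset_if_commutes[OF r(1) x nc(1) _ H(1,2,3)] mem_coset_if_commutes[OF r(1) y nc(2) _ H(1,2,4)]
        mem_coset_if_commutes[OF r(1) _ xync _ H(1,2)] subgroup.m_closed[OF H(1,3,4)] x y by blast
    then show "w \<in> H" using r(4) by blast
  qed
qed

text \<open>The order is at most \<open>4 |Z| = 16\<close>, and it is a proper multiple of \<open>|C(u)| = 8\<close> for every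
  non-central \<open>u\<close>.\<close>

lemma order_16: "order G = 16"
proof -
  obtain x y where xy: "x \<in> carrier G" "y \<in> carrier G" "commutator G x y \<noteq> \<one>" using noncommuting_pair .
  have "generate G (insert y (insert x (center G))) = carrier G"
  proof (rule generated_by_pair_and_center[OF xy])
    show "subgroup (generate G (insert y (insert x (center G)))) G"
      using center_subset xy by (intro generate_is_subgroup) simp
  qed (auto intro: generate.incl)
  then have le: "order G \<le> 16"
    using order_le_4_center[OF xy(1,2)] square_central commutator_central xy card_center by simp
  obtain u where u: "u \<in> carrier G" "u \<notin> center G" using not_comm_noncentral[OF not_comm] .
  have "card (centralizer G u) = 8" using half[OF u] card_center by simp
  then have "8 dvd order G" "8 < order G" using centralizer_proper[OF u] by simp_all
  then show ?thesis using le by presburger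
qed

text \<open>This formula drives the case analysis: it gives the square of the third non-central coset
  from those of the other two.\<close>

lemma product_square:
  assumes G: "x \<in> carrier G" "y \<in> carrier G"
  shows "(x \<otimes> y) \<otimes> (x \<otimes> y) = commutator G x y \<otimes> (x \<otimes> x) \<otimes> (y \<otimes> y)"
proof -
  let ?t = "commutator G x y"
  have tG: "?t \<in> carrier G" using commutator_closed G by simp
  have "(x \<otimes> y) \<otimes> (x \<otimes> y) = x \<otimes> (y \<otimes> x) \<otimes> y" using G by (simp add: m_assoc)
  also have "y \<otimes> x = ?t \<otimes> x \<otimes> y" using mult_eq_commutator[OF G(2,1)] commutator_sym[OF G] by simp
  also have "x \<otimes> (?t \<otimes> x \<otimes> y) \<otimes> y = (x \<otimes> ?t) \<otimes> x \<otimes> (y \<otimes> y)" using G tG by (simp add: m_assoc)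
  also have "x \<otimes> ?t = ?t \<otimes> x" using center_comm[OF commutator_central[OF G] G(1)] by simp
  finally show ?thesis using G tG by (simp add: m_assoc)
qed

lemma commutator_self: "x \<in> carrier G \<Longrightarrow> commutator G x x = \<one>"
  using commutator_eq_one_iff by simp

lemma commutator_with_center: "z \<in> center G \<Longrightarrow> x \<in> carrier G \<Longrightarrow> commutator G z x = \<one>"
  using commutator_eq_one_iff center_comm center_closed by simp

lemma generate_eq_carrierI:
  assumes G: "x \<in> carrier G" "y \<in> carrier G" "commutator G x y = t" "t \<noteq> \<one>"
    and Z: "center G = {\<one>, t, s, s \<otimes> t}"
    and B: "B \<subseteq> carrier G" "x \<in> generate G B" "y \<in> generate G B" "t \<in> generate G B" "s \<in> generate G B"
  shows "generate G B = carrier G"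
proof (rule generated_by_pair_and_center[OF G(1,2)])
  show "center G \<subseteq> generate G B"
    unfolding Z using B generate.eng[of s G B t] by (simp add: generate.one)
qed (use G B generate_is_subgroup in simp_all)

lemma dihedral_type_presented:
  assumes G: "x \<in> carrier G" "y \<in> carrier G" "commutator G x y = t" "t \<noteq> \<one>"
    and Z: "center G = {\<one>, t, s, s \<otimes> t}" "s \<in> center G"
    and sq: "x \<otimes> x = t" "y \<otimes> y = x [^] (j::nat)" "s \<otimes> s = x [^] (k::nat)"
  shows "presented_by G (dihedral_type_relations j k)"
proof -
  have tG: "t \<in> carrier G" using commutator_closed[OF G(1,2)] G(3) by simp
  have sG: "s \<in> carrier G" using Z(2) center_closed by blast
  have "x [^] (4::nat) = (x \<otimes> x) \<otimes> (x \<otimes> x)" using G by (simp add: numeral_eq_Suc m_assoc)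
  also have "\<dots> = \<one>" using commutator_square[OF G(1,2)] G(3) sq(1) by simp
  finally have x4: "x [^] (4::nat) = \<one>" .
  have x3: "x [^] (3::nat) = t \<otimes> x" using G(1) sq(1) by (simp add: numeral_eq_Suc)
  have conj: "y \<otimes> x \<otimes> inv y = t \<otimes> x"
    using conj_eq_commutator[OF G(2,1)] commutator_sym[OF G(1,2)] G(3) by simp
  have mem: "x \<in> generate G {x, y, s}" "y \<in> generate G {x, y, s}" "s \<in> generate G {x, y, s}"
    by (auto intro: generate.incl)
  have "t \<in> generate G {x, y, s}" using generate.eng[OF mem(1,1)] sq(1) by simp
  then have "generate G {x, y, s} = carrier G"
    using generate_eq_carrierI[OF G Z(1)] mem G sG by simp
  then show ?thesis
    using G sG sq x4 x3 conj center_comm[OF Z(2) G(1)] center_comm[OF Z(2) G(2)]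
    by (intro presented_by_three_gensI) (simp_all add: satisfies_dihedral_type numeral_2_eq_2)
qed

lemma modular_presented:
  assumes G: "x \<in> carrier G" "y \<in> carrier G" "commutator G x y = t" "t \<noteq> \<one>"
    and Z: "center G = {\<one>, t, s, s \<otimes> t}" "s \<in> center G"
    and sq: "x \<otimes> x = s" "s \<otimes> s = t" "y \<otimes> y = \<one>"
  shows "presented_by G (metacyclic_relations 8 2 5 0)"
proof -
  have tG: "t \<in> carrier G" using commutator_closed[OF G(1,2)] G(3) by simp
  have "x [^] (4::nat) = (x \<otimes> x) \<otimes> (x \<otimes> x)" using G by (simp add: numeral_eq_Suc m_assoc)
  then have x4: "x [^] (4::nat) = t" using sq by simp
  have "x [^] (8::nat) = x [^] (4::nat) \<otimes> x [^] (4::nat)" using G by (simp add: nat_pow_mult)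
  then have x8: "x [^] (8::nat) = \<one>" using x4 commutator_square[OF G(1,2)] G(3) by simp
  have "x [^] (5::nat) = x [^] (4::nat) \<otimes> x" using G by (simp add: numeral_eq_Suc)
  then have x5: "x [^] (5::nat) = t \<otimes> x" using x4 by simp
  have conj: "y \<otimes> x \<otimes> inv y = t \<otimes> x"
    using conj_eq_commutator[OF G(2,1)] commutator_sym[OF G(1,2)] G(3) by simp
  have mem: "x \<in> generate G {x, y}" "y \<in> generate G {x, y}" by (auto intro: generate.incl)
  have s: "s \<in> generate G {x, y}" using generate.eng[OF mem(1,1)] sq(1) by simp
  have "t \<in> generate G {x, y}" using generate.eng[OF s s] sq(2) by simp
  then have "generate G {x, y} = carrier G"
    using generate_eq_carrierI[OF G Z(1)] mem G s by simp
  then show ?thesis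
    using G sq x8 x5 conj
    by (intro presented_by_two_gensI) (simp_all add: satisfies_metacyclic numeral_2_eq_2)
qed

lemma C4xC2_sdp_C2_presented:
  assumes G: "x \<in> carrier G" "y \<in> carrier G" "commutator G x y = t" "t \<noteq> \<one>"
    and Z: "center G = {\<one>, t, s, s \<otimes> t}" "s \<in> center G"
    and sq: "x \<otimes> x = s" "s \<otimes> s = \<one>" "y \<otimes> y = \<one>"
  shows "presented_by G C4xC2_sdp_C2_relations"
proof -
  have tZ: "t \<in> center G" using Z by simp
  have tG: "t \<in> carrier G" using center_closed[OF tZ] .
  have tt: "t \<otimes> t = \<one>" using commutator_square[OF G(1,2)] G(3) by simp
  have "x [^] (4::nat) = (x \<otimes> x) \<otimes> (x \<otimes> x)" using G by (simp add: numeral_eq_Suc m_assoc)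
  then have x4: "x [^] (4::nat) = \<one>" using sq by simp
  have conj: "y \<otimes> x \<otimes> inv y = x \<otimes> t"
    using conj_eq_commutator[OF G(2,1)] commutator_sym[OF G(1,2)] G(3) center_comm[OF tZ G(1)] by simp
  have mem: "x \<in> generate G {x, t, y}" "y \<in> generate G {x, t, y}" "t \<in> generate G {x, t, y}"
    by (auto intro: generate.incl)
  have s: "s \<in> generate G {x, t, y}" using generate.eng[OF mem(1,1)] sq(1) by simp
  then have "generate G {x, t, y} = carrier G"
    using generate_eq_carrierI[OF G Z(1)] mem G tG by simp
  moreover have "satisfies G (case_three_gens x t y) C4xC2_sdp_C2_relations"
    unfolding satisfies_C4xC2_sdp_C2 three_gens.case
    using G(1,2) tG x4 tt sq(3) conj center_comm[OF tZ G(1), symmetric] center_comm[OF tZ G(2)]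
    by (intro conjI) (assumption | simp add: numeral_2_eq_2)+
  ultimately show ?thesis using presented_by_three_gensI by blast
qed

lemma inverting_presented:
  assumes G: "x \<in> carrier G" "y \<in> carrier G" "commutator G x y = t" "t \<noteq> \<one>"
    and Z: "center G = {\<one>, t, s, s \<otimes> t}" "s \<in> center G"
    and sq: "x \<otimes> x = s" "s \<otimes> s = \<one>" "y \<otimes> y = t"
  shows "presented_by G inverting_relations"
proof -
  have tG: "t \<in> carrier G" using commutator_closed[OF G(1,2)] G(3) by simp
  have tt: "t \<otimes> t = \<one>" using commutator_square[OF G(1,2)] G(3) by simp
  have "x [^] (4::nat) = (x \<otimes> x) \<otimes> (x \<otimes> x)" using G by (simp add: numeral_eq_Suc m_assoc)
  then have x4: "x [^] (4::nat) = \<one>" using sq by simp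
  have "y [^] (4::nat) = (y \<otimes> y) \<otimes> (y \<otimes> y)" using G by (simp add: numeral_eq_Suc m_assoc)
  then have y4: "y [^] (4::nat) = \<one>" using sq tt by simp
  have "t \<otimes> y \<otimes> y = \<one>" using G tG sq(3) tt by (simp add: m_assoc)
  then have "inv y = t \<otimes> y" using inv_equality G tG by simp
  then have conj: "x \<otimes> y \<otimes> inv x = inv y"
    using conj_eq_commutator[OF G(1,2)] G(3) by simp
  have mem: "x \<in> generate G {y, x}" "y \<in> generate G {y, x}" by (auto intro: generate.incl)
  have s: "s \<in> generate G {y, x}" using generate.eng[OF mem(1,1)] sq(1) by simp
  have "t \<in> generate G {y, x}" using generate.eng[OF mem(2,2)] sq(3) by simp
  then have "generate G {y, x} = carrier G"
    using generate_eq_carrierI[OF G Z(1)] mem G s by simp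
  then show ?thesis
    using G x4 y4 conj
    by (intro presented_by_two_gensI) (simp_all add: satisfies_inverting)
qed

lemma commutator_products:
  assumes G: "x \<in> carrier G" "y \<in> carrier G" "commutator G x y = t"
  shows "commutator G x (x \<otimes> y) = t" "commutator G (x \<otimes> y) y = t" "commutator G y x = t"
proof -
  have tG: "t \<in> carrier G" using commutator_closed[OF G(1,2)] G(3) by simp
  show "commutator G x (x \<otimes> y) = t"
    using commutator_mult_right[OF G(1,1,2)] commutator_self[OF G(1)] G(3) tG by simp
  show "commutator G (x \<otimes> y) y = t"
    using commutator_mult_left[OF G(1,2,2)] commutator_self[OF G(2)] G(3) tG by simp
  show "commutator G y x = t" using commutator_sym[OF G(1,2)] G(3) by simp
qed

text \<open>As \<open>s\<^sup>2 = t\<close>, multiplication by \<open>s\<close> changes a square by the factor \<open>t\<close>, so the generators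
  can be chosen with squares in \<open>{\<one>, s}\<close>. If both squares are \<open>\<one>\<close>, then \<open>x y\<close> squares to \<open>t = s\<^sup>2\<close>
  and the group is the central product of \<open>D\<^sub>8\<close> and \<open>C\<^sub>4\<close>. Otherwise some pair of generators among
  \<open>x\<close>, \<open>y\<close>, \<open>x y\<close> has squares \<open>s\<close> and \<open>\<one>\<close>; the former has order 8, and the group is \<open>C\<^sub>8 \<rtimes> C\<^sub>2\<close>.\<close>

lemma cyclic_center_case:
  assumes G: "x \<in> carrier G" "y \<in> carrier G" "commutator G x y = t" "t \<noteq> \<one>"
    and Z: "center G = {\<one>, t, s, s \<otimes> t}" "s \<in> center G" and ss: "s \<otimes> s = t"
  shows "presented_by G (dihedral_type_relations 0 2) \<or> presented_by G (metacyclic_relations 8 2 5 0)"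
proof -
  have sG: "s \<in> carrier G" using Z(2) center_closed by blast
  have tG: "t \<in> carrier G" using commutator_closed[OF G(1,2)] G(3) by simp
  have tt: "t \<otimes> t = \<one>" using commutator_square[OF G(1,2)] G(3) by simp
  have norm: "\<exists>c \<in> center G. (u \<otimes> c) \<otimes> (u \<otimes> c) \<in> {\<one>, s}" if u: "u \<in> carrier G" for u
  proof (cases "u \<otimes> u \<in> {\<one>, s}")
    case True
    then show ?thesis using u subgroup.one_closed[OF subgroup_center] by (intro bexI[of _ \<one>]) simp_all
  next
    case False
    then have "u \<otimes> u = t \<or> u \<otimes> u = s \<otimes> t" using square_central[OF u] Z(1) by auto
    moreover have "(u \<otimes> s) \<otimes> (u \<otimes> s) = (u \<otimes> u) \<otimes> t"
    proof -
      have "(u \<otimes> s) \<otimes> (u \<otimes> s) = u \<otimes> (s \<otimes> u) \<otimes> s" using u sG by (simp add: m_assoc)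
      also have "s \<otimes> u = u \<otimes> s" by (rule center_comm[OF Z(2) u])
      also have "u \<otimes> (u \<otimes> s) \<otimes> s = (u \<otimes> u) \<otimes> (s \<otimes> s)" using u sG by (simp add: m_assoc)
      finally show ?thesis unfolding ss .
    qed
    ultimately have "(u \<otimes> s) \<otimes> (u \<otimes> s) \<in> {\<one>, s}" using tt sG tG by (auto simp: m_assoc)
    then show ?thesis using Z(2) by blast
  qed
  obtain c where c: "c \<in> center G" "(x \<otimes> c) \<otimes> (x \<otimes> c) \<in> {\<one>, s}" using norm[OF G(1)] by blast
  obtain d where d: "d \<in> center G" "(y \<otimes> d) \<otimes> (y \<otimes> d) \<in> {\<one>, s}" using norm[OF G(2)] by blast
  define x' where "x' = x \<otimes> c"
  define y' where "y' = y \<otimes> d"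
  have cd: "c \<in> carrier G" "d \<in> carrier G" using c d center_closed by blast+
  have G': "x' \<in> carrier G" "y' \<in> carrier G" using G cd by (simp_all add: x'_def y'_def)
  have "commutator G x' y' = commutator G x y'"
    using commutator_mult_left[OF G(1) cd(1) G'(2)] commutator_with_center[OF c(1) G'(2)]
      commutator_closed[OF G(1) G'(2)] by (simp add: x'_def)
  also have "\<dots> = commutator G x y"
    using commutator_mult_right[OF G(1,2) cd(2)] commutator_with_center[OF d(1) G(1)]
      commutator_sym[OF G(1) cd(2)] commutator_closed[OF G(1,2)] by (simp add: y'_def)
  finally have t': "commutator G x' y' = t" using G(3) by simp
  have xyG: "x' \<otimes> y' \<in> carrier G" using G' by simp
  note prod = commutator_products[OF G' t'] and psq = product_square[OF G', unfolded t']
  have "x' \<otimes> x' = \<one> \<or> x' \<otimes> x' = s" "y' \<otimes> y' = \<one> \<or> y' \<otimes> y' = s"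
    using c(2) d(2) by (auto simp: x'_def y'_def)
  then consider (a) "x' \<otimes> x' = \<one>" "y' \<otimes> y' = \<one>" | (b) "x' \<otimes> x' = s" "y' \<otimes> y' = \<one>"
    | (c) "x' \<otimes> x' = \<one>" "y' \<otimes> y' = s" | (d) "x' \<otimes> x' = s" "y' \<otimes> y' = s" by blast
  then show ?thesis
  proof cases
    case a
    have 1: "(x' \<otimes> y') \<otimes> (x' \<otimes> y') = t" using psq a tG by simp
    have "(x' \<otimes> y') [^] (2::nat) = t" using 1 xyG by (simp add: numeral_2_eq_2)
    then have "presented_by G (dihedral_type_relations 0 2)"
      using dihedral_type_presented[OF xyG G'(2) prod(2) G(4) Z 1, of 0 2] a ss by simp
    then show ?thesis by blast
  next
    case b
    then show ?thesis using modular_presented[OF G' t' G(4) Z _ ss] by blast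
  next
    case c
    then show ?thesis using modular_presented[OF G'(2,1) prod(3) G(4) Z _ ss] by blast
  next
    case d
    have "(x' \<otimes> y') \<otimes> (x' \<otimes> y') = \<one>" using psq d tG sG ss tt by (simp add: m_assoc)
    then show ?thesis using modular_presented[OF G'(1) xyG prod(1) G(4) Z d(1) ss] by blast
  qed
qed

text \<open>If \<open>x\<close> and \<open>y\<close> both square to \<open>t\<close>, they generate a quaternion group; otherwise some pair
  among \<open>x\<close>, \<open>y\<close>, \<open>x y\<close> has squares \<open>t\<close> and \<open>\<one>\<close> and generates a group \<open>D\<^sub>8\<close>. In both cases \<open>s\<close>
  splits off as a direct factor of order 2.\<close>

lemma klein_center_case_1:
  assumes G: "x \<in> carrier G" "y \<in> carrier G" "commutator G x y = t" "t \<noteq> \<one>"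
    and Z: "center G = {\<one>, t, s, s \<otimes> t}" "s \<in> center G" and ss: "s \<otimes> s = \<one>"
    and sq: "x \<otimes> x \<in> {\<one>, t}" "y \<otimes> y \<in> {\<one>, t}"
  shows "presented_by G (dihedral_type_relations 0 0) \<or> presented_by G (dihedral_type_relations 2 0)"
proof -
  have tG: "t \<in> carrier G" using commutator_closed[OF G(1,2)] G(3) by simp
  have xyG: "x \<otimes> y \<in> carrier G" using G by simp
  note prod = commutator_products[OF G(1,2,3)] and psq = product_square[OF G(1,2), unfolded G(3)]
  consider (a) "x \<otimes> x = \<one>" "y \<otimes> y = \<one>" | (b) "x \<otimes> x = t" "y \<otimes> y = \<one>"
    | (c) "x \<otimes> x = \<one>" "y \<otimes> y = t" | (d) "x \<otimes> x = t" "y \<otimes> y = t" using sq by blast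
  then show ?thesis
  proof cases
    case a
    have 1: "(x \<otimes> y) \<otimes> (x \<otimes> y) = t" using psq a tG by simp
    then show ?thesis
      using dihedral_type_presented[OF xyG G(2) prod(2) G(4) Z 1, of 0 0] a ss by simp
  next
    case b
    then show ?thesis using dihedral_type_presented[OF G Z b(1), of 0 0] ss by simp
  next
    case c
    then show ?thesis using dihedral_type_presented[OF G(2,1) prod(3) G(4) Z c(2), of 0 0] ss by simp
  next
    case d
    have "x [^] (2::nat) = t" using d(1) G(1) by (simp add: numeral_2_eq_2)
    then show ?thesis using dihedral_type_presented[OF G Z d(1), of 2 0] d ss by simp
  qed
qed

text \<open>The square \<open>u\<close> of \<open>x\<close> can take the role of \<open>s\<close>. Since \<open>(x y)\<^sup>2 = t u y\<^sup>2\<close>, either \<open>y\<close> or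
  \<open>x y\<close> has its square in \<open>{\<one>, t}\<close>, and together with \<open>x\<close> it satisfies the relations of one of the
  two groups.\<close>

lemma klein_center_case_2:
  assumes G: "x \<in> carrier G" "y \<in> carrier G" "commutator G x y = t" "t \<noteq> \<one>"
    and Z: "center G = {\<one>, t, s, s \<otimes> t}" "s \<in> center G" and ss: "s \<otimes> s = \<one>"
    and sq: "x \<otimes> x \<notin> {\<one>, t}"
  shows "presented_by G C4xC2_sdp_C2_relations \<or> presented_by G inverting_relations"
proof -
  have sG: "s \<in> carrier G" using Z(2) center_closed by blast
  have tG: "t \<in> carrier G" using commutator_closed[OF G(1,2)] G(3) by simp
  have tt: "t \<otimes> t = \<one>" using commutator_square[OF G(1,2)] G(3) by simp
  have ts: "t \<otimes> s = s \<otimes> t" using center_comm[OF Z(2) tG] by simp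
  define u where "u = x \<otimes> x"
  have "u = s \<or> u = s \<otimes> t" using sq square_central[OF G(1)] Z(1) by (auto simp: u_def)
  then have Zu: "center G = {\<one>, t, u, u \<otimes> t}" and uu: "u \<otimes> u = \<one>"
  proof -
    assume u: "u = s \<or> u = s \<otimes> t"
    have "s \<otimes> t \<otimes> t = s" using sG tG tt by (simp add: m_assoc)
    then show "center G = {\<one>, t, u, u \<otimes> t}" using u Z(1) by auto
    have "(s \<otimes> t) \<otimes> (s \<otimes> t) = s \<otimes> (t \<otimes> s) \<otimes> t" using sG tG by (simp add: m_assoc)
    also have "\<dots> = (s \<otimes> s) \<otimes> (t \<otimes> t)" unfolding ts using sG tG by (simp add: m_assoc)
    finally show "u \<otimes> u = \<one>" using u ss tt by auto
  qed
  have uZ: "u \<in> center G" using Zu by blast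
  have uG: "u \<in> carrier G" using uZ center_closed by blast
  have main: ?thesis if v: "v \<in> carrier G" "commutator G x v = t" "v \<otimes> v = \<one> \<or> v \<otimes> v = t" for v
    using C4xC2_sdp_C2_presented[OF G(1) v(1,2) G(4) Zu uZ u_def[symmetric] uu]
      inverting_presented[OF G(1) v(1,2) G(4) Zu uZ u_def[symmetric] uu] v(3) by blast
  have xyG: "x \<otimes> y \<in> carrier G" using G by simp
  have psq: "(x \<otimes> y) \<otimes> (x \<otimes> y) = t \<otimes> u \<otimes> (y \<otimes> y)"
    using product_square[OF G(1,2), unfolded G(3)] by (simp add: u_def)
  have "y \<otimes> y \<in> {\<one>, t, u, u \<otimes> t}" using square_central[OF G(2)] Zu by simp
  then consider (a) "y \<otimes> y = \<one> \<or> y \<otimes> y = t" | (b) "y \<otimes> y = u" | (c) "y \<otimes> y = u \<otimes> t" by blast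
  then show ?thesis
  proof cases
    case a
    then show ?thesis using main[OF G(2,3)] by blast
  next
    case b
    then have "(x \<otimes> y) \<otimes> (x \<otimes> y) = t" using psq uu tG uG by (simp add: m_assoc)
    then show ?thesis using main[OF xyG commutator_products(1)[OF G(1,2,3)]] by blast
  next
    case c
    have "t \<otimes> u \<otimes> (u \<otimes> t) = t \<otimes> (u \<otimes> u) \<otimes> t" using tG uG by (simp add: m_assoc)
    then have "(x \<otimes> y) \<otimes> (x \<otimes> y) = \<one>" using psq c uu tG tt by simp
    then show ?thesis using main[OF xyG commutator_products(1)[OF G(1,2,3)]] by blast
  qed
qed

theorem classification:
  "presented_by G C4xC2_sdp_C2_relations \<or> presented_by G inverting_relations \<or>
   presented_by G (metacyclic_relations 8 2 5 0) \<or> presented_by G (dihedral_type_relations 0 0) \<or>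
   presented_by G (dihedral_type_relations 2 0) \<or> presented_by G (dihedral_type_relations 0 2)"
proof -
  obtain x y where xy: "x \<in> carrier G" "y \<in> carrier G" "commutator G x y \<noteq> \<one>" using noncommuting_pair .
  define t where "t = commutator G x y"
  have G: "x \<in> carrier G" "y \<in> carrier G" "commutator G x y = t" "t \<noteq> \<one>" using xy by (simp_all add: t_def)
  have t: "t \<in> center G" "t \<otimes> t = \<one>" using commutator_central commutator_square xy by (simp_all add: t_def)
  obtain s where Z: "center G = {\<one>, t, s, s \<otimes> t}" "s \<in> center G" "s \<otimes> s = \<one> \<or> s \<otimes> s = t"
    using center_cases[OF t(1) G(4) t(2)] by metis
  from Z(3) show ?thesis
  proof
    assume "s \<otimes> s = t"
    then show ?thesis using cyclic_center_case[OF G Z(1,2)] by blast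
  next
    assume ss: "s \<otimes> s = \<one>"
    show ?thesis
      using klein_center_case_1[OF G Z(1,2) ss] klein_center_case_2[OF G Z(1,2) ss]
        klein_center_case_2[OF G(2,1) commutator_products(3)[OF G(1,2,3)] G(4) Z(1,2) ss] by blast
  qed
qed

end

section \<open>Semidirect products in which a generator inverts\<close>

text \<open>The parity of \<open>m\<close> makes the sign by which \<open>k\<close> acts well defined modulo \<open>m\<close>.\<close>

context
  fixes n m :: nat
  assumes n: "n \<ge> 2" and m: "m \<ge> 2" "even m"
begin

private definition S where
  "S = semidirect_product (cyclic n) (cyclic m) (inversion_action (cyclic n))"

private definition sg :: "int \<Rightarrow> int" where
  "sg k = (if even k then 1 else -1)"

private lemma inversion_power:
  "i \<in> {0..<int n} \<Longrightarrow> ((m_inv (cyclic n)) ^^ j) i = ((-1) ^ j * i) mod int n"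
proof (induction j)
  case (Suc j)
  then show ?case using n by (simp add: carrier_integer_mod_group mod_minus_eq)
qed (use n in simp)

private lemma action: "\<lbrakk>i \<in> {0..<int n}; 0 \<le> k\<rbrakk> \<Longrightarrow> inversion_action (cyclic n) k i = (sg k * i) mod int n"
  by (simp add: inversion_action_def inversion_power sg_def minus_one_power_iff even_nat_iff)

private lemma S_carrier: "carrier S = {0..<int n} \<times> {0..<int m}"
  using n m by (simp add: S_def semidirect_product_def carrier_integer_mod_group)

private lemma S_one: "\<one>\<^bsub>S\<^esub> = (0, 0)"
  by (simp add: S_def semidirect_product_def)

private lemma S_mult:
  "\<lbrakk>i' \<in> {0..<int n}; k \<in> {0..<int m}\<rbrakk> \<Longrightarrow>
    (i, k) \<otimes>\<^bsub>S\<^esub> (i', k') = ((i + sg k * i') mod int n, (k + k') mod int m)"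
  by (simp add: S_def semidirect_product_def action mod_simps)

private lemma sg_mod: "sg (k mod int m) = sg k"
  using m(2) by (simp add: sg_def dvd_mod_iff)

private lemma sg_add: "sg (k + k') = sg k * sg k'"
  by (simp add: sg_def)

private lemma sg_minus: "sg (- k) = sg k"
  by (simp add: sg_def)

lemma group_semidirect_inversion: 
  "group (semidirect_product (cyclic n) (cyclic m) (inversion_action (cyclic n)))"
  unfolding S_def[symmetric]
proof (rule groupI)
  fix x y assume "x \<in> carrier S" "y \<in> carrier S"
  then show "x \<otimes>\<^bsub>S\<^esub> y \<in> carrier S" using n m by (auto simp: S_carrier S_mult)
next
  fix x y z assume "x \<in> carrier S" "y \<in> carrier S" "z \<in> carrier S"
  then obtain i k i' k' i'' k'' where xyz: "x = (i, k)" "y = (i', k')" "z = (i'', k'')"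
    and c: "i \<in> {0..<int n}" "k \<in> {0..<int m}" "i' \<in> {0..<int n}" "k' \<in> {0..<int m}"
      "i'' \<in> {0..<int n}" "k'' \<in> {0..<int m}"
    by (auto simp: S_carrier)
  have "(i + sg k * i') mod int n \<in> {0..<int n}" "(k + k') mod int m \<in> {0..<int m}"
    "(i' + sg k' * i'') mod int n \<in> {0..<int n}" using n m by simp_all
  then show "x \<otimes>\<^bsub>S\<^esub> y \<otimes>\<^bsub>S\<^esub> z = x \<otimes>\<^bsub>S\<^esub> (y \<otimes>\<^bsub>S\<^esub> z)"
    using c mod_add_right_eq[of i "sg k * ((i' + sg k' * i'') mod int n)" "int n"]
      mod_mult_right_eq[of "sg k" "i' + sg k' * i''" "int n"]
      mod_add_right_eq[of i "sg k * (i' + sg k' * i'')" "int n"]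
    by (simp add: xyz S_mult sg_mod sg_add mod_add_left_eq mod_add_right_eq) (simp add: algebra_simps)
next
  fix x assume "x \<in> carrier S"
  then obtain i k where x: "x = (i, k)" and c: "i \<in> {0..<int n}" "k \<in> {0..<int m}" by (auto simp: S_carrier)
  show "\<one>\<^bsub>S\<^esub> \<otimes>\<^bsub>S\<^esub> x = x" using c m by (simp add: x S_one S_mult sg_def)
  let ?y = "((- (sg k * i)) mod int n, (- k) mod int m)"
  have "?y \<otimes>\<^bsub>S\<^esub> x = \<one>\<^bsub>S\<^esub>"
    using c m by (simp add: x S_one S_mult sg_mod sg_minus mod_simps)
  moreover have "?y \<in> carrier S" using n m by (simp add: S_carrier)
  ultimately show "\<exists>y \<in> carrier S. y \<otimes>\<^bsub>S\<^esub> x = \<one>\<^bsub>S\<^esub>" by blast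
qed (use n m in \<open>simp add: S_carrier S_one\<close>)

lemma card_semidirect_inversion:
  "card (carrier (semidirect_product (cyclic n) (cyclic m) (inversion_action (cyclic n)))) = n * m"
  unfolding S_def[symmetric] by (simp add: S_carrier card_cartesian_product)

lemma carrier_semidirect_inversion:
  "carrier (semidirect_product (cyclic n) (cyclic m) (inversion_action (cyclic n))) =
    {0..<int n} \<times> {0..<int m}"
  unfolding S_def[symmetric] by (rule S_carrier)

lemma mult_semidirect_inversion:
  "\<lbrakk>i' \<in> {0..<int n}; k \<in> {0..<int m}\<rbrakk> \<Longrightarrow>
    (i, k) \<otimes>\<^bsub>semidirect_product (cyclic n) (cyclic m) (inversion_action (cyclic n))\<^esub> (i', k') =
      ((i + (if even k then i' else - i')) mod int n, (k + k') mod int m)"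
  unfolding S_def[symmetric] by (simp add: S_mult sg_def)

lemma semidirect_inversion_generators:
  "satisfies (semidirect_product (cyclic n) (cyclic m) (inversion_action (cyclic n)))
    (case_two_gens (1, 0) (0, 1)) (metacyclic_relations n m (n - 1) 0)"
  "generate (semidirect_product (cyclic n) (cyclic m) (inversion_action (cyclic n))) {(1, 0), (0, 1)} =
    carrier (semidirect_product (cyclic n) (cyclic m) (inversion_action (cyclic n)))"
  unfolding S_def[symmetric]
proof -
  interpret S: group S unfolding S_def by (rule group_semidirect_inversion)
  let ?x = "(1, 0) :: int \<times> int" and ?y = "(0, 1) :: int \<times> int"
  have c: "?x \<in> carrier S" "?y \<in> carrier S" using n m by (simp_all add: S_carrier)
  have px: "?x [^]\<^bsub>S\<^esub> j = (int j mod int n, 0)" for j :: nat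
    using n m by (induction j) (simp_all add: S_one S_mult sg_def mod_simps add.commute)
  have py: "?y [^]\<^bsub>S\<^esub> j = (0, int j mod int m)" for j :: nat
    using n m by (induction j) (simp_all add: S_one S_mult mod_simps add.commute)
  have "?y \<otimes>\<^bsub>S\<^esub> ?x = ?x [^]\<^bsub>S\<^esub> (n - 1) \<otimes>\<^bsub>S\<^esub> ?y"
    unfolding px using n m by (simp add: S_mult sg_def of_nat_diff zmod_minus1)
  then have conj: "?y \<otimes>\<^bsub>S\<^esub> ?x \<otimes>\<^bsub>S\<^esub> inv\<^bsub>S\<^esub> ?y = ?x [^]\<^bsub>S\<^esub> (n - 1)"
    using c by (simp add: S.inv_solve_right')
  show "generate S {?x, ?y} = carrier S"
  proof
    show "generate S {?x, ?y} \<subseteq> carrier S" using c by (intro S.generate_incl) simp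
    show "carrier S \<subseteq> generate S {?x, ?y}"
    proof
      fix g assume "g \<in> carrier S"
      then obtain i k where g: "g = (i, k)" and ik: "i \<in> {0..<int n}" "k \<in> {0..<int m}" by (auto simp: S_carrier)
      have "g = ?x [^]\<^bsub>S\<^esub> nat i \<otimes>\<^bsub>S\<^esub> ?y [^]\<^bsub>S\<^esub> nat k"
        unfolding px py using ik m n by (simp add: g S_mult sg_def)
      then show "g \<in> generate S {?x, ?y}"
        using c by (simp add: generate.eng S.pow_in_generate)
    qed
  qed
  show "satisfies S (case_two_gens ?x ?y) (metacyclic_relations n m (n - 1) 0)"
    using c conj px[of n] py[of m] m n by (simp add: S.satisfies_metacyclic S_one)
qed

lemma presented_semidirect_inversion:
  "presented_by (semidirect_product (cyclic n) (cyclic m) (inversion_action (cyclic n)))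
    (metacyclic_relations n m (n - 1) 0)"
  using semidirect_inversion_generators
  by (rule group.presented_by_two_gensI[OF group_semidirect_inversion])

end

lemma dihedral_group_presented:
  assumes "n \<ge> 2" 
  shows "presented_by (dihedral_group n) (metacyclic_relations n 2 (n - 1) 0)"
    "card (carrier (dihedral_group n)) = n * 2"
  unfolding dihedral_group_def
  using presented_semidirect_inversion[of n 2] card_semidirect_inversion[of n 2] assms by (auto simp only: even_numeral order.refl)

lemma C3_sdp_C4_presented:
  "presented_by C3_sdp_C4 (metacyclic_relations 3 4 2 0)" "card (carrier C3_sdp_C4) = 12"
  unfolding C3_sdp_C4_def
  using presented_semidirect_inversion[of 3 4] by (simp_all add: card_semidirect_inversion)

section \<open>The quaternion group\<close>

lemma group_quaternion_group: "group quaternion_group"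
proof (rule groupI)
  fix x assume "x \<in> carrier quaternion_group"
  then show "\<exists>y \<in> carrier quaternion_group. y \<otimes>\<^bsub>quaternion_group\<^esub> x = \<one>\<^bsub>quaternion_group\<^esub>"
    by (intro bexI[of _ "case x of (p, q, r, s) \<Rightarrow> (p, - q, - r, - s)"])
      (simp add: quaternion_group_def, elim disjE; simp)+
next
  fix x y assume "x \<in> carrier quaternion_group" "y \<in> carrier quaternion_group"
  then show "x \<otimes>\<^bsub>quaternion_group\<^esub> y \<in> carrier quaternion_group"
    by (simp add: quaternion_group_def) (elim disjE; simp)
next
  fix x y z assume "x \<in> carrier quaternion_group" "y \<in> carrier quaternion_group" "z \<in> carrier quaternion_group"
  show "x \<otimes>\<^bsub>quaternion_group\<^esub> y \<otimes>\<^bsub>quaternion_group\<^esub> z =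
      x \<otimes>\<^bsub>quaternion_group\<^esub> (y \<otimes>\<^bsub>quaternion_group\<^esub> z)"
    by (simp add: quaternion_group_def algebra_simps split: prod.split)
qed (auto simp: quaternion_group_def)

lemma quaternion_group_presented:
  "presented_by quaternion_group (metacyclic_relations 4 2 3 2)" "card (carrier quaternion_group) = 8"
proof -
  let ?Q = quaternion_group
  interpret Q: group ?Q by (rule group_quaternion_group)
  show "card (carrier ?Q) = 8" by (simp add: quaternion_group_def)
  let ?x = "(0, 1, 0, 0) :: int \<times> int \<times> int \<times> int" and ?y = "(0, 0, 1, 0) :: int \<times> int \<times> int \<times> int"
  have c: "?x \<in> carrier ?Q" "?y \<in> carrier ?Q" by (simp_all add: quaternion_group_def)
  have x2: "?x [^]\<^bsub>?Q\<^esub> (2::nat) = (-1, 0, 0, 0)" and x3: "?x [^]\<^bsub>?Q\<^esub> (3::nat) = (0, -1, 0, 0)"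
    and x4: "?x [^]\<^bsub>?Q\<^esub> (4::nat) = \<one>\<^bsub>?Q\<^esub>" and y2: "?y [^]\<^bsub>?Q\<^esub> (2::nat) = (-1, 0, 0, 0)"
    by (simp_all add: numeral_eq_Suc quaternion_group_def)
  have "?y \<otimes>\<^bsub>?Q\<^esub> ?x = ?x [^]\<^bsub>?Q\<^esub> (3::nat) \<otimes>\<^bsub>?Q\<^esub> ?y"
    unfolding x3 by (simp add: quaternion_group_def)
  then have conj: "?y \<otimes>\<^bsub>?Q\<^esub> ?x \<otimes>\<^bsub>?Q\<^esub> inv\<^bsub>?Q\<^esub> ?y = ?x [^]\<^bsub>?Q\<^esub> (3::nat)"
    using c by (simp add: Q.inv_solve_right')
  have "generate ?Q {?x, ?y} = carrier ?Q"
  proof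
    let ?H = "generate ?Q {?x, ?y}"
    show "?H \<subseteq> carrier ?Q" using c by (intro Q.generate_incl) simp
    have pow: "?x [^]\<^bsub>?Q\<^esub> i \<in> ?H" for i :: nat using c by (intro Q.pow_in_generate) simp_all
    have "?y \<in> ?H" by (simp add: generate.incl)
    then have powy: "?x [^]\<^bsub>?Q\<^esub> i \<otimes>\<^bsub>?Q\<^esub> ?y \<in> ?H" for i :: nat using pow by (intro generate.eng)
    have xy: "?x \<otimes>\<^bsub>?Q\<^esub> ?y = (0, 0, 0, 1)" "(-1, 0, 0, 0) \<otimes>\<^bsub>?Q\<^esub> ?y = (0, 0, -1, 0)"
      "(0, -1, 0, 0) \<otimes>\<^bsub>?Q\<^esub> ?y = (0, 0, 0, -1)" "\<one>\<^bsub>?Q\<^esub> = (1, 0, 0, 0)"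
      by (simp_all add: quaternion_group_def)
    have eq: "carrier ?Q = {\<one>\<^bsub>?Q\<^esub>, ?x, ?x [^]\<^bsub>?Q\<^esub> (2::nat), ?x [^]\<^bsub>?Q\<^esub> (3::nat),
        ?y, ?x \<otimes>\<^bsub>?Q\<^esub> ?y, ?x [^]\<^bsub>?Q\<^esub> (2::nat) \<otimes>\<^bsub>?Q\<^esub> ?y, ?x [^]\<^bsub>?Q\<^esub> (3::nat) \<otimes>\<^bsub>?Q\<^esub> ?y}"
      unfolding x2 x3 xy unfolding quaternion_group_def by simp blast
    have "?x \<in> ?H" by (simp add: generate.incl)
    then have "?x \<otimes>\<^bsub>?Q\<^esub> ?y \<in> ?H" using \<open>?y \<in> ?H\<close> by (rule generate.eng)
    then show "carrier ?Q \<subseteq> ?H"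
      unfolding eq using \<open>?x \<in> ?H\<close> \<open>?y \<in> ?H\<close> pow powy generate.one by (intro insert_subsetI empty_subsetI)
  qed
  then show "presented_by ?Q (metacyclic_relations 4 2 3 2)"
    using c conj x2 x4 y2 by (intro Q.presented_by_two_gensI) (simp_all add: Q.satisfies_metacyclic)
qed

section \<open>Direct products with cyclic groups\<close>

lemma DirProd_pow:
  "(x, y) [^]\<^bsub>G \<times>\<times> H\<^esub> (n::nat) = (x [^]\<^bsub>G\<^esub> n, y [^]\<^bsub>H\<^esub> n)"
  by (induction n) simp_all

lemma generate_DirProd_cyclic:
  assumes G: "group G" "generate G {x, y} = carrier G" "x \<in> carrier G" "y \<in> carrier G" and n: "n \<ge> 2"
  shows "generate (G \<times>\<times> cyclic n) {(x, 0), (y, 0), (\<one>\<^bsub>G\<^esub>, 1)} = carrier (G \<times>\<times> cyclic n)"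
proof -
  let ?P = "G \<times>\<times> cyclic n"
  let ?B = "{(x, 0), (y, 0), (\<one>\<^bsub>G\<^esub>, 1)}"
  interpret G: group G by (rule G(1))
  interpret P: group ?P using G(1) by (simp add: DirProd_group)
  have c: "?B \<subseteq> carrier ?P" using G n by simp
  have "(g, 0) \<in> generate ?P ?B" if "g \<in> carrier G" for g
  proof -
    interpret h: group_hom G ?P "\<lambda>g. (g, 0)"
      by (simp add: group_hom_def group_hom_axioms_def G.is_group P.is_group hom_def)
    have "(\<lambda>g. (g, 0)) ` generate G {x, y} = generate ?P ((\<lambda>g. (g, 0)) ` {x, y})"
      using h.generate_img[of "{x, y}"] G by simp
    also have "\<dots> \<subseteq> generate ?P ?B" by (intro P.mono_generate) auto
    finally show ?thesis using that G(2) by auto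
  qed
  moreover have "(\<one>\<^bsub>G\<^esub>, 1) [^]\<^bsub>?P\<^esub> k \<in> generate ?P ?B" for k :: nat
    by (rule P.pow_in_generate) (use c in auto)
  ultimately have prod: "(g, 0) \<otimes>\<^bsub>?P\<^esub> ((\<one>\<^bsub>G\<^esub>, 1) [^]\<^bsub>?P\<^esub> k) \<in> generate ?P ?B" if "g \<in> carrier G" for g and k :: nat
    using that by (intro generate.eng)
  have "carrier ?P \<subseteq> generate ?P ?B"
  proof
    fix p assume "p \<in> carrier ?P"
    then obtain g i where p: "p = (g, i)" "g \<in> carrier G" "i \<in> {0..<int n}"
      using n by (auto simp: carrier_integer_mod_group)
    then have "p = (g, 0) \<otimes>\<^bsub>?P\<^esub> ((\<one>\<^bsub>G\<^esub>, 1) [^]\<^bsub>?P\<^esub> nat i)"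
      unfolding DirProd_pow using G.nat_pow_one by simp
    then show "p \<in> generate ?P ?B" using prod[OF p(2)] by simp
  qed
  then show ?thesis using P.generate_incl[OF c] by blast
qed

text \<open>The generator of the new factor becomes the central generator \<open>c\<close>, with \<open>c\<^sup>2 = \<one> = a\<^sup>0\<close>.\<close>

lemma DirProd_cyclic_2_presented:
  assumes "presented_by G (metacyclic_relations 4 2 3 s)"
  shows "presented_by (G \<times>\<times> cyclic 2) (dihedral_type_relations s 0)"
proof -
  interpret G: group G using assms by (simp add: presented_by_def)
  obtain x y where xy: "satisfies G (case_two_gens x y) (metacyclic_relations 4 2 3 s)"
    "generate G {x, y} = carrier G" using G.presented_by_two_gensE[OF assms] .
  then have r: "x \<in> carrier G" "y \<in> carrier G" "x [^]\<^bsub>G\<^esub> (4::nat) = \<one>\<^bsub>G\<^esub>" "y [^]\<^bsub>G\<^esub> (2::nat) = x [^]\<^bsub>G\<^esub> s"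
      "y \<otimes>\<^bsub>G\<^esub> x \<otimes>\<^bsub>G\<^esub> inv\<^bsub>G\<^esub> y = x [^]\<^bsub>G\<^esub> (3::nat)"
    by (simp_all add: G.satisfies_metacyclic)
  interpret P: group "G \<times>\<times> cyclic 2" by (simp add: DirProd_group)
  show ?thesis
  proof (rule P.presented_by_three_gensI)
    show "generate (G \<times>\<times> cyclic 2) {(x, 0), (y, 0), (\<one>\<^bsub>G\<^esub>, 1)} = carrier (G \<times>\<times> cyclic 2)"
      using generate_DirProd_cyclic[OF G.is_group xy(2) r(1,2)] by simp
    show "satisfies (G \<times>\<times> cyclic 2) (case_three_gens (x, 0) (y, 0) (\<one>\<^bsub>G\<^esub>, 1)) (dihedral_type_relations s 0)"
      using r by (simp add: P.satisfies_dihedral_type DirProd_pow inv_DirProd)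
  qed
qed

lemma dihedral_4_C2_presented:
  "presented_by (dihedral_group 4 \<times>\<times> cyclic 2) (dihedral_type_relations 0 0)"
  "card (carrier (dihedral_group 4 \<times>\<times> cyclic 2)) = 16"
  using DirProd_cyclic_2_presented[of "dihedral_group 4" 0] dihedral_group_presented[of 4]
  by (simp_all add: card_cartesian_product carrier_integer_mod_group)

lemma quaternion_C2_presented:
  "presented_by (quaternion_group \<times>\<times> cyclic 2) (dihedral_type_relations 2 0)"
  "card (carrier (quaternion_group \<times>\<times> cyclic 2)) = 16"
  using DirProd_cyclic_2_presented[of quaternion_group 2] quaternion_group_presented
  by (simp_all add: card_cartesian_product carrier_integer_mod_group)

section \<open>The central product of the dihedral group of order eight and the cyclic group of order four\<close>

lemma center_dihedral_4: "center (dihedral_group 4) = {(0, 0), (2, 0)}"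
proof -
  let ?D = "dihedral_group 4"
  have mult: "(i, k) \<otimes>\<^bsub>?D\<^esub> (i', k') = ((i + (if even k then i' else - i')) mod 4, (k + k') mod 2)"
    if "i' \<in> {0..<4}" "k \<in> {0..<2}" for i k i' k'
    using mult_semidirect_inversion[of 4 2 i' k i k'] that by (simp add: dihedral_group_def)
  have car: "carrier ?D = {0..<4} \<times> {0..<2}"
    using carrier_semidirect_inversion[of 4 2] by (simp add: dihedral_group_def)
  show ?thesis
  proof (intro equalityI subsetI)
    fix z assume z: "z \<in> center ?D"
    then obtain i k where zik: "z = (i, k)" "i \<in> {0..<4}" "k \<in> {0..<2}" by (auto simp: center_def car)
    have "z \<otimes>\<^bsub>?D\<^esub> (1, 0) = (1, 0) \<otimes>\<^bsub>?D\<^esub> z" "z \<otimes>\<^bsub>?D\<^esub> (0, 1) = (0, 1) \<otimes>\<^bsub>?D\<^esub> z"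
      using z by (auto simp: center_def car)
    moreover have "i = 0 \<or> i = 1 \<or> i = 2 \<or> i = 3" "k = 0 \<or> k = 1" using zik by auto
    ultimately show "z \<in> {(0, 0), (2, 0)}" using zik(1) by (elim disjE) (simp_all add: mult)
  next
    fix z :: "int \<times> int" assume z: "z \<in> {(0, 0), (2, 0)}"
    have "z \<otimes>\<^bsub>?D\<^esub> g = g \<otimes>\<^bsub>?D\<^esub> z" if gD: "g \<in> carrier ?D" for g
    proof -
      obtain i k where g: "g = (i, k)" "i \<in> {0..<4}" "k \<in> {0..<2}" using gD by (auto simp: car)
      have "i = 0 \<or> i = 1 \<or> i = 2 \<or> i = 3" "k = 0 \<or> k = 1" using g by auto
      then show ?thesis using z g(1) by (elim disjE) (auto simp: mult)
    qed
    then show "z \<in> center ?D" using z by (auto simp: center_def car)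
  qed
qed

text \<open>For the projection from a direct product to a central product: the relation between the
  squares of \<open>c\<close> and \<open>a\<close> holds only in the image, all others hold before.\<close>

lemma (in group_hom) satisfies_dihedral_type_image:
  assumes c: "a \<in> carrier G" "b \<in> carrier G" "c \<in> carrier G"
    and r: "a [^] (4::nat) = \<one>" "b [^] (2::nat) = \<one>" "b \<otimes> a \<otimes> inv b = a [^] (3::nat)"
      "c \<otimes> a = a \<otimes> c" "c \<otimes> b = b \<otimes> c"
    and c2: "h c [^]\<^bsub>H\<^esub> (2::nat) = h a [^]\<^bsub>H\<^esub> (2::nat)"
  shows "satisfies H (case_three_gens (h a) (h b) (h c)) (dihedral_type_relations 0 2)"
proof -
  have "h a [^]\<^bsub>H\<^esub> (4::nat) = \<one>\<^bsub>H\<^esub>" "h b [^]\<^bsub>H\<^esub> (2::nat) = \<one>\<^bsub>H\<^esub>"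
    using arg_cong[OF r(1), of h] arg_cong[OF r(2), of h] c by (simp_all add: hom_nat_pow)
  moreover have "h b \<otimes>\<^bsub>H\<^esub> h a \<otimes>\<^bsub>H\<^esub> inv\<^bsub>H\<^esub> h b = h a [^]\<^bsub>H\<^esub> (3::nat)"
    using arg_cong[OF r(3), of h] c by (simp add: hom_nat_pow)
  moreover have "h c \<otimes>\<^bsub>H\<^esub> h a = h a \<otimes>\<^bsub>H\<^esub> h c" "h c \<otimes>\<^bsub>H\<^esub> h b = h b \<otimes>\<^bsub>H\<^esub> h c"
    using arg_cong[OF r(4), of h] arg_cong[OF r(5), of h] c by simp_all
  ultimately show ?thesis using c c2 by (simp add: H.satisfies_dihedral_type)
qed

text \<open>In \<open>D\<^sub>8 \<times> C\<^sub>4\<close> the square of the generator \<open>c\<close> of the second factor is \<open>((0, 0), 2)\<close>, which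
  differs from \<open>a\<^sup>2\<close> by the element \<open>((2, 0), 2)\<close> that the quotient kills.\<close>

lemma D8_central_C4_presented:
  "presented_by D8_central_C4 (dihedral_type_relations 0 2)" "card (carrier D8_central_C4) = 16"
proof -
  let ?D = "dihedral_group 4" and ?P = "dihedral_group 4 \<times>\<times> cyclic 4"
  have D: "group ?D" using group_semidirect_inversion[of 4 2] by (simp add: dihedral_group_def)
  interpret D: group ?D by (rule D)
  interpret P: group ?P using D by (simp add: DirProd_group)
  have mult: "(i, k) \<otimes>\<^bsub>?D\<^esub> (i', k') = ((i + (if even k then i' else - i')) mod 4, (k + k') mod 2)"
    if "i' \<in> {0..<4}" "k \<in> {0..<2}" for i k i' k'
    using mult_semidirect_inversion[of 4 2 i' k i k'] that by (simp add: dihedral_group_def)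
  have car: "carrier ?D = {0..<4} \<times> {0..<2}"
    using carrier_semidirect_inversion[of 4 2] by (simp add: dihedral_group_def)
  have one: "\<one>\<^bsub>?D\<^esub> = (0, 0)" by (simp add: dihedral_group_def semidirect_product_def)
  define N :: "((int \<times> int) \<times> int) set" where "N = {((0, 0), 0), ((2, 0), 2)}"
  have inv2: "inv\<^bsub>cyclic 4\<^esub> (2::int) = 2" by (subst inv_integer_mod_group) (simp_all add: carrier_integer_mod_group)
  have inv0: "inv\<^bsub>cyclic 4\<^esub> (0::int) = 0" by (subst inv_integer_mod_group) simp_all
  have "(\<lambda>z. (z, inv\<^bsub>cyclic 4\<^esub> (if z = \<one>\<^bsub>?D\<^esub> then 0 else 2))) ` center ?D = N"
    by (simp add: center_dihedral_4 one inv0 inv2 N_def)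
  then have Q: "D8_central_C4 = ?P Mod N" by (simp add: D8_central_C4_def central_product_def)
  have N_center: "z \<otimes>\<^bsub>?P\<^esub> p = p \<otimes>\<^bsub>?P\<^esub> z" if z: "z \<in> N" and p: "p \<in> carrier ?P" for z p
  proof -
    obtain g i where gi: "p = (g, i)" "g \<in> carrier ?D" using p by auto
    have "fst z \<in> center ?D" using z by (auto simp: N_def center_dihedral_4)
    then have "fst z \<otimes>\<^bsub>?D\<^esub> g = g \<otimes>\<^bsub>?D\<^esub> fst z" using gi by (simp add: center_def)
    then show ?thesis by (cases z) (simp add: gi add.commute)
  qed
  have NP: "N \<subseteq> carrier ?P" by (simp add: N_def car carrier_integer_mod_group)
  have sub: "subgroup N ?P"
  proof (rule P.subgroupI)
    fix z assume z: "z \<in> N"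
    then have "z \<otimes>\<^bsub>?P\<^esub> z = \<one>\<^bsub>?P\<^esub>" by (auto simp: N_def mult one)
    then have "inv\<^bsub>?P\<^esub> z = z" using z NP P.inv_equality by blast
    then show "inv\<^bsub>?P\<^esub> z \<in> N" using z by simp
  next
    fix z z' assume "z \<in> N" "z' \<in> N"
    then show "z \<otimes>\<^bsub>?P\<^esub> z' \<in> N" by (auto simp: N_def mult)
  qed (use NP in \<open>auto simp: N_def\<close>)
  have "N \<lhd> ?P"
    unfolding P.normal_inv_iff
  proof (intro conjI ballI sub)
    fix p z assume p: "p \<in> carrier ?P" and z: "z \<in> N"
    have "p \<otimes>\<^bsub>?P\<^esub> z \<otimes>\<^bsub>?P\<^esub> inv\<^bsub>?P\<^esub> p = z"
      using P.commutes_iff_conj[of p z] N_center[OF z p] p z NP by auto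
    then show "p \<otimes>\<^bsub>?P\<^esub> z \<otimes>\<^bsub>?P\<^esub> inv\<^bsub>?P\<^esub> p \<in> N" using z by simp
  qed
  then interpret N: normal N ?P .
  have "card (rcosets\<^bsub>?P\<^esub> N) * card N = order ?P" by (rule P.lagrange[OF sub])
  then show "card (carrier D8_central_C4) = 16"
    by (simp add: Q FactGroup_def order_def N_def car card_cartesian_product carrier_integer_mod_group)
  interpret Q: group "?P Mod N" by (rule N.factorgroup_is_group)
  define h where "h p = N #>\<^bsub>?P\<^esub> p" for p
  interpret h: group_hom ?P "?P Mod N" h
    using N.r_coset_hom_Mod
    by (simp add: group_hom_def group_hom_axioms_def P.is_group Q.is_group h_def[abs_def])
  let ?a = "((1, 0), 0)" and ?b = "((0, 1), 0)" and ?c = "(\<one>\<^bsub>?D\<^esub>, 1)"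
  note gens = semidirect_inversion_generators[of 4 2, folded dihedral_group_def, simplified]
  have r: "(1, 0) \<in> carrier ?D" "(0, 1) \<in> carrier ?D" "(1, 0) [^]\<^bsub>?D\<^esub> (4::nat) = \<one>\<^bsub>?D\<^esub>"
    "(0, 1) [^]\<^bsub>?D\<^esub> (2::nat) = \<one>\<^bsub>?D\<^esub>"
    "(0, 1) \<otimes>\<^bsub>?D\<^esub> (1, 0) \<otimes>\<^bsub>?D\<^esub> inv\<^bsub>?D\<^esub> (0, 1) = (1, 0) [^]\<^bsub>?D\<^esub> (3::nat)"
    using gens(1) by (simp_all add: D.satisfies_metacyclic)
  have abc: "?a \<in> carrier ?P" "?b \<in> carrier ?P" "?c \<in> carrier ?P"
    using r by (simp_all add: carrier_integer_mod_group)
  have "generate ?P {?a, ?b, ?c} = carrier ?P"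
    by (rule generate_DirProd_cyclic[OF D gens(2) r(1,2)]) simp
  then have "generate (?P Mod N) (h ` {?a, ?b, ?c}) = h ` carrier ?P"
    using h.generate_img[of "{?a, ?b, ?c}"] abc by simp
  moreover have "h ` carrier ?P = carrier (?P Mod N)" by (simp add: carrier_FactGroup h_def)
  ultimately have gen: "generate (?P Mod N) {h ?a, h ?b, h ?c} = carrier (?P Mod N)" by simp
  have "?c [^]\<^bsub>?P\<^esub> (2::nat) = ((2, 0), 2) \<otimes>\<^bsub>?P\<^esub> (?a [^]\<^bsub>?P\<^esub> (2::nat))"
    by (simp add: DirProd_pow numeral_2_eq_2 one mult)
  moreover have "h ((2, 0), 2) = \<one>\<^bsub>?P Mod N\<^esub>"
    unfolding h_def one_FactGroup by (rule P.coset_join2[OF _ sub]) (use NP in \<open>simp_all add: N_def\<close>)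
  moreover have "((2, 0), 2) \<in> carrier ?P" using NP by (simp add: N_def)
  ultimately have "h (?c [^]\<^bsub>?P\<^esub> (2::nat)) = \<one>\<^bsub>?P Mod N\<^esub> \<otimes>\<^bsub>?P Mod N\<^esub> h (?a [^]\<^bsub>?P\<^esub> (2::nat))"
    using abc(1) h.hom_mult[of "((2, 0), 2)" "?a [^]\<^bsub>?P\<^esub> (2::nat)"] P.nat_pow_closed by presburger
  also have "\<dots> = h (?a [^]\<^bsub>?P\<^esub> (2::nat))"
    by (rule Q.l_one[OF h.hom_closed[OF P.nat_pow_closed[OF abc(1)]]])
  also have "\<dots> = h ?a [^]\<^bsub>?P Mod N\<^esub> (2::nat)" by (rule h.hom_nat_pow[OF abc(1)])
  finally have c2: "h ?c [^]\<^bsub>?P Mod N\<^esub> (2::nat) = h ?a [^]\<^bsub>?P Mod N\<^esub> (2::nat)"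
    by (rule trans[OF h.hom_nat_pow[OF abc(3), symmetric]])
  have P_rel: "?a [^]\<^bsub>?P\<^esub> (4::nat) = \<one>\<^bsub>?P\<^esub>" "?b [^]\<^bsub>?P\<^esub> (2::nat) = \<one>\<^bsub>?P\<^esub>"
    "?b \<otimes>\<^bsub>?P\<^esub> ?a \<otimes>\<^bsub>?P\<^esub> inv\<^bsub>?P\<^esub> ?b = ?a [^]\<^bsub>?P\<^esub> (3::nat)"
    "?c \<otimes>\<^bsub>?P\<^esub> ?a = ?a \<otimes>\<^bsub>?P\<^esub> ?c" "?c \<otimes>\<^bsub>?P\<^esub> ?b = ?b \<otimes>\<^bsub>?P\<^esub> ?c"
    using r by (simp_all add: DirProd_pow inv_DirProd)
  have "satisfies (?P Mod N) (case_three_gens (h ?a) (h ?b) (h ?c)) (dihedral_type_relations 0 2)"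
    by (rule h.satisfies_dihedral_type_image[OF abc P_rel c2])
  then have "presented_by (?P Mod N) (dihedral_type_relations 0 2)"
    using gen by (rule Q.presented_by_three_gensI)
  then show "presented_by D8_central_C4 (dihedral_type_relations 0 2)" by (simp add: Q)
qed

section \<open>The affine group over the field with five elements\<close>

lemma affine_mod:
  fixes u v w x m :: int
  shows "(u mod m * x + w mod m) mod m = (u * x + w) mod m" "(u * (v mod m) + w) mod m = (u * v + w) mod m"
proof -
  have "(u mod m * x + w mod m) mod m = ((u mod m * x) mod m + w) mod m" by (simp add: mod_add_right_eq mod_add_left_eq)
  also have "\<dots> = (u * x + w) mod m" by (simp only: mod_mult_left_eq mod_add_left_eq)
  finally show "(u mod m * x + w mod m) mod m = (u * x + w) mod m" .
  have "(u * (v mod m) + w) mod m = ((u * (v mod m)) mod m + w) mod m" by (simp only: mod_add_left_eq)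
  also have "\<dots> = (u * v + w) mod m" by (simp only: mod_mult_right_eq mod_add_left_eq)
  finally show "(u * (v mod m) + w) mod m = (u * v + w) mod m" .
qed

text \<open>Restricted to \<open>{0..4}\<close>, because the elements of the group of bijections of a set are
  extensional functions.\<close>

definition affine_map :: "int \<Rightarrow> int \<Rightarrow> int \<Rightarrow> int" where
  "affine_map a b = (\<lambda>t \<in> {0..4}. (a * t + b) mod 5)"

lemma affine_map_Bij:
  assumes "a \<in> {1..4}" shows "affine_map a b \<in> Bij {0..4}"
proof -
  have "inj_on (\<lambda>t. (a * t + b) mod 5) {0..4}"
  proof (rule inj_onI)
    fix t u :: int assume tu: "t \<in> {0..4}" "u \<in> {0..4}" "(a * t + b) mod 5 = (a * u + b) mod 5"
    then have "5 dvd a * (t - u)" by (simp add: mod_eq_dvd_iff algebra_simps)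
    moreover have "coprime 5 a"
    proof -
      have "a = 1 \<or> a = 2 \<or> a = 3 \<or> a = 4" using assms by auto
      then show ?thesis by (elim disjE) (simp_all add: coprime_iff_gcd_eq_1 gcd_non_0_int)
    qed
    ultimately have "5 dvd t - u" by (simp add: coprime_dvd_mult_right_iff)
    then obtain k where "t - u = 5 * k" by (elim dvdE)
    then show "t = u" using tu(1,2) by simp presburger
  qed
  moreover have "(\<lambda>t. (a * t + b) mod 5) ` {0..4} \<subseteq> {0..4}" by auto
  ultimately have "bij_betw (\<lambda>t. (a * t + b) mod 5) {0..4} {0..4}"
    using endo_inj_surj[of "{0..4::int}"] by (simp add: bij_betw_def)
  then have "bij_betw (affine_map a b) {0..4} {0..4}"
    unfolding affine_map_def by (subst bij_betw_restrict_eq)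
  then show ?thesis by (simp add: Bij_def affine_map_def)
qed

lemma carrier_GA_1_5: "carrier GA_1_5 = (\<lambda>(a, b). affine_map a b) ` ({1..4} \<times> {0..4})"
proof -
  interpret residues_prime 5 "residue_ring (int 5)" by unfold_locales simp
  have U: "Units (residue_ring 5) = {1..4}" using res_prime_units_eq by simp
  have car: "carrier (residue_ring 5) = {0..4}" by (simp add: residue_ring_def)
  have "(\<lambda>t \<in> carrier (residue_ring 5). a \<otimes>\<^bsub>residue_ring 5\<^esub> t \<oplus>\<^bsub>residue_ring 5\<^esub> b) = affine_map a b" for a b
    unfolding affine_map_def car by (simp add: residue_ring_def mod_add_left_eq)
  then have "carrier GA_1_5 = {affine_map a b | a b. a \<in> {1..4} \<and> b \<in> {0..4}}"
    unfolding GA_1_5_def affine_group_def by (simp add: U car)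
  also have "\<dots> = (\<lambda>(a, b). affine_map a b) ` ({1..4} \<times> {0..4})"
    unfolding image_def by (simp del: atLeastAtMost_iff) blast
  finally show ?thesis .
qed

lemma affine_map_closed: "\<lbrakk>a \<in> {1..4}; b \<in> {0..4}\<rbrakk> \<Longrightarrow> affine_map a b \<in> carrier GA_1_5"
  unfolding carrier_GA_1_5 by (rule image_eqI[of _ _ "(a, b)"]) simp_all

lemma mod_5_closed: "b mod 5 \<in> {0..4::int}"
  using pos_mod_bound[of 5 b] pos_mod_sign[of 5 b] by simp

lemma mult_GA_1_5:
  assumes "a \<in> {1..4}" "c \<in> {1..4}"
  shows "affine_map a b \<otimes>\<^bsub>GA_1_5\<^esub> affine_map c d = affine_map (a * c mod 5) ((a * d + b) mod 5)"
proof -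
  have car: "carrier (residue_ring 5) = {0..4}" by (simp add: residue_ring_def)
  have "affine_map a b \<otimes>\<^bsub>GA_1_5\<^esub> affine_map c d = compose {0..4} (affine_map a b) (affine_map c d)"
    using affine_map_Bij[OF assms(1), of b] affine_map_Bij[OF assms(2), of d]
    by (simp add: GA_1_5_def affine_group_def BijGroup_def car)
  also have "\<dots> = affine_map (a * c mod 5) ((a * d + b) mod 5)"
  proof
    fix t
    have "(a * ((c * t + d) mod 5) + b) mod 5 = (a * (c * t + d) + b) mod 5"
      by (rule affine_mod)
    moreover have "(a * c mod 5 * t + (a * d + b) mod 5) mod 5 = (a * c * t + (a * d + b)) mod 5"
      by (rule affine_mod)
    moreover have "a * (c * t + d) + b = a * c * t + (a * d + b)" by (simp add: algebra_simps)
    ultimately have "(a * ((c * t + d) mod 5) + b) mod 5 = (a * c mod 5 * t + (a * d + b) mod 5) mod 5"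
      by (simp only:)
    moreover have mem: "(c * t + d) mod 5 \<in> {0..4}"
      using pos_mod_bound[of 5 "c * t + d"] pos_mod_sign[of 5 "c * t + d"] by simp
    ultimately show "compose {0..4} (affine_map a b) (affine_map c d) t =
        affine_map (a * c mod 5) ((a * d + b) mod 5) t"
      by (cases "t \<in> {0..4}")
        (simp_all only: compose_def affine_map_def restrict_apply if_True if_False)
  qed
  finally show ?thesis .
qed

lemma units_5_mult: "\<lbrakk>a \<in> {1..4}; c \<in> {1..4}\<rbrakk> \<Longrightarrow> a * c mod 5 \<in> {1..4::int}"
proof -
  assume "a \<in> {1..4}" "c \<in> {1..4}"
  then have "a = 1 \<or> a = 2 \<or> a = 3 \<or> a = 4" "c = 1 \<or> c = 2 \<or> c = 3 \<or> c = 4" by auto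
  then show ?thesis by (elim disjE) simp_all
qed

lemma inj_affine_map: "inj_on (\<lambda>(a, b). affine_map a b) ({1..4} \<times> {0..4})"
proof (rule inj_onI, clarify)
  fix a b c d :: int
  assume r: "a \<in> {1..4}" "b \<in> {0..4}" "c \<in> {1..4}" "d \<in> {0..4}" and eq: "affine_map a b = affine_map c d"
  have "b = d" using fun_cong[OF eq, of 0] r by (simp add: affine_map_def)
  moreover have "(a + b) mod 5 = (c + d) mod 5" using fun_cong[OF eq, of 1] by (simp add: affine_map_def)
  ultimately have "5 dvd a - c" by (simp add: mod_eq_dvd_iff)
  then obtain k where "a - c = 5 * k" by (elim dvdE)
  then have "a = c" using r by simp presburger
  then show "a = c \<and> b = d" using \<open>b = d\<close> by simp
qed

lemma one_GA_1_5: "\<one>\<^bsub>GA_1_5\<^esub> = affine_map 1 0"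
proof -
  have car: "carrier (residue_ring 5) = {0..4}" by (simp add: residue_ring_def)
  show ?thesis
    by (auto simp: GA_1_5_def affine_group_def BijGroup_def car affine_map_def intro!: restrict_ext)
qed

lemma group_GA_1_5: "group GA_1_5"
proof (rule groupI)
  fix x y z assume "x \<in> carrier GA_1_5" "y \<in> carrier GA_1_5" "z \<in> carrier GA_1_5"
  then obtain a b c d e f where xyz: "x = affine_map a b" "y = affine_map c d" "z = affine_map e f"
    and u: "a \<in> {1..4}" "c \<in> {1..4}" "e \<in> {1..4}" by (auto simp: carrier_GA_1_5)
  have "a * c mod 5 * e mod 5 = a * (c * e mod 5) mod 5"
    by (simp add: mod_mult_left_eq mod_mult_right_eq mult.assoc)
  moreover have "(a * c mod 5 * f + (a * d + b) mod 5) mod 5 = (a * ((c * f + d) mod 5) + b) mod 5"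
  proof -
    have "(a * c mod 5 * f + (a * d + b) mod 5) mod 5 = (a * c * f + (a * d + b)) mod 5"
      by (rule affine_mod)
    also have "\<dots> = (a * (c * f + d) + b) mod 5" by (simp add: algebra_simps)
    also have "\<dots> = (a * ((c * f + d) mod 5) + b) mod 5" by (rule affine_mod(2)[symmetric])
    finally show ?thesis .
  qed
  ultimately show "x \<otimes>\<^bsub>GA_1_5\<^esub> y \<otimes>\<^bsub>GA_1_5\<^esub> z = x \<otimes>\<^bsub>GA_1_5\<^esub> (y \<otimes>\<^bsub>GA_1_5\<^esub> z)"
    unfolding xyz mult_GA_1_5[OF u(1,2)] mult_GA_1_5[OF units_5_mult[OF u(1,2)] u(3)]
      mult_GA_1_5[OF u(2,3)] mult_GA_1_5[OF u(1) units_5_mult[OF u(2,3)]]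
    by (simp only:)
next
  fix x y assume "x \<in> carrier GA_1_5" "y \<in> carrier GA_1_5"
  then obtain a b c d where xy: "x = affine_map a b" "y = affine_map c d"
    and u: "a \<in> {1..4}" "c \<in> {1..4}" by (auto simp: carrier_GA_1_5)
  then have "x \<otimes>\<^bsub>GA_1_5\<^esub> y = affine_map (a * c mod 5) ((a * d + b) mod 5)" by (simp add: mult_GA_1_5)
  then show "x \<otimes>\<^bsub>GA_1_5\<^esub> y \<in> carrier GA_1_5"
    using affine_map_closed[OF units_5_mult[OF u] mod_5_closed] by simp
next
  fix x assume "x \<in> carrier GA_1_5"
  then obtain a b where x: "x = affine_map a b" and ab: "a \<in> {1..4}" "b \<in> {0..4}" by (auto simp: carrier_GA_1_5)
  show "\<one>\<^bsub>GA_1_5\<^esub> \<otimes>\<^bsub>GA_1_5\<^esub> x = x" using ab by (simp add: x one_GA_1_5 mult_GA_1_5)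
  have "a = 1 \<or> a = 2 \<or> a = 3 \<or> a = 4" using ab by auto
  then obtain c where c: "c \<in> {1..4}" "c * a mod 5 = 1"
    by (elim disjE) (force intro: that[of 1] that[of 3] that[of 2] that[of 4])+
  let ?y = "affine_map c ((- (c * b)) mod 5)"
  have "?y \<otimes>\<^bsub>GA_1_5\<^esub> x = \<one>\<^bsub>GA_1_5\<^esub>"
    using c ab by (simp add: x one_GA_1_5 mult_GA_1_5 mod_add_right_eq)
  moreover have "?y \<in> carrier GA_1_5" by (rule affine_map_closed[OF c(1) mod_5_closed])
  ultimately show "\<exists>y \<in> carrier GA_1_5. y \<otimes>\<^bsub>GA_1_5\<^esub> x = \<one>\<^bsub>GA_1_5\<^esub>" by blast
qed (simp add: one_GA_1_5 affine_map_closed)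

text \<open>The generators are the translation by 1 and the multiplication by 2, as 2 generates the
  units modulo 5.\<close>

lemma GA_1_5_presented:
  "presented_by GA_1_5 (metacyclic_relations 5 4 2 0)" "card (carrier GA_1_5) = 20"
proof -
  interpret group GA_1_5 by (rule group_GA_1_5)
  show "card (carrier GA_1_5) = 20"
    unfolding carrier_GA_1_5 by (subst card_image[OF inj_affine_map]) (simp add: card_cartesian_product)
  let ?x = "affine_map 1 1" and ?y = "affine_map 2 0"
  have xy: "?x \<in> carrier GA_1_5" "?y \<in> carrier GA_1_5" by (simp_all add: affine_map_closed)
  have px: "?x [^]\<^bsub>GA_1_5\<^esub> j = affine_map 1 (int j mod 5)" for j :: nat
    by (induction j) (simp_all add: one_GA_1_5 mult_GA_1_5 mod_add_right_eq add.commute)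
  have py: "?y [^]\<^bsub>GA_1_5\<^esub> (2::nat) = affine_map 4 0" "?y [^]\<^bsub>GA_1_5\<^esub> (3::nat) = affine_map 3 0"
    "?y [^]\<^bsub>GA_1_5\<^esub> (4::nat) = affine_map 1 0"
    by (simp_all add: numeral_eq_Suc one_GA_1_5 mult_GA_1_5)
  have "?y \<otimes>\<^bsub>GA_1_5\<^esub> ?x = ?x [^]\<^bsub>GA_1_5\<^esub> (2::nat) \<otimes>\<^bsub>GA_1_5\<^esub> ?y"
    unfolding px by (simp add: mult_GA_1_5)
  then have conj: "?y \<otimes>\<^bsub>GA_1_5\<^esub> ?x \<otimes>\<^bsub>GA_1_5\<^esub> inv\<^bsub>GA_1_5\<^esub> ?y = ?x [^]\<^bsub>GA_1_5\<^esub> (2::nat)"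
    using xy by (simp add: inv_solve_right')
  have "generate GA_1_5 {?x, ?y} = carrier GA_1_5"
  proof
    let ?H = "generate GA_1_5 {?x, ?y}"
    show "?H \<subseteq> carrier GA_1_5" using xy by (intro generate_incl) simp
    have pow: "?x [^]\<^bsub>GA_1_5\<^esub> j \<in> ?H" "?y [^]\<^bsub>GA_1_5\<^esub> j \<in> ?H" for j :: nat
      using xy by (auto intro!: pow_in_generate)
    have scale: "affine_map a 0 \<in> ?H" if "a \<in> {1..4}" for a
    proof -
      have "a = 1 \<or> a = 2 \<or> a = 3 \<or> a = 4" using that by auto
      then show ?thesis
        using pow(2)[of 2] pow(2)[of 3] pow(2)[of 4] unfolding py
        by (elim disjE) (simp_all add: generate.incl)
    qed
    show "carrier GA_1_5 \<subseteq> ?H"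
    proof
      fix g assume "g \<in> carrier GA_1_5"
      then obtain a b where g: "g = affine_map a b" "a \<in> {1..4}" "b \<in> {0..4}" by (auto simp: carrier_GA_1_5)
      then have "g = ?x [^]\<^bsub>GA_1_5\<^esub> nat b \<otimes>\<^bsub>GA_1_5\<^esub> affine_map a 0"
        unfolding px by (simp add: mult_GA_1_5)
      then show "g \<in> ?H" using generate.eng[OF pow(1) scale[OF g(2)]] by simp
    qed
  qed
  then show "presented_by GA_1_5 (metacyclic_relations 5 4 2 0)"
    using xy conj px[of 5] py(3)
    by (intro presented_by_two_gensI) (simp_all add: satisfies_metacyclic one_GA_1_5)
qed

section \<open>Centralizers in the alternating group of degree five\<close>

text \<open>Since \<open>c\<close> commutes with \<open>x\<close> and fixes \<open>p\<close>, it also fixes \<open>q = x p\<close>. So \<open>c\<close> permutes the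
  other three points, and as it is even it would be a 3-cycle on them. Then \<open>x\<close> preserves the set
  \<open>{p, q}\<close> of fixed points of \<open>c\<close>, exchanging them, and acts on the other three points as a power
  of \<open>c\<close>. That makes \<open>x\<close> odd.\<close>

lemma commuting_even_perm_fixing_moved_point:
  fixes x c :: "nat \<Rightarrow> nat"
  assumes x: "x permutes {1..5}" "evenperm x" and c: "c permutes {1..5}" "evenperm c"
    and comm: "x \<circ> c = c \<circ> x" and p: "x p \<noteq> p" "c p = p"
  shows "c = id"
proof (rule ccontr)
  assume "c \<noteq> id"
  then obtain r where r: "c r \<noteq> r" by (auto simp: fun_eq_iff)
  have xc: "x (c i) = c (x i)" for i using fun_cong[OF comm, of i] by simp
  have injc: "c i = c j \<longleftrightarrow> i = j" for i j using permutes_inj[OF c(1)] by (auto dest: injD)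
  have injx: "x i = x j \<longleftrightarrow> i = j" for i j using permutes_inj[OF x(1)] by (auto dest: injD)
  have perm: "permutation x" "permutation c" using x(1) c(1) permutation_permutes by auto
  define q where "q = x p"
  define s where "s = c r"
  define t where "t = c s"
  have cq: "c q = q" using xc[of p] p(2) by (simp add: q_def)
  have in5: "i \<in> {1..5}" if "c i \<noteq> i \<or> x i \<noteq> i" for i
    using that permutes_not_in[OF c(1)] permutes_not_in[OF x(1)] by blast
  have ne: "p \<noteq> q" "r \<noteq> p" "r \<noteq> q" "s \<noteq> r" "s \<noteq> p" "s \<noteq> q" "t \<noteq> s" "t \<noteq> p" "t \<noteq> q"
    using p r cq injc[of r p] injc[of r q] injc[of s p] injc[of s q] injc[of s r]
    by (auto simp: q_def s_def t_def)
  have xq: "x q \<noteq> q" using p(1) injx[of q p] by (simp add: q_def)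
  have mem: "p \<in> {1..5}" "q \<in> {1..5}" "r \<in> {1..5}" "s \<in> {1..5}" "t \<in> {1..5}"
    using in5 p(1) xq r ne(4) injc[of s r] injc[of t s] ne(7) by (auto simp: s_def t_def)
  show False
  proof (cases "t = r")
    case True
    have "c i = transpose r s i" for i
    proof (cases "i \<in> {p, q, r, s}")
      case False
      show ?thesis
      proof (cases "i \<in> {1..5}")
        case i5: True
        have "{p, q, r, s, i} \<subseteq> {1..5}" "card {p, q, r, s, i} = 5" using mem i5 False ne by auto
        then have "{p, q, r, s, i} = {1..5}" by (intro card_subset_eq) simp_all
        moreover have "c i \<in> {1..5}" using i5 permutes_in_image[OF c(1)] by simp
        ultimately have "c i \<in> {p, q, r, s, i}" by simp
        moreover have "c i \<noteq> p" "c i \<noteq> q" using injc[of i p] injc[of i q] p(2) cq False by auto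
        moreover have "c i \<noteq> s" using injc[of i r] False by (simp add: s_def)
        moreover have "c i \<noteq> r" using injc[of i s] False True by (simp add: t_def)
        ultimately have "c i = i" by blast
        then show ?thesis using False by (simp add: transpose_def)
      next
        case i5: False
        then have "i \<noteq> r" "i \<noteq> s" using mem by auto
        then show ?thesis using permutes_not_in[OF c(1) i5] by (simp add: transpose_def)
      qed
    qed (use p(2) cq ne True in \<open>auto simp: transpose_def s_def t_def\<close>)
    then have "c = transpose r s" by (simp add: fun_eq_iff)
    then show False using c(2) ne(4) evenperm_swap[of r s] by simp
  next
    case False
    have "{p, q, r, s, t} \<subseteq> {1..5}" "card {p, q, r, s, t} = 5" using mem False ne by auto
    then have all: "{p, q, r, s, t} = {1..5}" by (intro card_subset_eq) simp_all
    have "c t \<in> {p, q, r, s, t}" using mem(5) permutes_in_image[OF c(1)] unfolding all by simp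
    moreover have "c t \<noteq> p" "c t \<noteq> q" using injc[of t p] injc[of t q] p(2) cq ne by auto
    moreover have "c t \<noteq> s" "c t \<noteq> t" using injc[of t r] injc[of t s] False ne by (simp_all add: s_def t_def)
    ultimately have ct: "c t = r" by blast
    have cr: "c r = s" "c s = t" by (simp_all add: s_def t_def)
    have xr: "x r \<in> {p, q, r, s, t}" using mem(3) permutes_in_image[OF x(1)] unfolding all by simp
    have "c (x r) \<noteq> x r" using xc[of r] injx[of s r] ne(4) by (simp add: cr)
    then have xr: "x r = r \<or> x r = s \<or> x r = t" using xr p(2) cq by auto
    have xs: "x s = c (x r)" "x t = c (c (x r))" using xc[of r] xc[of s] by (simp_all add: cr)
    have xp: "x p = q" by (simp add: q_def)
    have "x q \<in> {p, q, r, s, t}" using mem(2) permutes_in_image[OF x(1)] unfolding all by simp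
    moreover have "x q \<notin> {r, s, t}"
    proof
      assume "x q \<in> {r, s, t}"
      then have "c (x q) \<noteq> x q" using cr ct ne False by auto
      then show False using xc[of q] cq by simp
    qed
    ultimately have xq': "x q = p" using xq by blast
    \<comment> \<open>Multiply \<open>x\<close> by the power of \<open>c\<close> that cancels its action on \<open>{r, s, t}\<close>; a transposition
      remains.\<close>
    define y where "y = (if x r = r then x else if x r = s then x \<circ> (c \<circ> c) else x \<circ> c)"
    have "y p = q \<and> y q = p \<and> y r = r \<and> y s = s \<and> y t = t"
      using xr
    proof (elim disjE)
      assume 1: "x r = r"
      then have "x s = s" "x t = t" using xs by (simp_all add: cr)
      then show ?thesis using 1 xp xq' by (simp add: y_def)
    next
      assume 1: "x r = s"
      then have "x s = t" "x t = r" using xs by (simp_all add: cr ct)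
      then show ?thesis using 1 xp xq' ne(4) p(2) cq by (simp add: y_def cr ct)
    next
      assume 1: "x r = t"
      then have "x s = r" "x t = s" using xs by (simp_all add: cr ct)
      then show ?thesis using 1 xp xq' False ne(7) p(2) cq by (simp add: y_def cr ct)
    qed
    then have y: "y p = q" "y q = p" "y r = r" "y s = s" "y t = t" by simp_all
    have "y i = transpose p q i" for i
    proof (cases "i \<in> {p, q, r, s, t}")
      case True
      then consider "i = p" | "i = q" | "i = r" | "i = s" | "i = t" by blast
      then show ?thesis by cases (use y ne in \<open>simp_all add: transpose_def\<close>)
    next
      case out: False
      then have "i \<notin> {1..5}" unfolding all by simp
      then have "c i = i" "x i = i" using permutes_not_in[OF c(1)] permutes_not_in[OF x(1)] by blast+
      then show ?thesis using out by (simp add: y_def transpose_def)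
    qed
    then have "y = transpose p q" by (simp add: fun_eq_iff)
    moreover have "evenperm y"
      using perm x(2) c(2) by (simp add: y_def evenperm_comp permutation_compose)
    ultimately show False using ne(1) evenperm_swap[of p q] by simp
  qed
qed

text \<open>By the previous lemma, an element of the centralizer is determined by the image of a single
  point that \<open>x\<close> moves.\<close>

lemma alt_group_5_centralizer:
  assumes "x \<in> carrier (alt_group 5)" "x \<noteq> \<one>\<^bsub>alt_group 5\<^esub>"
  shows "card (centralizer (alt_group 5) x) \<le> 5"
proof -
  have x: "x permutes {1..5}" "evenperm x" "x \<noteq> id"
    using assms by (auto simp: alt_group_carrier alt_group_one)
  then obtain p where p: "x p \<noteq> p" by (auto simp: fun_eq_iff)
  have p5: "p \<in> {1..5}" using p permutes_not_in[OF x(1)] by blast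
  have c: "c permutes {1..5} \<and> evenperm c \<and> x \<circ> c = c \<circ> x" if "c \<in> centralizer (alt_group 5) x" for c
    using that by (auto simp: centralizer_def alt_group_carrier alt_group_mult)
  have "inj_on (\<lambda>c. c p) (centralizer (alt_group 5) x)"
  proof (rule inj_onI)
    fix c d assume cd: "c \<in> centralizer (alt_group 5) x" "d \<in> centralizer (alt_group 5) x" "c p = d p"
    note c = c[OF cd(1)] and d = c[OF cd(2)]
    let ?e = "inv' d \<circ> c"
    have bij: "d \<circ> inv' d = id" "inv' d \<circ> d = id" using d permutes_inv_o by blast+
    have "?e = id"
    proof (rule commuting_even_perm_fixing_moved_point[OF x(1,2)])
      show "?e permutes {1..5}" using c d permutes_compose permutes_inv by blast
      have "permutation c" "permutation d" using c d permutation_permutes by blast+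
      then show "evenperm ?e"
        using c d by (simp add: evenperm_comp permutation_inverse evenperm_inv)
      have "x \<circ> inv' d = inv' d \<circ> d \<circ> x \<circ> inv' d" using bij by simp
      also have "\<dots> = inv' d \<circ> (x \<circ> d) \<circ> inv' d" using d by (simp add: comp_assoc)
      also have "\<dots> = inv' d \<circ> x" using bij by (simp add: comp_assoc)
      finally have "x \<circ> ?e = inv' d \<circ> x \<circ> c" by (simp add: comp_assoc[symmetric])
      then show "x \<circ> ?e = ?e \<circ> x" using c by (simp add: comp_assoc)
      show "?e p = p" using cd(3) fun_cong[OF bij(2), of p] by simp
    qed (rule p)
    then have "d \<circ> ?e = d" by simp
    then show "c = d" using bij by (simp add: comp_assoc[symmetric])
  qed
  moreover have "(\<lambda>c. c p) ` centralizer (alt_group 5) x \<subseteq> {1..5}"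
  proof
    fix i assume "i \<in> (\<lambda>c. c p) ` centralizer (alt_group 5) x"
    then obtain d where d: "d \<in> centralizer (alt_group 5) x" "i = d p" by blast
    then have "d permutes {1..5}" using c by blast
    then show "i \<in> {1..5}" using permutes_in_image[of d "{1..5}" p] p5 d(2) by simp
  qed
  ultimately have "card (centralizer (alt_group 5) x) \<le> card {1..5::nat}"
    by (rule card_inj_on_le) simp
  then show ?thesis by simp
qed

section \<open>The group SL(2,3)\<close>

type_synonym int_matrix_2 = "(int \<times> int) \<times> (int \<times> int)"

text \<open>With explicit arithmetic modulo 3 in place of the residue ring, the facts that concern all
  24 matrices can be verified by enumeration.\<close>

definition mult_mod_3 :: "int_matrix_2 \<Rightarrow> int_matrix_2 \<Rightarrow> int_matrix_2" where
  "mult_mod_3 = (\<lambda>((a, b), (c, d)) ((a', b'), (c', d')).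
     (((a * a' + b * c') mod 3, (a * b' + b * d') mod 3),
      ((c * a' + d * c') mod 3, (c * b' + d * d') mod 3)))"

definition det_mod_3 :: "int_matrix_2 \<Rightarrow> int" where
  "det_mod_3 = (\<lambda>((a, b), (c, d)). (a * d - b * c) mod 3)"

definition matrices_mod_3 :: "int_matrix_2 list" where
  "matrices_mod_3 = (let rows = List.product [0, 1, 2] [0, 1, 2] in List.product rows rows)"

definition SL_2_3_list :: "int_matrix_2 list" where
  "SL_2_3_list = filter (\<lambda>A. det_mod_3 A = 1) matrices_mod_3"

definition inverse_mod_3 :: "int_matrix_2 \<Rightarrow> int_matrix_2" where
  "inverse_mod_3 = (\<lambda>((a, b), (c, d)). ((d, (- b) mod 3), ((- c) mod 3, a)))"

abbreviation id_matrix :: int_matrix_2 where "id_matrix \<equiv> ((1, 0), (0, 1))"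

lemma set_matrices_mod_3:
  "((a, b), (c, d)) \<in> set matrices_mod_3 \<longleftrightarrow> a \<in> {0..2} \<and> b \<in> {0..2} \<and> c \<in> {0..2} \<and> d \<in> {0..2}"
proof -
  have "x \<in> set [0, 1, 2] \<longleftrightarrow> x \<in> {0..2}" for x :: int by auto
  then show ?thesis
    unfolding matrices_mod_3_def Let_def set_product mem_Times_iff fst_conv snd_conv by (simp only: conj_assoc)
qed

lemma carrier_SL_2_3: "carrier SL_2_3 = set SL_2_3_list"
proof -
  have "residues 3" by (simp add: residues_def)
  then have neg: "\<ominus>\<^bsub>residue_ring 3\<^esub> x = (- x) mod 3" for x by (rule residues.res_neg_eq)
  have det: "((a * d) mod 3 + (- ((b * c) mod 3)) mod 3) mod 3 = det_mod_3 ((a, b), (c, d))" for a b c d :: int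
  proof -
    have "((a * d) mod 3 + (- ((b * c) mod 3)) mod 3) mod 3 = (a * d + - ((b * c) mod 3)) mod 3"
      by (rule mod_add_eq)
    also have "\<dots> = (a * d - b * c) mod 3" by (simp add: mod_diff_right_eq)
    finally show ?thesis by (simp add: det_mod_3_def)
  qed
  have "A \<in> carrier SL_2_3 \<longleftrightarrow> A \<in> set SL_2_3_list" for A
  proof -
    obtain a b c d where A: "A = ((a, b), (c, d))" by (metis surj_pair)
    have "A \<in> carrier SL_2_3 \<longleftrightarrow> a \<in> {0..2} \<and> b \<in> {0..2} \<and> c \<in> {0..2} \<and> d \<in> {0..2} \<and>
        ((a * d) mod 3 + (- ((b * c) mod 3)) mod 3) mod 3 = 1"
      by (simp add: A SL_2_3_def special_linear_group_2_def a_minus_def neg) (simp add: residue_ring_def)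
    then show ?thesis
      unfolding det by (simp add: A SL_2_3_list_def set_matrices_mod_3 del: atLeastAtMost_iff)
  qed
  then show ?thesis by blast
qed

lemma mult_SL_2_3: "A \<otimes>\<^bsub>SL_2_3\<^esub> B = mult_mod_3 A B"
  by (simp add: SL_2_3_def special_linear_group_2_def residue_ring_def mult_mod_3_def mod_add_eq split: prod.split)

lemma one_SL_2_3: "\<one>\<^bsub>SL_2_3\<^esub> = id_matrix"
  by (simp add: SL_2_3_def special_linear_group_2_def residue_ring_def)

lemma SL_2_3_list_closed: "list_all (\<lambda>A. list_all (\<lambda>B. det_mod_3 (mult_mod_3 A B) = 1) SL_2_3_list) SL_2_3_list"
  by code_simp

lemma SL_2_3_list_inverse:
  "list_all (\<lambda>A. det_mod_3 (inverse_mod_3 A) = 1 \<and> mult_mod_3 (inverse_mod_3 A) A = id_matrix \<and>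
    mult_mod_3 id_matrix A = A \<and> inverse_mod_3 A \<in> set matrices_mod_3) SL_2_3_list"
  by code_simp

lemma SL_2_3_list_centralizers:
  "list_all (\<lambda>A. A = id_matrix \<or> A = ((2, 0), (0, 2)) \<or>
    length (filter (\<lambda>B. mult_mod_3 A B = mult_mod_3 B A) SL_2_3_list) \<le> 6) SL_2_3_list"
  by code_simp

lemma mult_mod_3_range: "mult_mod_3 A B \<in> set matrices_mod_3"
proof -
  obtain a b c d a' b' c' d' where "A = ((a, b), (c, d))" "B = ((a', b'), (c', d'))" by (metis surj_pair)
  moreover have "x mod 3 \<in> {0..2}" for x :: int using pos_mod_bound[of 3 x] pos_mod_sign[of 3 x] by simp
  ultimately show ?thesis by (simp add: mult_mod_3_def set_matrices_mod_3 del: atLeastAtMost_iff)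
qed

lemma bilinear_mod:
  fixes u v x y m :: int
  shows "(u mod m * x + v mod m * y) mod m = (u * x + v * y) mod m"
    "(x * (u mod m) + y * (v mod m)) mod m = (x * u + y * v) mod m"
proof -
  have "(u mod m * x + v mod m * y) mod m = ((u mod m * x) mod m + (v mod m * y) mod m) mod m"
    by (simp only: mod_add_eq)
  also have "\<dots> = (u * x + v * y) mod m" by (simp only: mod_mult_left_eq mod_add_eq)
  finally show "(u mod m * x + v mod m * y) mod m = (u * x + v * y) mod m" .
  then show "(x * (u mod m) + y * (v mod m)) mod m = (x * u + y * v) mod m"
    by (simp only: mult.commute)
qed

lemma group_SL_2_3: "group SL_2_3"
proof (rule groupI)
  fix A B assume "A \<in> carrier SL_2_3" "B \<in> carrier SL_2_3"
  then have "det_mod_3 (mult_mod_3 A B) = 1"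
    using SL_2_3_list_closed unfolding carrier_SL_2_3 list_all_iff by blast
  then show "A \<otimes>\<^bsub>SL_2_3\<^esub> B \<in> carrier SL_2_3"
    using mult_mod_3_range[of A B] by (simp add: carrier_SL_2_3 mult_SL_2_3 SL_2_3_list_def)
next
  fix A B C :: int_matrix_2
  obtain a b c d where A: "A = ((a, b), (c, d))" by (metis surj_pair)
  obtain a' b' c' d' where B: "B = ((a', b'), (c', d'))" by (metis surj_pair)
  obtain a'' b'' c'' d'' where C: "C = ((a'', b''), (c'', d''))" by (metis surj_pair)
  have "(a * a' + b * c') * x + (a * b' + b * d') * y = a * (a' * x + b' * y) + b * (c' * x + d' * y)"
    for a b x y :: int by (simp add: algebra_simps)
  then show "A \<otimes>\<^bsub>SL_2_3\<^esub> B \<otimes>\<^bsub>SL_2_3\<^esub> C = A \<otimes>\<^bsub>SL_2_3\<^esub> (B \<otimes>\<^bsub>SL_2_3\<^esub> C)"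
    by (simp only: A B C mult_SL_2_3 mult_mod_3_def prod.case bilinear_mod)
next
  fix A assume A: "A \<in> carrier SL_2_3"
  then have i: "det_mod_3 (inverse_mod_3 A) = 1 \<and> mult_mod_3 (inverse_mod_3 A) A = id_matrix \<and>
      mult_mod_3 id_matrix A = A \<and> inverse_mod_3 A \<in> set matrices_mod_3"
    using SL_2_3_list_inverse unfolding list_all_iff carrier_SL_2_3 by blast
  then show "\<one>\<^bsub>SL_2_3\<^esub> \<otimes>\<^bsub>SL_2_3\<^esub> A = A" by (simp only: one_SL_2_3 mult_SL_2_3)
  have "inverse_mod_3 A \<in> carrier SL_2_3" using i by (simp add: carrier_SL_2_3 SL_2_3_list_def)
  then show "\<exists>B \<in> carrier SL_2_3. B \<otimes>\<^bsub>SL_2_3\<^esub> A = \<one>\<^bsub>SL_2_3\<^esub>"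
    using i by (intro bexI[of _ "inverse_mod_3 A"]) (simp_all only: one_SL_2_3 mult_SL_2_3)
next
  show "\<one>\<^bsub>SL_2_3\<^esub> \<in> carrier SL_2_3"
    by (simp add: one_SL_2_3 carrier_SL_2_3 SL_2_3_list_def set_matrices_mod_3 det_mod_3_def)
qed

text \<open>The products \<open>i\<^sup>p j\<^sup>q\<close>, which form the normal quaternion subgroup.\<close>

definition quaternion_matrices :: "int_matrix_2 list" where
  "quaternion_matrices = (let i = ((0, 1), (2, 0)); j = ((2, 1), (1, 1)); i2 = mult_mod_3 i i; i3 = mult_mod_3 i2 i in
     [id_matrix, i, i2, i3, j, mult_mod_3 i j, mult_mod_3 i2 j, mult_mod_3 i3 j])"

text \<open>The quaternion subgroup has three cosets, and they are represented by the powers of a matrix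
  of order 3.\<close>

lemma SL_2_3_list_generated:
  "list_all (\<lambda>A. A \<in> set (concat (map (\<lambda>B. [B, mult_mod_3 B ((1, 0), (1, 1)),
     mult_mod_3 (mult_mod_3 B ((1, 0), (1, 1))) ((1, 0), (1, 1))]) quaternion_matrices))) SL_2_3_list"
  by code_simp

lemma length_SL_2_3_list: "length SL_2_3_list = 24"
  by code_simp

lemma distinct_SL_2_3_list: "distinct SL_2_3_list"
  unfolding SL_2_3_list_def matrices_mod_3_def Let_def
  by (intro distinct_filter distinct_product) simp_all

lemma SL_2_3_presented:
  "presented_by SL_2_3 SL_2_3_relations" "card (carrier SL_2_3) = 24"
proof -
  interpret group SL_2_3 by (rule group_SL_2_3)
  show "card (carrier SL_2_3) = 24"
    using distinct_card[OF distinct_SL_2_3_list] length_SL_2_3_list by (simp add: carrier_SL_2_3)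
  let ?i = "((0, 1), (2, 0)) :: int_matrix_2" and ?j = "((2, 1), (1, 1)) :: int_matrix_2"
    and ?c = "((1, 0), (1, 1)) :: int_matrix_2"
  have mem: "?i \<in> carrier SL_2_3" "?j \<in> carrier SL_2_3" "?c \<in> carrier SL_2_3"
    by (simp_all add: carrier_SL_2_3 SL_2_3_list_def set_matrices_mod_3 det_mod_3_def)
  have pow: "?i [^]\<^bsub>SL_2_3\<^esub> (2::nat) = ((2, 0), (0, 2))" "?i [^]\<^bsub>SL_2_3\<^esub> (3::nat) = ((0, 2), (1, 0))"
    "?i [^]\<^bsub>SL_2_3\<^esub> (4::nat) = id_matrix" "?j [^]\<^bsub>SL_2_3\<^esub> (2::nat) = ((2, 0), (0, 2))"
    "?c [^]\<^bsub>SL_2_3\<^esub> (3::nat) = id_matrix"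
    by (simp_all add: numeral_eq_Suc mult_SL_2_3 one_SL_2_3 mult_mod_3_def)
  have "?j \<otimes>\<^bsub>SL_2_3\<^esub> ?i = ?i [^]\<^bsub>SL_2_3\<^esub> (3::nat) \<otimes>\<^bsub>SL_2_3\<^esub> ?j" "?c \<otimes>\<^bsub>SL_2_3\<^esub> ?i = ?j \<otimes>\<^bsub>SL_2_3\<^esub> ?c"
    "?c \<otimes>\<^bsub>SL_2_3\<^esub> ?j = (?i \<otimes>\<^bsub>SL_2_3\<^esub> ?j) \<otimes>\<^bsub>SL_2_3\<^esub> ?c"
    unfolding pow by (simp_all add: mult_SL_2_3 mult_mod_3_def)
  then have rel: "?j \<otimes>\<^bsub>SL_2_3\<^esub> ?i \<otimes>\<^bsub>SL_2_3\<^esub> inv\<^bsub>SL_2_3\<^esub> ?j = ?i [^]\<^bsub>SL_2_3\<^esub> (3::nat)"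
    "?c \<otimes>\<^bsub>SL_2_3\<^esub> ?i \<otimes>\<^bsub>SL_2_3\<^esub> inv\<^bsub>SL_2_3\<^esub> ?c = ?j"
    "?c \<otimes>\<^bsub>SL_2_3\<^esub> ?j \<otimes>\<^bsub>SL_2_3\<^esub> inv\<^bsub>SL_2_3\<^esub> ?c = ?i \<otimes>\<^bsub>SL_2_3\<^esub> ?j"
    using mem by (simp_all add: inv_solve_right')
  have "generate SL_2_3 {?i, ?j, ?c} = carrier SL_2_3"
  proof
    let ?H = "generate SL_2_3 {?i, ?j, ?c}"
    show "?H \<subseteq> carrier SL_2_3" using mem by (intro generate_incl) simp
    have cl: "mult_mod_3 A B \<in> ?H" if "A \<in> ?H" "B \<in> ?H" for A B
      using generate.eng[OF that] by (simp add: mult_SL_2_3)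
    have g: "?i \<in> ?H" "?j \<in> ?H" "?c \<in> ?H" "id_matrix \<in> ?H"
      using generate.one[of SL_2_3] by (simp_all add: generate.incl one_SL_2_3)
    have i2: "mult_mod_3 ?i ?i \<in> ?H" by (rule cl[OF g(1,1)])
    have i3: "mult_mod_3 (mult_mod_3 ?i ?i) ?i \<in> ?H" by (rule cl[OF i2 g(1)])
    have "list_all (\<lambda>B. B \<in> ?H) quaternion_matrices"
      unfolding quaternion_matrices_def Let_def list.pred_inject(2)
      using g(1,2,4) i2 i3 cl[OF g(1,2)] cl[OF i2 g(2)] cl[OF i3 g(2)] by (intro conjI list.pred_inject(1))
    then have q: "B \<in> ?H" if "B \<in> set quaternion_matrices" for B
      using that unfolding list_all_iff by blast
    show "carrier SL_2_3 \<subseteq> ?H"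
    proof
      fix A assume "A \<in> carrier SL_2_3"
      then have "A \<in> set (concat (map (\<lambda>B. [B, mult_mod_3 B ?c, mult_mod_3 (mult_mod_3 B ?c) ?c]) quaternion_matrices))"
        using SL_2_3_list_generated unfolding carrier_SL_2_3 list_all_iff by blast
      then obtain B where "B \<in> set quaternion_matrices"
        "A = B \<or> A = mult_mod_3 B ?c \<or> A = mult_mod_3 (mult_mod_3 B ?c) ?c" by auto
      then show "A \<in> ?H" using q cl g(3) by blast
    qed
  qed
  then show "presented_by SL_2_3 SL_2_3_relations"
    using mem pow rel
    by (intro presented_by_three_gensI) (simp_all only: satisfies_SL_2_3 three_gens.case one_SL_2_3 simp_thms)
qed

lemma SL_2_3_centralizers:
  assumes "A \<in> carrier SL_2_3 - center SL_2_3"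
  shows "card (centralizer SL_2_3 A) \<le> 6"
proof -
  interpret group SL_2_3 by (rule group_SL_2_3)
  have "A \<noteq> id_matrix"
    using assms subgroup.one_closed[OF subgroup_center] by (auto simp: one_SL_2_3)
  moreover have "((2, 0), (0, 2)) \<in> center SL_2_3"
    unfolding center_def carrier_SL_2_3
    by (auto simp: mult_SL_2_3 mult_mod_3_def SL_2_3_list_def set_matrices_mod_3 det_mod_3_def mult.commute)
  then have "A \<noteq> ((2, 0), (0, 2))" using assms by blast
  ultimately have "length (filter (\<lambda>B. mult_mod_3 A B = mult_mod_3 B A) SL_2_3_list) \<le> 6"
    using assms SL_2_3_list_centralizers unfolding list_all_iff carrier_SL_2_3 by blast
  then have "card (set (filter (\<lambda>B. mult_mod_3 A B = mult_mod_3 B A) SL_2_3_list)) \<le> 6"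
    by (rule order_trans[OF card_length])
  moreover have "centralizer SL_2_3 A = set (filter (\<lambda>B. mult_mod_3 A B = mult_mod_3 B A) SL_2_3_list)"
    by (simp add: centralizer_def carrier_SL_2_3 mult_SL_2_3)
  ultimately show ?thesis by (simp only:)
qed

section \<open>Centralizers in the listed groups\<close>

context finite_group
begin

lemma centralizer_le_half:
  assumes "x \<in> carrier G" "x \<notin> center G"
  shows "2 * card (centralizer G x) \<le> order G"
proof -
  obtain k where k: "order G = card (centralizer G x) * k" using centralizer_proper(1)[OF assms] by (elim dvdE)
  have "k \<noteq> 0" "k \<noteq> 1" using k centralizer_proper(2)[OF assms] order_pos by auto
  then have "2 \<le> k" by simp
  then show ?thesis using k mult_le_mono2[of 2 k "card (centralizer G x)"] by simp
qed

text \<open>A proper subgroup has at most \<open>|G| / 2 \<le> 6\<close> elements, and \<open>|Z| \<ge> 1\<close>.\<close>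

lemma small_centralizers_if_order_le_12:
  assumes "order G \<le> 12" shows "small_centralizers G"
  unfolding small_centralizers_def
proof
  fix x assume x: "x \<in> carrier G - center G"
  then have "2 * card (centralizer G x) \<le> order G" using centralizer_le_half by simp
  moreover have "card (center G) > 0" using card_subgroup_pos[OF subgroup_center] .
  ultimately show "card (centralizer G x) \<le> card (center G) + 5" using assms by linarith
qed

text \<open>As \<open>|C(x)| \<le> |G| / 2\<close>, the centralizer has at most 8 elements and at most \<open>2 |Z|\<close>. One of
  these bounds is at most \<open>|Z| + 5\<close>.\<close>

lemma small_centralizers_if_center_large:
  assumes "order G \<le> 16" "order G \<le> 4 * card (center G)" shows "small_centralizers G"
  unfolding small_centralizers_def
proof
  fix x assume x: "x \<in> carrier G - center G"
  then have "2 * card (centralizer G x) \<le> order G" using centralizer_le_half by simp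
  moreover have "card (center G) > 0" using card_subgroup_pos[OF subgroup_center] .
  ultimately show "card (centralizer G x) \<le> card (center G) + 5" using assms by linarith
qed

lemma generated_with_center:
  assumes "generate G B = carrier G" "B \<subseteq> insert y (insert x (center G))" "x \<in> carrier G" "y \<in> carrier G"
  shows "generate G (insert y (insert x (center G))) = carrier G"
proof
  show "generate G (insert y (insert x (center G))) \<subseteq> carrier G"
    using assms(3,4) center_subset by (intro generate_incl) simp
  show "carrier G \<subseteq> generate G (insert y (insert x (center G)))"
    using mono_generate[OF assms(2)] assms(1) by simp
qed

lemma order_le_4_center_if_conj:
  assumes xy: "x \<in> carrier G" "y \<in> carrier G"
    and B: "generate G B = carrier G" "B \<subseteq> insert y (insert x (center G))"
    and c: "x \<otimes> x \<in> center G" "y \<otimes> y \<in> center G" and t: "t \<in> center G" "y \<otimes> x \<otimes> inv y = t \<otimes> x"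
  shows "order G \<le> 4 * card (center G)"
proof (rule order_le_4_center[OF xy])
  show "generate G (insert y (insert x (center G))) = carrier G"
    by (rule generated_with_center[OF B xy])
  have "commutator G y x = t" using commutator_unique[OF xy(2,1) center_closed[OF t(1)] t(2)] .
  then show "commutator G y x \<in> center G" using t by simp
qed (use c in simp_all)

lemma square_conj_eq:
  assumes "x \<in> carrier G" "y \<in> carrier G" "y \<otimes> x \<otimes> inv y = x [^] (k::nat)" "x [^] (2 * k) = x [^] (2::nat)"
  shows "(x \<otimes> x) \<otimes> y = y \<otimes> (x \<otimes> x)"
proof -
  have "y \<otimes> (x \<otimes> x) \<otimes> inv y = x [^] k \<otimes> x [^] k" using conj_mult[OF assms(2,1,1)] assms(3) by simp
  also have "\<dots> = x \<otimes> x" using assms(1,4) by (simp add: nat_pow_mult numeral_2_eq_2 mult_2)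
  finally have "y \<otimes> (x \<otimes> x) = (x \<otimes> x) \<otimes> y" using commutes_iff_conj[OF assms(2), of "x \<otimes> x"] assms(1) by simp
  then show ?thesis by simp
qed

text \<open>In this and the next three lemmas the generators have central squares and their commutator
  is central, which gives \<open>|G| \<le> 4 |Z|\<close>. Here \<open>c\<close> and \<open>a\<^sup>2\<close> are central, and \<open>a\<^sup>2\<close> is the
  commutator of \<open>a\<close> and \<open>b\<close>.\<close>

lemma small_centralizers_dihedral_type:
  assumes P: "presented_by G (dihedral_type_relations s k)" and s: "s = 0 \<or> s = 2" and ord: "order G \<le> 16"
  shows "small_centralizers G"
proof -
  obtain a b c where sat: "satisfies G (case_three_gens a b c) (dihedral_type_relations s k)"
    and gen: "generate G {a, b, c} = carrier G" using presented_by_three_gensE[OF P] .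
  then have r: "a \<in> carrier G" "b \<in> carrier G" "c \<in> carrier G" "a [^] (4::nat) = \<one>" "b [^] (2::nat) = a [^] s"
    "b \<otimes> a \<otimes> inv b = a [^] (3::nat)" "c \<otimes> a = a \<otimes> c" "c \<otimes> b = b \<otimes> c"
    by (simp_all add: satisfies_dihedral_type)
  have sub: "{a, b, c} \<subseteq> carrier G" using r by simp
  have cZ: "c \<in> center G" using mem_center_iff_generators[OF gen sub r(3)] r(7,8) by simp
  have a6: "a [^] (2 * 3 :: nat) = a [^] (2::nat)" using r(1,4) nat_pow_mult[OF r(1), of 4 2] by simp
  have aa: "a \<otimes> a \<in> center G"
    using mem_center_iff_generators[OF gen sub, of "a \<otimes> a"] r(1) square_conj_eq[OF r(1,2,6) a6]
      center_comm[OF cZ, of "a \<otimes> a"] by (simp add: m_assoc)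
  have "b \<otimes> b = a [^] s" using r(2,5) by (simp add: numeral_2_eq_2)
  then have bb: "b \<otimes> b \<in> center G"
    using s aa r(1) subgroup.one_closed[OF subgroup_center] by (auto simp: numeral_2_eq_2)
  have "b \<otimes> a \<otimes> inv b = (a \<otimes> a) \<otimes> a" using r(1,6) by (simp add: numeral_3_eq_3)
  then have "order G \<le> 4 * card (center G)"
    using order_le_4_center_if_conj[OF r(1,2) gen _ aa bb aa] cZ by blast
  then show ?thesis using small_centralizers_if_center_large ord by blast
qed

lemma small_centralizers_modular:
  assumes P: "presented_by G (metacyclic_relations 8 2 5 0)" and ord: "order G \<le> 16"
  shows "small_centralizers G"
proof -
  obtain a b where sat: "satisfies G (case_two_gens a b) (metacyclic_relations 8 2 5 0)"
    and gen: "generate G {a, b} = carrier G" using presented_by_two_gensE[OF P] .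
  then have r: "a \<in> carrier G" "b \<in> carrier G" "a [^] (8::nat) = \<one>" "b [^] (2::nat) = \<one>"
    "b \<otimes> a \<otimes> inv b = a [^] (5::nat)" by (simp_all add: satisfies_metacyclic)
  have sub: "{a, b} \<subseteq> carrier G" using r by simp
  have a10: "a [^] (2 * 5 :: nat) = a [^] (2::nat)" using r(1,3) nat_pow_mult[OF r(1), of 8 2] by simp
  have aa: "a \<otimes> a \<in> center G"
    using mem_center_iff_generators[OF gen sub, of "a \<otimes> a"] r(1) square_conj_eq[OF r(1,2,5) a10] by (simp add: m_assoc)
  have bb: "b \<otimes> b \<in> center G"
    using r(2,4) subgroup.one_closed[OF subgroup_center] by (simp add: numeral_2_eq_2)
  have t: "(a \<otimes> a) \<otimes> (a \<otimes> a) \<in> center G" using subgroup.m_closed[OF subgroup_center aa aa] .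
  have "b \<otimes> a \<otimes> inv b = (a \<otimes> a) \<otimes> (a \<otimes> a) \<otimes> a" using r(1,5) by (simp add: numeral_eq_Suc m_assoc)
  then have "order G \<le> 4 * card (center G)"
    using order_le_4_center_if_conj[OF r(1,2) gen _ aa bb t] by blast
  then show ?thesis using small_centralizers_if_center_large ord by blast
qed

lemma small_centralizers_inverting:
  assumes P: "presented_by G inverting_relations" and ord: "order G \<le> 16"
  shows "small_centralizers G"
proof -
  obtain a b where sat: "satisfies G (case_two_gens a b) inverting_relations"
    and gen: "generate G {a, b} = carrier G" using presented_by_two_gensE[OF P] .
  then have r: "a \<in> carrier G" "b \<in> carrier G" "a [^] (4::nat) = \<one>"
    "b \<otimes> a \<otimes> inv b = inv a" by (simp_all add: satisfies_inverting)
  have sub: "{a, b} \<subseteq> carrier G" using r by simp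
  have "a [^] (3::nat) \<otimes> a = \<one>" using r(3) by (simp add: numeral_eq_Suc)
  then have inva: "inv a = a [^] (3::nat)" using inv_equality r(1) by simp
  have a6: "a [^] (2 * 3 :: nat) = a [^] (2::nat)" using r(1,3) nat_pow_mult[OF r(1), of 4 2] by simp
  have conj: "b \<otimes> a \<otimes> inv b = a [^] (3::nat)" using r(4) inva by simp
  have aa: "a \<otimes> a \<in> center G"
    using mem_center_iff_generators[OF gen sub, of "a \<otimes> a"] r(1) square_conj_eq[OF r(1,2) conj a6] by (simp add: m_assoc)
  have "(b \<otimes> b) \<otimes> a \<otimes> inv (b \<otimes> b) = b \<otimes> (b \<otimes> a \<otimes> inv b) \<otimes> inv b"
    using r(1,2) by (simp add: m_assoc inv_mult_group)
  also have "\<dots> = inv (b \<otimes> a \<otimes> inv b)" unfolding r(4)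
    using r(1,2) arg_cong[OF r(4), of "m_inv G"] by (simp add: inv_mult_group m_assoc)
  also have "\<dots> = a" using r(1,4) by simp
  finally have "(b \<otimes> b) \<otimes> a = a \<otimes> (b \<otimes> b)" using commutes_iff_conj[of "b \<otimes> b" a] r(1,2) by simp
  then have bb: "b \<otimes> b \<in> center G"
    using mem_center_iff_generators[OF gen sub, of "b \<otimes> b"] r(2) by (simp add: m_assoc)
  have "b \<otimes> a \<otimes> inv b = (a \<otimes> a) \<otimes> a" using r(1) conj by (simp add: numeral_3_eq_3)
  then have "order G \<le> 4 * card (center G)"
    using order_le_4_center_if_conj[OF r(1,2) gen _ aa bb aa] by blast
  then show ?thesis using small_centralizers_if_center_large ord by blast
qed

lemma small_centralizers_C4xC2_sdp_C2:
  assumes P: "presented_by G C4xC2_sdp_C2_relations" and ord: "order G \<le> 16"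
  shows "small_centralizers G"
proof -
  obtain a b c where sat: "satisfies G (case_three_gens a b c) C4xC2_sdp_C2_relations"
    and gen: "generate G {a, b, c} = carrier G" using presented_by_three_gensE[OF P] .
  have r: "a \<in> carrier G" "b \<in> carrier G" "c \<in> carrier G" "b [^] (2::nat) = \<one>" "c [^] (2::nat) = \<one>"
    "a \<otimes> b = b \<otimes> a" "b \<otimes> c = c \<otimes> b" "c \<otimes> a \<otimes> inv c = a \<otimes> b"
    using sat unfolding satisfies_C4xC2_sdp_C2 three_gens.case by blast+
  have sub: "{a, b, c} \<subseteq> carrier G" using r(1,2,3) by simp
  have bZ: "b \<in> center G"
    unfolding mem_center_iff_generators[OF gen sub r(2)] using r(6,7) by (metis empty_iff insert_iff)
  have conj: "c \<otimes> a \<otimes> inv c = b \<otimes> a" using r(6,8) by (rule trans[OF _ _, rotated])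
  have bb: "b \<otimes> b = \<one>" using r(2,4) by (simp add: numeral_2_eq_2)
  have "c \<otimes> (a \<otimes> a) \<otimes> inv c = (b \<otimes> a) \<otimes> (b \<otimes> a)" using conj_mult[OF r(3,1,1)] conj by simp
  also have "\<dots> = b \<otimes> (a \<otimes> b) \<otimes> a" using r(1,2) by (simp add: m_assoc)
  also have "\<dots> = b \<otimes> (b \<otimes> a) \<otimes> a" by (simp only: r(6))
  also have "\<dots> = (b \<otimes> b) \<otimes> (a \<otimes> a)" using r(1,2) by (simp add: m_assoc)
  also have "\<dots> = a \<otimes> a" using bb r(1) by simp
  finally have ca: "c \<otimes> (a \<otimes> a) = (a \<otimes> a) \<otimes> c" using commutes_iff_conj[OF r(3), of "a \<otimes> a"] r(1) by simp
  have aG: "a \<otimes> a \<in> carrier G" using r(1) by simp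
  have aa: "a \<otimes> a \<in> center G"
    unfolding mem_center_iff_generators[OF gen sub aG]
    using m_assoc[OF r(1,1,1)] center_comm[OF bZ aG] ca by (metis empty_iff insert_iff)
  have cc: "c \<otimes> c \<in> center G"
    using r(3,5) subgroup.one_closed[OF subgroup_center] by (simp add: numeral_2_eq_2)
  have "{a, b, c} \<subseteq> insert c (insert a (center G))" using bZ by simp
  then have "order G \<le> 4 * card (center G)"
    using order_le_4_center_if_conj[OF r(1,3) gen _ aa cc bZ conj] by blast
  then show ?thesis using small_centralizers_if_center_large ord by blast
qed

text \<open>A centralizer \<open>C(g)\<close> with more than 6 elements has order 10, hence index two, and contains
  all squares. Then \<open>x = (x\<^sup>3)\<^sup>2\<close> lies in it, so that \<open>g\<close> is a power of \<open>x\<close>, and so does \<open>y\<^sup>2\<close>,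
  which inverts \<open>x\<close>. Only \<open>g = \<one>\<close> remains.\<close>

lemma small_centralizers_order_20:
  assumes P: "presented_by G (metacyclic_relations 5 4 2 0)" and G: "order G = 20"
  shows "small_centralizers G"
  unfolding small_centralizers_def
proof
  fix g assume "g \<in> carrier G - center G"
  then have g: "g \<in> carrier G" "g \<notin> center G" by simp_all
  obtain x y where sat: "satisfies G (case_two_gens x y) (metacyclic_relations 5 4 2 0)"
    and gen: "generate G {x, y} = carrier G" using presented_by_two_gensE[OF P] .
  then have r: "x \<in> carrier G" "y \<in> carrier G" "x [^] (5::nat) = \<one>"
    "y \<otimes> x \<otimes> inv y = x [^] (2::nat)" by (simp_all add: satisfies_metacyclic)
  have x1: "x \<noteq> \<one>"
  proof
    assume "x = \<one>"
    then have "comm_group G" using comm_of_generators[OF gen r(1,2)] r(1,2) by simp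
    then show False using g abelian_iff_center by simp
  qed
  have "ord x dvd 5" using r(1,3) pow_eq_id by simp
  then have ordx: "ord x = 5" using x1 ord_eq_1[OF r(1)] prime_nat_iff[of 5] by auto
  have conj2: "(y \<otimes> y) \<otimes> x \<otimes> inv (y \<otimes> y) = x [^] (4::nat)"
  proof -
    have "(y \<otimes> y) \<otimes> x \<otimes> inv (y \<otimes> y) = y \<otimes> (y \<otimes> x \<otimes> inv y) \<otimes> inv y"
      using r(1,2) by (simp add: m_assoc inv_mult_group)
    also have "\<dots> = (y \<otimes> x \<otimes> inv y) [^] (2::nat)" unfolding r(4) using conj_pow[OF r(2,1), of 2] r(4) by simp
    also have "\<dots> = x [^] (4::nat)" unfolding r(4) using r(1) by (simp add: nat_pow_pow)
    finally show ?thesis .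
  qed
  have not_half: "card (centralizer G x) \<noteq> 10"
  proof
    assume "card (centralizer G x) = 10"
    then have "y \<otimes> y \<in> centralizer G x" using index2_square[OF subgroup_centralizer[OF r(1)] _ r(2)] G by simp
    then have "(y \<otimes> y) \<otimes> x \<otimes> inv (y \<otimes> y) = x"
      using commutes_iff_conj[of "y \<otimes> y" x] r(1,2) by (simp add: centralizer_def)
    then have "x [^] (4::nat) = x [^] (1::nat)" using conj2 r(1) by simp
    then show False using pow_eq_pow_iff[OF r(1), of 4 1] ordx by (simp add: cong_def)
  qed
  have xnc: "x \<notin> center G"
  proof
    assume "x \<in> center G"
    then have "y \<otimes> x = x \<otimes> y" using center_comm[of x y] r(2) by simp
    then have "x [^] (2::nat) = x [^] (1::nat)" using commutes_iff_conj[OF r(2,1)] r(1,4) by simp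
    then show False using pow_eq_pow_iff[OF r(1), of 2 1] ordx by (simp add: cong_def)
  qed
  have cx: "card (centralizer G x) = 5"
  proof -
    have "5 dvd card (centralizer G x)"
      using ord_dvd_card_centralizer[OF r(1) self_in_centralizer[OF r(1)]] ordx by simp
    moreover have "card (centralizer G x) \<le> 10" using centralizer_le_half[OF r(1) xnc] G by simp
    moreover have "card (centralizer G x) > 0" using card_subgroup_pos[OF subgroup_centralizer[OF r(1)]] .
    ultimately show ?thesis using not_half by (auto elim!: dvdE)
  qed
  have Cx: "generate G {x} = centralizer G x"
  proof (rule card_subset_eq)
    show "generate G {x} \<subseteq> centralizer G x"
      using generate_subgroup_incl[OF _ subgroup_centralizer[OF r(1)], of "{x}"] self_in_centralizer[OF r(1)] by simp
  qed (use r(1) card_generate_singleton ordx cx in simp_all)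
  have "card (centralizer G g) \<noteq> 10"
  proof
    assume "card (centralizer G g) = 10"
    then have sq: "u \<otimes> u \<in> centralizer G g" if "u \<in> carrier G" for u
      using index2_square[OF subgroup_centralizer[OF g(1)] _ that] G by simp
    have "x [^] (3::nat) \<otimes> x [^] (3::nat) = x [^] (6::nat)" using r(1) by (simp add: nat_pow_mult)
    also have "\<dots> = x [^] (1::nat)" using pow_eq_pow_iff[OF r(1), of 6 1] ordx by (simp add: cong_def)
    finally have "x \<in> centralizer G g" using sq[of "x [^] (3::nat)"] r(1) by simp
    then have "g \<in> generate G {x}" using centralizer_sym[OF g(1)] Cx by simp
    from generate_singleton_elem[OF r(1) this] obtain i where i: "i < ord x" "g = x [^] i" by blast
    have "y \<otimes> y \<in> centralizer G g" using sq[OF r(2)] .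
    then have "(y \<otimes> y) \<otimes> g \<otimes> inv (y \<otimes> y) = g"
      using commutes_iff_conj[of "y \<otimes> y" g] g(1) r(2) by (simp add: centralizer_def)
    then have "(x [^] (4::nat)) [^] i = x [^] i"
      using conj_pow[of "y \<otimes> y" x i] r(1,2) conj2 i(2) by simp
    then have "[4 * i = i] (mod 5)" using pow_eq_pow_iff[OF r(1)] r(1) ordx by (simp add: nat_pow_pow)
    then have "i = 0" using i(1) ordx unfolding cong_def by simp presburger
    then have "g = \<one>" using i(2) by simp
    then show False using g(2) subgroup.one_closed[OF subgroup_center] by simp
  qed
  moreover have "card (centralizer G g) dvd 20" "2 * card (centralizer G g) \<le> 20"
    using centralizer_proper(1)[OF g] centralizer_le_half[OF g] G by simp_all
  moreover have "card (centralizer G g) \<noteq> 7" "card (centralizer G g) \<noteq> 8" "card (centralizer G g) \<noteq> 9"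
    using \<open>card (centralizer G g) dvd 20\<close> by (intro notI; simp)+
  ultimately have "card (centralizer G g) \<le> 6" by linarith
  moreover have "card (center G) > 0" using card_subgroup_pos[OF subgroup_center] .
  ultimately show "card (centralizer G g) \<le> card (center G) + 5" by linarith
qed

end

section \<open>The degree of a vertex and its invariance\<close>

lemma small_centralizers_iso:
  assumes "G \<cong> H" "group G" "group H" "small_centralizers H"
  shows "small_centralizers G"
proof -
  interpret G: group G by (rule assms(2))
  interpret H: group H by (rule assms(3))
  obtain h where h: "h \<in> hom G H" "bij_betw h (carrier G) (carrier H)" using assms(1) by (auto simp: is_iso_def iso_def)
  have im: "h ` carrier G = carrier H" and inj: "inj_on h (carrier G)" using h(2) by (simp_all add: bij_betw_def)
  have hc: "h x \<in> carrier H" if "x \<in> carrier G" for x using that im by blast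
  have comm: "h x \<otimes>\<^bsub>H\<^esub> h y = h y \<otimes>\<^bsub>H\<^esub> h x \<longleftrightarrow> x \<otimes>\<^bsub>G\<^esub> y = y \<otimes>\<^bsub>G\<^esub> x"
    if "x \<in> carrier G" "y \<in> carrier G" for x y
    using that hom_mult[OF h(1)] inj_on_eq_iff[OF inj, of "x \<otimes>\<^bsub>G\<^esub> y" "y \<otimes>\<^bsub>G\<^esub> x"] by simp
  have cent: "centralizer H (h x) = h ` centralizer G x" if x: "x \<in> carrier G" for x
    unfolding centralizer_def im[symmetric] using comm[OF x] by blast
  have card_cent: "card (centralizer H (h x)) = card (centralizer G x)" if "x \<in> carrier G" for x
    unfolding cent[OF that]
    by (intro card_image inj_on_subset[OF inj] subgroup.subset[OF G.subgroup_centralizer[OF that]])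
  have center: "center H = h ` center G"
    unfolding center_def im[symmetric] using comm by blast
  then have card_center: "card (center H) = card (center G)"
    using inj G.center_subset by (simp add: card_image inj_on_subset)
  show ?thesis
    unfolding small_centralizers_def
  proof
    fix x assume x: "x \<in> carrier G - center G"
    then have "h x \<notin> center H"
      unfolding center using inj_on_image_mem_iff[OF inj, of x "center G"] G.center_subset by simp
    then have "h x \<in> carrier H - center H" using hc x by blast
    then have "card (centralizer H (h x)) \<le> card (center H) + 5"
      using assms(4) unfolding small_centralizers_def by blast
    then show "card (centralizer G x) \<le> card (center G) + 5"
      using x card_cent[of x] card_center by simp
  qed
qed

text \<open>The neighbours of \<open>x\<close> are the elements of \<open>C(x) - Z\<close> other than \<open>x\<close>.\<close>

lemma (in finite_group) max_degree_commuting_graph: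
  assumes "\<not> comm_group G"
  shows "max_degree (with_proj (commuting_graph G)) < 5 \<longleftrightarrow> small_centralizers G"
proof -
  let ?V = "carrier G - center G" and ?\<Gamma> = "with_proj (commuting_graph G)"
  have verts: "verts ?\<Gamma> = ?V" by (simp add: commuting_graph_def)
  have deg: "out_degree ?\<Gamma> x = card (centralizer G x) - card (center G) - 1" if x: "x \<in> ?V" for x
  proof -
    have "out_arcs ?\<Gamma> x = (\<lambda>y. (x, y)) ` (centralizer G x - center G - {x})"
      using x by (auto simp: out_arcs_def commuting_graph_def centralizer_def)
    then have "out_degree ?\<Gamma> x = card (centralizer G x - center G - {x})"
      by (simp add: out_degree_def card_image inj_on_def)
    also have "\<dots> = card (centralizer G x) - card (center G) - 1"
      using x self_in_centralizer center_subset_centralizer by (simp add: card_Diff_subset card_Diff_singleton)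
    finally show ?thesis .
  qed
  have "?V \<noteq> {}" using not_comm_noncentral[OF assms] by blast
  then have "max_degree ?\<Gamma> < 5 \<longleftrightarrow> (\<forall>x \<in> ?V. out_degree ?\<Gamma> x < 5)"
    unfolding max_degree_def verts by (subst Max_less_iff) simp_all
  also have "\<dots> \<longleftrightarrow> (\<forall>x \<in> ?V. card (centralizer G x) - card (center G) - 1 < 5)" using deg by simp
  also have "\<dots> \<longleftrightarrow> small_centralizers G"
    unfolding small_centralizers_def by (intro ball_cong refl) linarith
  finally show ?thesis .
qed

section \<open>The classification\<close>

lemma sym_group_3_presented:
  "presented_by (sym_group 3) (metacyclic_relations 3 2 2 0)" "card (carrier (sym_group 3)) = 6"
proof -
  show c: "card (carrier (sym_group 3)) = 6" by (simp add: sym_group_card_carrier fact_numeral)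
  interpret finite_group "sym_group 3"
    using c sym_group_is_group by (simp add: finite_group_def finite_group_axioms_def card_ge_0_finite)
  let ?p = "transpose 1 2 :: nat \<Rightarrow> nat" and ?q = "transpose 2 3 :: nat \<Rightarrow> nat"
  have "?p \<in> carrier (sym_group 3)" "?q \<in> carrier (sym_group 3)"
    by (auto simp: sym_group_carrier intro!: permutes_swap_id)
  moreover have "(?p \<circ> ?q) 1 \<noteq> (?q \<circ> ?p) 1" by (simp add: transpose_def)
  then have "?p \<circ> ?q \<noteq> ?q \<circ> ?p" by metis
  ultimately have "\<not> comm_group (sym_group 3)"
    using comm_monoid.m_comm[OF comm_group.axioms(1), of "sym_group 3" ?p ?q] by (auto simp: sym_group_mult)
  then show "presented_by (sym_group 3) (metacyclic_relations 3 2 2 0)"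
    using order_2p_nonabelian[of 3] c by (simp add: order_def)
qed

lemma C8_sdp_C2_eq: "C8_sdp_C2 = presented_group (metacyclic_relations 8 2 5 0)"
  by (simp add: C8_sdp_C2_def metacyclic_relations_def gen_pow_def)

lemma C4_sdp_C4_eq: "C4_sdp_C4 = presented_group inverting_relations"
  by (simp add: C4_sdp_C4_def inverting_relations_def)

lemma C4xC2_sdp_C2_eq: "C4xC2_sdp_C2 = presented_group C4xC2_sdp_C2_relations"
  by (simp add: C4xC2_sdp_C2_def C4xC2_sdp_C2_relations_def)

lemma iso_presented_group_of_order:
  assumes "presented_by G R" "presents_at_most R n" "card (carrier G) = n"
  shows "G \<cong> presented_group R"
  using assms group.iso_presented_group[of G] by (auto simp: presented_by_def presents_at_most_def)

lemma finite_group_presented_group: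
  assumes "presents_at_most R n"
  shows "finite_group (presented_group R)" "order (presented_group R) \<le> n"
  using assms group_presented_group
  by (auto simp: presents_at_most_def finite_group_def finite_group_axioms_def order_def)

lemma finite_group_if_presented:
  assumes "presented_by G R" "card (carrier G) = n" "n > 0"
  shows "finite_group G"
  using assms by (simp add: presented_by_def finite_group_def finite_group_axioms_def card_ge_0_finite)

abbreviation listed :: "('a, 'b) monoid_scheme \<Rightarrow> bool" where
  "listed G \<equiv> G \<cong> sym_group 3 \<or> G \<cong> dihedral_group 5 \<or> G \<cong> alt_group 4 \<or> G \<cong> GA_1_5 \<or> G \<cong> alt_group 5 \<or>
      G \<cong> dihedral_group 4 \<or> G \<cong> quaternion_group \<or>
      G \<cong> dihedral_group 6 \<or> G \<cong> C3_sdp_C4 \<or> G \<cong> SL_2_3 \<or>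
      G \<cong> C4xC2_sdp_C2 \<or> G \<cong> C4_sdp_C4 \<or> G \<cong> C8_sdp_C2 \<or>
      G \<cong> dihedral_group 4 \<times>\<times> cyclic 2 \<or> G \<cong> quaternion_group \<times>\<times> cyclic 2 \<or> G \<cong> D8_central_C4"

text \<open>The center has one, two or at least three elements. In the last case three cosets of \<open>Z\<close> are
  too many for \<open>C(x)\<close>, so \<open>|C(x)| = 2 |Z| \<le> |Z| + 5\<close>; as \<open>|Z|\<close> is even, it is 4.\<close>

lemma (in finite_group) listed_if_small_centralizers:
  assumes nc: "\<not> comm_group G" and small: "small_centralizers G"
  shows "listed G"
proof -
  have small': "card (centralizer G x) \<le> card (center G) + 5" if "x \<in> carrier G" "x \<notin> center G" for x
    using small that by (simp add: small_centralizers_def)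
  have one: "\<one> \<in> center G" using subgroup.one_closed[OF subgroup_center] .
  have "card (center G) > 0" using card_subgroup_pos[OF subgroup_center] .
  then consider "card (center G) = 1" | "card (center G) = 2" | "card (center G) \<ge> 3" by linarith
  then show ?thesis
  proof cases
    case 1
    then obtain w where "center G = {w}" by (rule card_1_singletonE)
    then have Z: "center G = {\<one>}" using one by simp
    interpret trivial_center_case G
      by unfold_locales (use nc Z small' in auto)
    show ?thesis
      using classification
      iso_of_same_presentation[OF _ sym_group_3_presented(1) presents_metacyclic[of 3 2], of G]
      iso_of_same_presentation[OF _ dihedral_group_presented(1)[of 5] presents_metacyclic[of 5 2], of G]
      iso_of_same_presentation[OF _ GA_1_5_presented(1) presents_metacyclic[of 5 4], of G]
      sym_group_3_presented(2) dihedral_group_presented(2)[of 5] GA_1_5_presented(2)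
      by (simp add: order_def) blast
  next
    case 2
    then obtain u v where uv: "center G = {u, v}" "u \<noteq> v" by (auto simp: card_2_iff)
    then obtain z where Z: "center G = {\<one>, z}" "z \<noteq> \<one>"
      using one by (cases "u = \<one>") auto
    interpret center_2_case G z
      by unfold_locales (use nc Z small' in auto)
    show ?thesis
      using classification
      iso_of_same_presentation[OF _ dihedral_group_presented(1)[of 4] presents_metacyclic[of 4 2], of G]
      iso_of_same_presentation[OF _ quaternion_group_presented(1) presents_metacyclic[of 4 2], of G]
      iso_of_same_presentation[OF _ dihedral_group_presented(1)[of 6] presents_metacyclic[of 6 2], of G]
      iso_of_same_presentation[OF _ C3_sdp_C4_presented(1) presents_metacyclic[of 3 4], of G]
      iso_of_same_presentation[OF _ SL_2_3_presented(1) presents_SL_2_3, of G]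
      dihedral_group_presented(2)[of 4] quaternion_group_presented(2) dihedral_group_presented(2)[of 6]
      C3_sdp_C4_presented(2) SL_2_3_presented(2)
      by (simp add: order_def) blast
  next
    case 3
    have half: "card (centralizer G x) = 2 * card (center G)" if x: "x \<in> carrier G" "x \<notin> center G" for x
    proof -
      obtain k where k: "card (centralizer G x) = card (center G) * k"
        using centralizer_proper(3)[OF x] by (elim dvdE)
      have "k \<noteq> 0" "k \<noteq> 1" using k centralizer_proper(4)[OF x] by auto
      moreover have "k < 3"
      proof (rule ccontr)
        assume "\<not> k < 3"
        then have "card (center G) * 3 \<le> card (centralizer G x)" using k by simp
        then show False using small'[OF x] 3 by linarith
      qed
      ultimately have "k = 2" by linarith
      then show ?thesis using k by simp
    qed
    interpret center_half_case G
      by unfold_locales (use nc half in auto)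
    obtain x where x: "x \<in> carrier G" "x \<notin> center G" using not_comm_noncentral[OF nc] .
    have "card (center G) \<le> 5" using small'[OF x] half[OF x] by linarith
    then have "card (center G) = 4" using 3 even_card_center by presburger
    then interpret center_4_case G by unfold_locales
    have card: "card (carrier G) = 16" using order_16 by (simp add: order_def)
    have m: "presents_at_most (metacyclic_relations 8 2 5 0) 16"
      using presents_metacyclic[of 8 2 5 0] by simp
    show ?thesis
      unfolding C4xC2_sdp_C2_eq C4_sdp_C4_eq C8_sdp_C2_eq
      using classification
      iso_presented_group_of_order[OF _ presents_C4xC2_sdp_C2 card]
      iso_presented_group_of_order[OF _ presents_inverting card]
      iso_presented_group_of_order[OF _ m card]
      iso_of_same_presentation[OF _ dihedral_4_C2_presented(1) presents_dihedral_type card dihedral_4_C2_presented(2)]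
      iso_of_same_presentation[OF _ quaternion_C2_presented(1) presents_dihedral_type card quaternion_C2_presented(2)]
      iso_of_same_presentation[OF _ D8_central_C4_presented(1) presents_dihedral_type card D8_central_C4_presented(2)]
      by blast
  qed
qed

lemma (in finite_group) small_centralizers_if_card_le_6:
  assumes "\<And>x. x \<in> carrier G - center G \<Longrightarrow> card (centralizer G x) \<le> 6"
  shows "small_centralizers G"
proof -
  have "card (center G) > 0" using card_subgroup_pos[OF subgroup_center] .
  then show ?thesis unfolding small_centralizers_def using assms by fastforce
qed

definition has_small_centralizers :: "('a, 'b) monoid_scheme \<Rightarrow> bool" where
  "has_small_centralizers L \<longleftrightarrow> finite_group L \<and> small_centralizers L"

lemma has_small_centralizers_iso:
  assumes "group G" "has_small_centralizers L" "G \<cong> L" shows "small_centralizers G"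
  using assms small_centralizers_iso[OF assms(3,1)] by (simp add: has_small_centralizers_def finite_group_def)

lemma has_small_centralizers_order_le_12:
  assumes "group L" "card (carrier L) = n" "0 < n" "n \<le> 12" shows "has_small_centralizers L"
proof -
  have "finite_group L" using assms by (simp add: finite_group_def finite_group_axioms_def card_ge_0_finite)
  then show ?thesis
    using finite_group.small_centralizers_if_order_le_12[of L] assms by (simp add: has_small_centralizers_def order_def)
qed

lemma has_small_centralizers_dihedral_type:
  assumes "presented_by L (dihedral_type_relations s k)" "s = 0 \<or> s = 2" "card (carrier L) = 16"
  shows "has_small_centralizers L"
proof -
  have "finite_group L" using finite_group_if_presented[OF assms(1,3)] by simp
  then show ?thesis
    using finite_group.small_centralizers_dihedral_type[OF _ assms(1,2)] assms(3)
    by (simp add: has_small_centralizers_def order_def)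
qed

lemma has_small_centralizers_list:
  "has_small_centralizers (sym_group 3)" "has_small_centralizers (dihedral_group 5)"
  "has_small_centralizers (alt_group 4)" "has_small_centralizers GA_1_5" "has_small_centralizers (alt_group 5)"
  "has_small_centralizers (dihedral_group 4)" "has_small_centralizers quaternion_group"
  "has_small_centralizers (dihedral_group 6)" "has_small_centralizers C3_sdp_C4" "has_small_centralizers SL_2_3"
  "has_small_centralizers C4xC2_sdp_C2" "has_small_centralizers C4_sdp_C4" "has_small_centralizers C8_sdp_C2"
  "has_small_centralizers (dihedral_group 4 \<times>\<times> cyclic 2)"
  "has_small_centralizers (quaternion_group \<times>\<times> cyclic 2)" "has_small_centralizers D8_central_C4"
proof -
  have D: "group (dihedral_group n)" if "n \<ge> 2" for n
    using dihedral_group_presented(1)[OF that] by (simp add: presented_by_def)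
  show "has_small_centralizers (sym_group 3)"
    using has_small_centralizers_order_le_12[OF sym_group_is_group sym_group_3_presented(2)] by simp
  show "has_small_centralizers (dihedral_group 5)" "has_small_centralizers (dihedral_group 4)"
    "has_small_centralizers (dihedral_group 6)"
    using has_small_centralizers_order_le_12[OF D[of 5] dihedral_group_presented(2)[of 5]]
      has_small_centralizers_order_le_12[OF D[of 4] dihedral_group_presented(2)[of 4]]
      has_small_centralizers_order_le_12[OF D[of 6] dihedral_group_presented(2)[of 6]] by simp_all
  have "2 * card (carrier (alt_group 4)) = 24" using alt_group_card_carrier[of 4] by (simp add: fact_numeral)
  then show "has_small_centralizers (alt_group 4)"
    using has_small_centralizers_order_le_12[OF alt_group_is_group, of 4 12] by simp
  show "has_small_centralizers quaternion_group"
    using has_small_centralizers_order_le_12[OF group_quaternion_group quaternion_group_presented(2)] by simp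
  show "has_small_centralizers C3_sdp_C4"
    using has_small_centralizers_order_le_12[OF _ C3_sdp_C4_presented(2)] C3_sdp_C4_presented(1)
    by (simp add: presented_by_def)
  show "has_small_centralizers GA_1_5"
    using finite_group_if_presented[OF GA_1_5_presented]
      finite_group.small_centralizers_order_20[OF _ GA_1_5_presented(1)] GA_1_5_presented(2)
    by (simp add: has_small_centralizers_def order_def)
  have "2 * card (carrier (alt_group 5)) = 120" using alt_group_card_carrier[of 5] by (simp add: fact_numeral)
  then have A5: "finite_group (alt_group 5)"
    using alt_group_is_group[of 5] by (simp add: finite_group_def finite_group_axioms_def card_ge_0_finite)
  have "card (centralizer (alt_group 5) x) \<le> 6" if "x \<in> carrier (alt_group 5) - center (alt_group 5)" for x
  proof -
    have "x \<noteq> \<one>\<^bsub>alt_group 5\<^esub>"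
      using that subgroup.one_closed[OF group.subgroup_center[OF alt_group_is_group, of 5]] by auto
    then show ?thesis using alt_group_5_centralizer[of x] that by simp
  qed
  then show "has_small_centralizers (alt_group 5)"
    using A5 finite_group.small_centralizers_if_card_le_6[OF A5] by (simp add: has_small_centralizers_def)
  have SL: "finite_group SL_2_3" using finite_group_if_presented[OF SL_2_3_presented] by simp
  then show "has_small_centralizers SL_2_3"
    using finite_group.small_centralizers_if_card_le_6[OF SL SL_2_3_centralizers] by (simp add: has_small_centralizers_def)
  show "has_small_centralizers C4xC2_sdp_C2"
    using finite_group_presented_group[OF presents_C4xC2_sdp_C2]
      finite_group.small_centralizers_C4xC2_sdp_C2[OF _ presented_by_presented_group]
    by (simp add: C4xC2_sdp_C2_eq has_small_centralizers_def)
  show "has_small_centralizers C4_sdp_C4"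
    using finite_group_presented_group[OF presents_inverting]
      finite_group.small_centralizers_inverting[OF _ presented_by_presented_group]
    by (simp add: C4_sdp_C4_eq has_small_centralizers_def)
  show "has_small_centralizers C8_sdp_C2"
    using finite_group_presented_group[OF presents_metacyclic[of 8 2 5 0]]
      finite_group.small_centralizers_modular[OF _ presented_by_presented_group]
    by (simp add: C8_sdp_C2_eq has_small_centralizers_def)
  show "has_small_centralizers (dihedral_group 4 \<times>\<times> cyclic 2)"
    using has_small_centralizers_dihedral_type[OF dihedral_4_C2_presented(1) _ dihedral_4_C2_presented(2)] by simp
  show "has_small_centralizers (quaternion_group \<times>\<times> cyclic 2)"
    using has_small_centralizers_dihedral_type[OF quaternion_C2_presented(1) _ quaternion_C2_presented(2)] by simp
  show "has_small_centralizers D8_central_C4"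
    using has_small_centralizers_dihedral_type[OF D8_central_C4_presented(1) _ D8_central_C4_presented(2)] by simp
qed

lemma small_centralizers_if_listed:
  assumes "group G" "listed G"
  shows "small_centralizers G"
  using assms(2) by (elim disjE) (erule has_small_centralizers_iso[OF assms(1), rotated], rule has_small_centralizers_list)+

theorem theorem1p2:
  fixes G :: "('a, 'b) monoid_scheme"
  assumes "group G" and "finite (carrier G)" and "\<not> comm_group G"
  shows "max_degree (with_proj (commuting_graph G)) < 5 \<longleftrightarrow>
      G \<cong> sym_group 3 \<or> G \<cong> dihedral_group 5 \<or> G \<cong> alt_group 4 \<or> G \<cong> GA_1_5 \<or> G \<cong> alt_group 5 \<or>
      G \<cong> dihedral_group 4 \<or> G \<cong> quaternion_group \<or>
      G \<cong> dihedral_group 6 \<or> G \<cong> C3_sdp_C4 \<or> G \<cong> SL_2_3 \<or>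
      G \<cong> C4xC2_sdp_C2 \<or> G \<cong> C4_sdp_C4 \<or> G \<cong> C8_sdp_C2 \<or>
      G \<cong> dihedral_group 4 \<times>\<times> cyclic 2 \<or> G \<cong> quaternion_group \<times>\<times> cyclic 2 \<or> G \<cong> D8_central_C4"
proof -
  interpret finite_group G using assms by (simp add: finite_group_def finite_group_axioms_def)
  show ?thesis
    using max_degree_commuting_graph[OF assms(3)] listed_if_small_centralizers[OF assms(3)]
      small_centralizers_if_listed[OF assms(1)] by blast
qed

end
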